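(* For each prime $p \geq 29$, let $G = \mathbb{Z}_3^2 \oplus \mathbb{Z}_{23} \oplus \mathbb{Z}_p$ and $n = |G| = 207p$. Then \[ 2^{\mu(G)/2 }=2^{4n/23} \ll 3^{n/9} \leq f_{\max}(G) \leq 3^{25n/216+o(n)} \ll 3^{8n/69} = 3^{\mu(G)/3 }. \]
   Context: Here $o(n)$ denotes a quantity with $o(n)/n\to 0$ as $p\to\infty$, and $\ll$ means exponentially smaller. A set $S\subseteq G$ is sum-free if there are no $x,y,z\in S$ (not necessarily distinct) with $x+y=z$. $\mu(G)$ is the maximum size of a sum-free subset of $G$, and $f_{\max}(G)$ is the number of maximal (with respect to inclusion) sum-free subsets of $G$. *)

theory Defs
  imports "HOL-Algebra.Elementary_Groups" "HOL-Library.Landau_Symbols"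
    "HOL-Computational_Algebra.Primes"
begin

text \<open>The groups of HOL-Algebra are written multiplicatively, so the sum $x + y$ is
  \<open>x \<otimes>\<^bsub>G\<^esub> y\<close>.\<close>

definition sum_free :: "('a, 'b) monoid_scheme \<Rightarrow> 'a set \<Rightarrow> bool" where
  "sum_free G S \<longleftrightarrow>
     S \<subseteq> carrier G \<and> \<not> (\<exists>x\<in>S. \<exists>y\<in>S. \<exists>z\<in>S. x \<otimes>\<^bsub>G\<^esub> y = z)"

definition maximal_sum_free :: "('a, 'b) monoid_scheme \<Rightarrow> 'a set \<Rightarrow> bool" where
  "maximal_sum_free G S \<longleftrightarrow>
     sum_free G S \<and> (\<forall>T. sum_free G T \<and> S \<subseteq> T \<longrightarrow> T = S)"

text \<open>The following two notions are meaningful for finite \<open>G\<close> only.\<close>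

definition max_sum_free_size :: "('a, 'b) monoid_scheme \<Rightarrow> nat" (\<open>\<mu>\<close>) where
  "\<mu> G = Max (card ` {S. sum_free G S})"

definition f_max :: "('a, 'b) monoid_scheme \<Rightarrow> nat" where
  "f_max G = card {S. maximal_sum_free G S}"

definition grp :: "nat \<Rightarrow> ((int \<times> int) \<times> int \<times> int) monoid" where
  "grp p = (integer_mod_group 3 \<times>\<times> integer_mod_group 3) \<times>\<times>
           (integer_mod_group 23 \<times>\<times> integer_mod_group p)"

text \<open>The limit \<open>p \<rightarrow> \<infinity>\<close> taken through the primes.\<close>

definition primes_at_top :: "nat filter" where
  "primes_at_top = inf at_top (principal {p. prime p})"

text \<open>\<open>f\<close> is exponentially smaller than \<open>g\<close>, with respect to the size parameter \<open>n\<close>: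
  $f \le e^{-cn} g$ for some constant $c > 0$ and all sufficiently large primes.\<close>

definition exp_smaller ::
    "(nat \<Rightarrow> nat) \<Rightarrow> (nat \<Rightarrow> real) \<Rightarrow> (nat \<Rightarrow> real) \<Rightarrow> bool" where
  "exp_smaller n f g \<longleftrightarrow>
     (\<exists>c>0. \<forall>\<^sub>F p in primes_at_top. f p \<le> exp (- c * real (n p)) * g p)"

end

theory Submission
  imports Defs "HOL-Analysis.Convex" "HOL-Library.Set_Algebras" "HOL-Library.Product_Plus"
    "HOL-Real_Asymp.Real_Asymp"
begin

text \<open>Only large primes matter, since the error term absorbs the others. By a container theorem and
  the removal lemma for $x + y = z$, every maximal sum-free set lies in one of $2^{o(n)}$ sets
  $B \cup C$ with $B$ sum-free and $C$ tiny. Given $S \setminus B$, the set $S \cap B$ is a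
  maximal independent set of a link graph on $B$, so there are at most $3^{|B|/3}$ choices.
  Kneser's theorem shows that either $|B| \le 10n/29$, which suffices, or $B$ lies in a union $B'$ of
  eight cosets of a subgroup of index $23$ with $B' = -B'$ and $G \setminus B' = B' - B'$. In the latter
  case no induced union of disjoint triangles of the link graph covers almost all of $B'$, which
  improves the Moon--Moser bound. For the lower bound, an element of order three splits a coset
  of index three into $n/9$ triangles.\<close>

section \<open>Kneser's theorem\<close>

text \<open>The bound 3^(|B|/3) alone fails in exactly one place. The possible indices of the
  stabilizer are divisors m of 207p, and k of its cosets can form a sum-free set only if 3k <= m +
  1. If 3 divides m, rounding gives k/m <= 1/3; if p divides m, then m >= 29 and k/m <= 10/29;
  otherwise m divides 23, which leaves m = 23, k = 8. There Moon--Moser gives 3^(8n/69), precisely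
  the quantity to be beaten. The gain comes from the subgroup H of order n/23: an induced union of
  triangles misses at least about |H|/3 vertices of B', hence covers at most about 8n/23 - n/69 =
  n/3 of them. With weight sqrt 2 per vertex and \<open>kappa\<close> per covered vertex the count
  is 2^(4n/23) kappa^(n/3) = 2^(n/138) 3^(n/9), and 25/216 = 1/9 + 1/216 works because 2^(1/138) <
  3^(1/216). All these inequalities are strict, so containers and removal enter with the fixed
  precision 1/100000 instead of a vanishing one.\<close>

definition subgrp :: "'a::ab_group_add set \<Rightarrow> bool" where
  "subgrp H \<longleftrightarrow> finite H \<and> 0 \<in> H \<and> (\<forall>x\<in>H. \<forall>y\<in>H. x - y \<in> H)"

lemma subgrpD:
  assumes "subgrp H"
  shows "finite H" "0 \<in> H" "x \<in> H \<Longrightarrow> y \<in> H \<Longrightarrow> x - y \<in> H"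
    "x \<in> H \<Longrightarrow> - x \<in> H" "x \<in> H \<Longrightarrow> y \<in> H \<Longrightarrow> x + y \<in> H"
proof -
  show fin: "finite H" and z: "0 \<in> H" and d: "x \<in> H \<Longrightarrow> y \<in> H \<Longrightarrow> x - y \<in> H" for x y
    using assms by (auto simp: subgrp_def)
  show m: "x \<in> H \<Longrightarrow> - x \<in> H" for x using d[OF z] by simp
  show "x \<in> H \<Longrightarrow> y \<in> H \<Longrightarrow> x + y \<in> H" using d m by (metis diff_minus_eq_add)
qed

lemma subgrp_Int: "subgrp H \<Longrightarrow> subgrp K \<Longrightarrow> subgrp (H \<inter> K)"
  by (auto simp: subgrp_def)

definition periodic :: "'a::ab_group_add set \<Rightarrow> 'a set \<Rightarrow> bool" where
  "periodic H C \<longleftrightarrow> (\<forall>x\<in>C. \<forall>h\<in>H. x + h \<in> C)"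

lemma periodicD: "periodic H C \<Longrightarrow> x \<in> C \<Longrightarrow> h \<in> H \<Longrightarrow> x + h \<in> C"
  by (auto simp: periodic_def)

lemma periodic_iff:
  assumes "subgrp H" "periodic H C" "h \<in> H"
  shows "x + h \<in> C \<longleftrightarrow> x \<in> C"
  using periodicD[OF assms(2), of "x + h" "- h"] periodicD[OF assms(2), of x h] assms(3)
    subgrpD(4)[OF assms(1) assms(3)] by auto

definition stab :: "'a::ab_group_add set \<Rightarrow> 'a set" where
  "stab C = {h. \<forall>x. x + h \<in> C \<longleftrightarrow> x \<in> C}"

lemma periodic_stab: "periodic (stab C) C"
  by (auto simp: periodic_def stab_def)

lemma subset_stab: "subgrp H \<Longrightarrow> periodic H C \<Longrightarrow> H \<subseteq> stab C"
  by (auto simp: stab_def periodic_iff)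

lemma stab_subset:
  assumes "subgrp G" "C \<subseteq> G" "C \<noteq> {}" shows "stab C \<subseteq> G"
proof
  fix h assume "h \<in> stab C"
  obtain x where "x \<in> C" using assms by auto
  hence "x + h \<in> G" "x \<in> G" using \<open>h \<in> stab C\<close> assms by (auto simp: stab_def)
  from subgrpD(3)[OF assms(1) this] show "h \<in> G" by simp
qed

lemma subgrp_stab:
  assumes "finite C" "C \<noteq> {}" shows "subgrp (stab C)"
proof -
  obtain x where x: "x \<in> C" using assms by auto
  have "stab C \<subseteq> (\<lambda>y. y - x) ` C"
  proof
    fix h assume "h \<in> stab C"
    hence "x + h \<in> C" using x by (simp add: stab_def)
    moreover have "h = (x + h) - x" by simp
    ultimately show "h \<in> (\<lambda>y. y - x) ` C" by blast
  qed
  moreover have "u - v \<in> stab C" if "u \<in> stab C" "v \<in> stab C" for u v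
  proof -
    have "x + (u - v) \<in> C \<longleftrightarrow> x \<in> C" for x
    proof -
      have "x + (u - v) \<in> C \<longleftrightarrow> (x + (u - v)) + v \<in> C"
        using that(2)[unfolded stab_def mem_Collect_eq, THEN spec, of "x + (u - v)"] by (rule sym)
      also have "(x + (u - v)) + v = x + u" by simp
      finally show ?thesis using that by (simp add: stab_def)
    qed
    thus ?thesis by (simp add: stab_def)
  qed
  moreover have "0 \<in> stab C" by (simp add: stab_def)
  ultimately show ?thesis using finite_subset[OF _ finite_imageI[OF assms(1)]]
    unfolding subgrp_def by blast
qed

lemma card_translate: "card ((\<lambda>h. x + h) ` (A :: 'a::ab_group_add set)) = card A"
  by (simp add: card_image inj_on_def)

lemma card_periodic_ge:
  assumes "subgrp H" "periodic H C" "C \<noteq> {}" "finite C"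
  shows "card H \<le> card C"
proof -
  obtain x where "x \<in> C" using assms by auto
  hence "(\<lambda>h. x + h) ` H \<subseteq> C" using assms by (auto simp: periodic_def)
  from card_mono[OF assms(4) this] show ?thesis by (simp add: card_translate)
qed

text \<open>The cosets of \<open>H\<close> through points of \<open>C\<close> stay inside
  \<open>C\<close> and partition it.\<close>

lemma card_dvd_periodic:
  fixes H C :: "'a::ab_group_add set"
  assumes H: "subgrp H" and C: "periodic H C" and fin: "finite C"
  shows "card H dvd card C"
proof -
  let ?P = "(\<lambda>x. (\<lambda>h. x + h) ` H) ` C"
  have U: "\<Union>?P = C" using C subgrpD(2)[OF H] by (force simp: periodic_def)
  have "card H dvd card (\<Union>?P)"
  proof (rule dvd_partition)
    show "finite (\<Union>?P)" using U fin by simp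
    show "\<forall>c\<in>?P. card H dvd card c" by (auto simp: card_translate)
    show "\<forall>c1\<in>?P. \<forall>c2\<in>?P. c1 \<noteq> c2 \<longrightarrow> c1 \<inter> c2 = {}"
    proof (intro ballI impI)
      fix c1 c2 assume "c1 \<in> ?P" "c2 \<in> ?P" and ne: "c1 \<noteq> c2"
      then obtain x y where xy: "c1 = (\<lambda>h. x + h) ` H" "c2 = (\<lambda>h. y + h) ` H" by auto
      show "c1 \<inter> c2 = {}"
      proof (rule ccontr)
        assume "c1 \<inter> c2 \<noteq> {}"
        then obtain h k where hk: "h \<in> H" "k \<in> H" "x + h = y + k" using xy by auto
        have 1: "x = y + (k - h)" and 2: "y = x + (h - k)" using hk(3) by (simp_all add: algebra_simps)
        have "x + u \<in> c2" if u: "u \<in> H" for u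
        proof -
          have "x + u = y + (k - h + u)" using 1 by (simp add: algebra_simps)
          moreover have "k - h + u \<in> H" using u hk subgrpD(3,5)[OF H] by blast
          ultimately show ?thesis using xy by blast
        qed
        moreover have "y + u \<in> c1" if u: "u \<in> H" for u
        proof -
          have "y + u = x + (h - k + u)" using 2 by (simp add: algebra_simps)
          moreover have "h - k + u \<in> H" using u hk subgrpD(3,5)[OF H] by blast
          ultimately show ?thesis using xy by blast
        qed
        ultimately show False using ne xy by auto
      qed
    qed
  qed
  thus ?thesis using U by simp
qed

text \<open>Two representations of one sum differ by an element of \<open>H \<inter> K\<close>, so
  each fibre of addition on \<open>Q \<times> R\<close> has at most
  \<open>card (H \<inter> K)\<close> members.\<close>

lemma card_mult_le_setsum:
  fixes H K :: "'a::ab_group_add set"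
  assumes H: "subgrp H" and K: "subgrp K" and "Q \<subseteq> H" "R \<subseteq> K"
  shows "card Q * card R \<le> card (Q + R) * card (H \<inter> K)"
proof -
  have fin: "finite Q" "finite R" "finite (H \<inter> K)" using assms subgrpD(1) finite_subset by blast+
  have "card Q * card R = card (Q \<times> R)" by (rule card_cartesian_product[symmetric])
  also have "Q \<times> R = (\<Union>s\<in>Q + R. {z \<in> Q \<times> R. fst z + snd z = s})" by (force simp: set_plus_def)
  also have "card \<dots> \<le> (\<Sum>s\<in>Q + R. card {z \<in> Q \<times> R. fst z + snd z = s})"
    by (rule card_UN_le) (simp add: fin finite_set_plus)
  also have "\<dots> \<le> (\<Sum>s\<in>Q + R. card (H \<inter> K))"
  proof (rule sum_mono)
    fix s
    let ?F = "{z \<in> Q \<times> R. fst z + snd z = s}"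
    show "card ?F \<le> card (H \<inter> K)"
    proof (cases "?F = {}")
      case False
      then obtain a b where ab: "a \<in> Q" "b \<in> R" "a + b = s" by auto
      have "inj_on (\<lambda>z. fst z - a) ?F" by (auto simp: inj_on_def)
      moreover have "(\<lambda>z. fst z - a) ` ?F \<subseteq> H \<inter> K"
      proof safe
        fix x y assume z: "x \<in> Q" "y \<in> R" "s = fst (x, y) + snd (x, y)"
        show "fst (x, y) - a \<in> H" using z(1) ab(1) \<open>Q \<subseteq> H\<close> subgrpD(3)[OF H] by (simp add: subset_iff)
        have "x - a = b - y" using z ab by (simp add: algebra_simps)
        thus "fst (x, y) - a \<in> K" using z(2) ab(2) \<open>R \<subseteq> K\<close> subgrpD(3)[OF K] by (simp add: subset_iff)
      qed
      ultimately show ?thesis using fin by (meson card_inj_on_le)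
    next
      case True
      show ?thesis unfolding True by simp
    qed
  qed
  finally show ?thesis by simp
qed

text \<open>Inside \<open>x + H1 + H2\<close> the set \<open>C1\<close> is a union of rows and \<open>C2\<close> a union of columns of a grid
  whose cells are cosets of \<open>H1 \<inter> H2\<close>; the bound comes from counting cells in the
  differences \<open>C2 - C1\<close> and \<open>C1 - C2\<close>.\<close>

lemma card_Diff_ge_periodic:
  fixes C1 C2 :: "'a::ab_group_add set"
  assumes H: "subgrp H1" "subgrp H2" and P: "periodic H1 C1" "periodic H2 C2"
    and fin: "finite C1" "finite C2" and x: "x \<in> C2" "x \<notin> C1"
    and lt1: "card (C2 - C1) + card (H1 \<inter> H2) < card H1"
    and lt2: "card (C1 - C2) + card (H1 \<inter> H2) < card H2"
  shows "card H2 \<le> card (C2 - C1)"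
proof (rule ccontr)
  assume not: "\<not> card H2 \<le> card (C2 - C1)"
  define L where "L = H1 \<inter> H2"
  define l where "l = card L"
  have L: "subgrp L" unfolding L_def by (rule subgrp_Int[OF H])
  have l0: "l > 0" using subgrpD(1,2)[OF L] unfolding l_def by (auto simp: card_gt_0_iff)
  \<comment> \<open>In coordinates \<open>x + (h1 + h2)\<close>, membership in \<open>C1\<close>
    depends on \<open>h2\<close> only and membership in \<open>C2\<close> on \<open>h1\<close> only.
    Hence \<open>Q + P'\<close> translates into \<open>C2 - C1\<close>, and \<open>Q' + P\<close>
    into \<open>C1 - C2\<close>.\<close>
  define P where "P = {h\<in>H2. x + h \<in> C1}"
  define P' where "P' = {h\<in>H2. x + h \<notin> C1}"
  define Q where "Q = {h\<in>H1. x + h \<in> C2}"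
  define Q' where "Q' = {h\<in>H1. x + h \<notin> C2}"
  note finH = subgrpD(1)[OF H(1)] subgrpD(1)[OF H(2)]
  have cardP: "card P + card P' = card H2"
    unfolding P_def P'_def using finH
    by (subst card_Un_disjoint[symmetric]) (auto intro: arg_cong[where f=card])
  have cardQ: "card Q + card Q' = card H1"
    unfolding Q_def Q'_def using finH
    by (subst card_Un_disjoint[symmetric]) (auto intro: arg_cong[where f=card])
  have ge: "card Z \<ge> l" if "Z = P \<or> Z = P' \<or> Z = Q \<or> Z = Q'" "Z \<noteq> {}" for Z
  proof -
    have per: "periodic L Z"
      unfolding periodic_def
    proof (intro ballI)
      fix z h assume zh: "z \<in> Z" "h \<in> L"
      have a: "x + (z + h) \<in> C1 \<longleftrightarrow> x + z \<in> C1" 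
        using periodic_iff[OF H(1) \<open>periodic H1 C1\<close>, of h "x + z"] zh by (simp add: L_def add.assoc)
      have b: "x + (z + h) \<in> C2 \<longleftrightarrow> x + z \<in> C2" 
        using periodic_iff[OF H(2) \<open>periodic H2 C2\<close>, of h "x + z"] zh by (simp add: L_def add.assoc)
      show "z + h \<in> Z" using that(1) zh a b subgrpD(5)[OF H(1), of z h] subgrpD(5)[OF H(2), of z h]
        by (auto simp: P_def P'_def Q_def Q'_def L_def)
    qed
    have "finite Z" using that finH by (auto simp: P_def P'_def Q_def Q'_def)
    thus ?thesis using card_periodic_ge[OF L per that(2)] by (simp add: l_def)
  qed
  have mem1: "x + (h1 + h2) \<in> C1 \<longleftrightarrow> x + h2 \<in> C1" if "h1 \<in> H1" for h1 h2
    using periodic_iff[OF H(1) \<open>periodic H1 C1\<close> that, of "x + h2"] by (simp add: ac_simps)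
  have mem2: "x + (h1 + h2) \<in> C2 \<longleftrightarrow> x + h1 \<in> C2" if "h2 \<in> H2" for h1 h2
    using periodic_iff[OF H(2) \<open>periodic H2 C2\<close> that, of "x + h1"] by (simp add: ac_simps)
  have "(\<lambda>h. x + h) ` (Q + P') \<subseteq> C2 - C1"
    using mem1 mem2 unfolding Q_def P'_def by (auto elim!: set_plus_elim)
  from card_mono[OF finite_Diff[OF fin(2)] this] have c1: "card (Q + P') \<le> card (C2 - C1)"
    by (simp add: card_translate)
  have "(\<lambda>h. x + h) ` (Q' + P) \<subseteq> C1 - C2"
    using mem1 mem2 unfolding Q'_def P_def by (auto elim!: set_plus_elim)
  from card_mono[OF finite_Diff[OF fin(1)] this] have c2: "card (Q' + P) \<le> card (C1 - C2)"
    by (simp add: card_translate)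
  have e1: "card Q * card P' \<le> card (C2 - C1) * l"
  proof (rule order_trans)
    show "card Q * card P' \<le> card (Q + P') * l" unfolding l_def L_def
      by (rule card_mult_le_setsum[OF H]) (auto simp: Q_def P'_def)
  qed (rule mult_le_mono1[OF c1])
  have e2: "card Q' * card P \<le> card (C1 - C2) * l"
  proof (rule order_trans)
    show "card Q' * card P \<le> card (Q' + P) * l" unfolding l_def L_def
      by (rule card_mult_le_setsum[OF H]) (auto simp: Q'_def P_def)
  qed (rule mult_le_mono1[OF c2])
  have "0 \<in> Q" "0 \<in> P'" using x subgrpD(2) H by (auto simp: Q_def P'_def)
  hence q: "card Q \<ge> l" and p': "card P' \<ge> l" using ge[of Q] ge[of P'] by auto
  have "Q' \<noteq> {}"
  proof
    assume "Q' = {}"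
    hence "(\<lambda>h. x + h) ` H1 \<subseteq> C2 - C1" using x periodic_iff[OF H(1) \<open>periodic H1 C1\<close>] by (auto simp: Q'_def)
    from card_mono[OF _ this] fin lt1 show False by (simp add: card_translate)
  qed
  hence q': "card Q' \<ge> l" using ge[of Q'] by simp
  have "P \<noteq> {}"
  proof
    assume "P = {}"
    hence "(\<lambda>h. x + h) ` H2 \<subseteq> C2 - C1" using x periodic_iff[OF H(2) \<open>periodic H2 C2\<close>] by (auto simp: P_def)
    from card_mono[OF _ this] fin not show False by (simp add: card_translate)
  qed
  hence p: "card P \<ge> l" using ge[of P] by simp
  \<comment> \<open>All four sets are nonempty unions of cosets of \<open>L\<close>. In terms of the
    surpluses over \<open>l\<close>, the first cell count against \<open>lt1\<close> forces
    \<open>p2 < q2\<close>, and the second against \<open>lt2\<close> forces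
    \<open>q2 < p2\<close>.\<close>
  obtain q1 where q1: "card Q = l + q1" using q le_Suc_ex by blast
  obtain q2 where q2: "card Q' = l + q2" using q' le_Suc_ex by blast
  obtain p1 where p1: "card P = l + p1" using p le_Suc_ex by blast
  obtain p2 where p2: "card P' = l + p2" using p' le_Suc_ex by blast
  have "card (C2 - C1) < l + q1 + q2" using lt1 cardQ q1 q2 by (simp add: l_def L_def)
  hence "card (C2 - C1) * l < (l + q1 + q2) * l" using l0 by simp
  from le_less_trans[OF e1[unfolded q1 p2] this] have "(l + q1) * (l + p2) < (l + q1 + q2) * l" .
  hence "l * p2 + p2 * q1 < l * q2" by (simp add: algebra_simps)
  hence "l * p2 < l * q2" by linarith
  hence A: "p2 < q2" by simp
  have "card (C1 - C2) < l + p1 + p2" using lt2 cardP p1 p2 by (simp add: l_def L_def)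
  hence "card (C1 - C2) * l < (l + p1 + p2) * l" using l0 by simp
  from le_less_trans[OF e2[unfolded q2 p1] this] have "(l + q2) * (l + p1) < (l + p1 + p2) * l" .
  hence "l * q2 + q2 * p1 < l * p2" by (simp add: algebra_simps)
  hence "l * q2 < l * p2" by linarith
  hence "q2 < p2" by simp
  with A show False by simp
qed

definition kneser_good :: "nat \<Rightarrow> 'a::ab_group_add set \<Rightarrow> bool" where
  "kneser_good s C \<longleftrightarrow> (\<exists>H. subgrp H \<and> periodic H C \<and> s \<le> card C + card H)"

text \<open>If the period \<open>H1 \<inter> H2\<close> failed for the union, both differences would
  be small, and applying \<open>card_Diff_ge_periodic\<close> both ways would give the cycle |H2|
  \<le> |C2 - C1| < |H1| \<le> |C1 - C2| < |H2|.\<close>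

lemma kneser_good_Un:
  fixes C1 C2 :: "'a::ab_group_add set"
  assumes fin: "finite C1" "finite C2" and g: "kneser_good s C1" "kneser_good s C2"
  shows "kneser_good s (C1 \<union> C2)"
proof (cases "C1 \<subseteq> C2 \<or> C2 \<subseteq> C1")
  case True thus ?thesis using g by (auto simp: sup_absorb1 sup_absorb2)
next
  case False
  obtain H1 H2 where H: "subgrp H1" "subgrp H2" and P: "periodic H1 C1" "periodic H2 C2"
    and c: "s \<le> card C1 + card H1" "s \<le> card C2 + card H2"
    using g by (auto simp: kneser_good_def)
  have un: "card (C1 \<union> C2) = card C1 + card (C2 - C1)" "card (C1 \<union> C2) = card C2 + card (C1 - C2)"
    using fin card_Un_disjoint[of C1 "C2 - C1"] card_Un_disjoint[of C2 "C1 - C2"]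
    by (simp_all add: Un_commute)
  have per: "periodic (H1 \<inter> H2) (C1 \<union> C2)" using P by (auto simp: periodic_def)
  obtain x y where x: "x \<in> C2" "x \<notin> C1" and y: "y \<in> C1" "y \<notin> C2" using False by auto
  have "s \<le> card (C1 \<union> C2) + card (H1 \<inter> H2)"
  proof (rule ccontr)
    assume n: "\<not> ?thesis"
    have lt1: "card (C2 - C1) + card (H1 \<inter> H2) < card H1" using n un c by linarith
    have lt2: "card (C1 - C2) + card (H1 \<inter> H2) < card H2" using n un c by linarith
    have 1: "card H2 \<le> card (C2 - C1)" by (rule card_Diff_ge_periodic[OF H P fin x lt1 lt2])
    have 2: "card H1 \<le> card (C1 - C2)"
      by (rule card_Diff_ge_periodic[OF H(2,1) P(2,1) fin(2,1) y]) (use lt1 lt2 in \<open>simp_all add: Int_commute\<close>)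
    show False using 1 2 lt1 lt2 by linarith
  qed
  thus ?thesis using per subgrp_Int[OF H] by (auto simp: kneser_good_def)
qed

text \<open>Dyson's transform \<open>(A \<union> (e + B), B \<inter> (A - e))\<close> keeps \<open>card A + card B\<close> and shrinks \<open>B\<close>
  until \<open>B\<close> lies in the stabilizer of \<open>A\<close>.\<close>

lemma kneser_good_cover:
  fixes A B :: "'a::ab_group_add set"
  assumes "finite A" "finite B" "a \<in> A" "b \<in> B"
  shows "\<exists>C. a + b \<in> C \<and> C \<subseteq> A + B \<and> kneser_good (card A + card B) C"
proof -
  have main: "\<exists>C. a \<in> C \<and> C \<subseteq> A + B \<and> kneser_good (card A + card B) C"
    if "finite A" "finite B" "a \<in> A" "0 \<in> B" for a :: 'a and A B
    using that
  proof (induction "card B" arbitrary: A B rule: less_induct)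
    case less
    show ?case
    proof (cases "\<exists>e\<in>A. \<exists>b\<in>B. e + b \<notin> A")
      case False
      \<comment> \<open>When no transform is possible, each translation by \<open>b\<close> maps
        \<open>A\<close> into itself, hence onto itself by finiteness; then \<open>A\<close> is the
        covering set with period \<open>stab A\<close>.\<close>
      have "B \<subseteq> stab A"
      proof
        fix b assume b: "b \<in> B"
        have sub: "(\<lambda>x. x + b) ` A \<subseteq> A" using False b by auto
        have "card ((\<lambda>x. x + b) ` A) = card A" by (simp add: card_image inj_on_def)
        with sub have eq: "(\<lambda>x. x + b) ` A = A" using less.prems(1) by (metis card_subset_eq)
        have "x + b \<in> A \<longleftrightarrow> x \<in> A" for x
        proof
          assume "x + b \<in> A"
          then obtain y where "y \<in> A" "x + b = y + b" using eq by (metis imageE)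
          thus "x \<in> A" by simp
        qed (use sub in auto)
        thus "b \<in> stab A" by (simp add: stab_def)
      qed
      moreover have st: "subgrp (stab A)" using less.prems by (intro subgrp_stab) auto
      ultimately have "card B \<le> card (stab A)" using card_mono subgrpD(1) by blast
      hence "kneser_good (card A + card B) A" using st periodic_stab by (auto simp: kneser_good_def)
      moreover have "A \<subseteq> A + B" using less.prems(4) by (force simp: set_plus_def)
      ultimately show ?thesis using less.prems by blast
    next
      case True
      then obtain e b where e: "e \<in> A" "b \<in> B" "e + b \<notin> A" by auto
      define A' where "A' = A \<union> (\<lambda>x. e + x) ` B"
      define B' where "B' = {x\<in>B. e + x \<in> A}"
      have fin: "finite A'" "finite B'" using less.prems by (auto simp: A'_def B'_def)
      have "B' \<subset> B" using e by (auto simp: B'_def)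
      hence "card B' < card B" using less.prems by (simp add: psubset_card_mono)
      moreover have "a \<in> A'" "0 \<in> B'" using less.prems e by (auto simp: A'_def B'_def)
      ultimately obtain C where C: "a \<in> C" "C \<subseteq> A' + B'" "kneser_good (card A' + card B') C"
        using less.hyps[of B' A'] fin by blast
      have "A' + B' \<subseteq> A + B"
      proof
        fix z assume "z \<in> A' + B'"
        then obtain u v where uv: "z = u + v" "u \<in> A'" "v \<in> B'" by (rule set_plus_elim)
        show "z \<in> A + B"
        proof (cases "u \<in> A")
          case True thus ?thesis using uv by (auto simp: B'_def intro: set_plus_intro)
        next
          case False
          then obtain w where w: "w \<in> B" "u = e + w" using uv by (auto simp: A'_def)
          have "z = (e + v) + w" using uv w by (simp add: ac_simps)
          thus ?thesis using uv(3) w(1) set_plus_intro[of "e + v" A w B] by (simp add: B'_def)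
        qed
      qed
      moreover have "card A' + card B' = card A + card B"
      proof -
        have "(\<lambda>x. e + x) ` B' = A \<inter> (\<lambda>x. e + x) ` B" by (auto simp: B'_def)
        hence "card B' = card (A \<inter> (\<lambda>x. e + x) ` B)" by (metis card_translate)
        thus ?thesis unfolding A'_def
          using card_Un_Int[of A "(\<lambda>x. e + x) ` B"] less.prems by (simp add: card_translate)
      qed
      ultimately show ?thesis using C by auto
    qed
  qed
  \<comment> \<open>The induction needs \<open>0\<close> in the second set and keeps it there,
    because \<open>e + 0\<close> lies in \<open>A\<close>. Translating by \<open>- b\<close>
    provides it at the start.\<close>
  define B0 where "B0 = (\<lambda>x. - b + x) ` B"
  have B0: "finite B0" "0 \<in> B0" "card B0 = card B"
    unfolding B0_def card_translate using assms by force+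
  obtain C where C: "a \<in> C" "C \<subseteq> A + B0" "kneser_good (card A + card B0) C"
    using main[OF assms(1) B0(1) assms(3) B0(2)] by blast
  obtain H where H: "subgrp H" "periodic H C" "card A + card B \<le> card C + card H"
    using C(3) B0 by (auto simp: kneser_good_def)
  define C' where "C' = (\<lambda>x. b + x) ` C"
  have "periodic H C'" using H(2) by (force simp: periodic_def C'_def add.assoc)
  moreover have "card C' = card C" by (simp add: C'_def card_translate)
  ultimately have "kneser_good (card A + card B) C'" using H by (auto simp: kneser_good_def)
  moreover have "C' \<subseteq> A + B"
  proof
    fix z assume "z \<in> C'"
    then obtain c where c: "c \<in> C" "z = b + c" by (auto simp: C'_def)
    then obtain u v where uv: "c = u + v" "u \<in> A" "v \<in> B0" using C(2) by (meson set_plus_elim subsetD)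
    then obtain w where "w \<in> B" "v = - b + w" by (auto simp: B0_def)
    hence "z = u + w" using c uv by simp
    thus "z \<in> A + B" using uv \<open>w \<in> B\<close> by auto
  qed
  moreover have "a + b \<in> C'" using C(1) by (auto simp: C'_def add.commute)
  ultimately show ?thesis by blast
qed

text \<open>Every element of \<open>A + B\<close> lies in a good subset, and good sets are closed
  under union, so the finite union of these subsets, which is \<open>A + B\<close> itself, is
  good.\<close>

lemma kneser_weak:
  fixes A B :: "'a::ab_group_add set"
  assumes "finite A" "finite B" "A \<noteq> {}" "B \<noteq> {}"
  shows "kneser_good (card A + card B) (A + B)"
proof -
  let ?s = "card A + card B"
  have fin: "finite (A + B)" using assms by (simp add: finite_set_plus)
  have ne: "A + B \<noteq> {}" using assms by (auto simp: set_plus_def)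
  have cov: "\<exists>C. x \<in> C \<and> C \<subseteq> A + B \<and> kneser_good ?s C" if "x \<in> A + B" for x
    using that kneser_good_cover[OF assms(1,2)] by (auto elim!: set_plus_elim)
  have "\<exists>C. X \<subseteq> C \<and> C \<subseteq> A + B \<and> kneser_good ?s C" if "finite X" "X \<noteq> {}" "X \<subseteq> A + B" for X
    using that
  proof (induction X rule: finite_ne_induct)
    case (singleton x) thus ?case using cov by auto
  next
    case (insert x F)
    obtain C where C: "F \<subseteq> C" "C \<subseteq> A + B" "kneser_good ?s C" using insert.IH insert.prems by auto
    obtain D where D: "x \<in> D" "D \<subseteq> A + B" "kneser_good ?s D" using cov[of x] insert.prems by auto
    have "kneser_good ?s (C \<union> D)" 
      by (rule kneser_good_Un[OF finite_subset[OF C(2) fin] finite_subset[OF D(2) fin] C(3) D(3)])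
    moreover have "insert x F \<subseteq> C \<union> D" "C \<union> D \<subseteq> A + B" using C(1,2) D(1,2) by auto
    ultimately show ?case by blast
  qed
  from this[OF fin ne order_refl] obtain C where "A + B \<subseteq> C" "C \<subseteq> A + B" "kneser_good ?s C" by blast
  thus ?thesis by (simp add: subset_antisym)
qed

text \<open>Enlarging both summands by \<open>K\<close> does not change the sum, so the weak form
  applies to \<open>A + K\<close> and \<open>B + K\<close>; the period it yields is contained in
  \<open>K\<close>.\<close>

theorem kneser:
  fixes A B :: "'a::ab_group_add set"
  assumes "finite A" "finite B" "A \<noteq> {}" "B \<noteq> {}"
  defines "K \<equiv> stab (A + B)"
  shows "card (A + K) + card (B + K) \<le> card (A + B) + card K"
proof -
  have fin: "finite (A + B)" using assms by (simp add: finite_set_plus)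
  have ne: "A + B \<noteq> {}" using assms by (auto simp: set_plus_def)
  have K: "subgrp K" unfolding K_def by (rule subgrp_stab[OF fin ne])
  have "A + B + K \<subseteq> A + B" using periodic_stab[of "A + B"]
    unfolding K_def[symmetric] by (auto simp: periodic_def elim!: set_plus_elim[of _ "A + B" K])
  moreover have sub: "X \<subseteq> X + K" for X using subgrpD(2)[OF K] by (force simp: set_plus_def)
  moreover have "K + K \<subseteq> K" using subgrpD(5)[OF K] by (auto elim!: set_plus_elim)
  ultimately have KK: "K + K = K" and ABK: "A + B + K = A + B" by blast+
  have "(A + K) + (B + K) = A + B + (K + K)" by (simp only: ac_simps)
  hence eq: "(A + K) + (B + K) = A + B" using KK ABK by simp
  have "kneser_good (card (A + K) + card (B + K)) ((A + K) + (B + K))"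
    using assms K sub by (intro kneser_weak) (auto simp: finite_set_plus subgrpD(1))
  then obtain H where H: "subgrp H" "periodic H (A + B)" 
      "card (A + K) + card (B + K) \<le> card (A + B) + card H"
    unfolding eq kneser_good_def by blast
  have "card H \<le> card K" using subset_stab[OF H(1,2)] K card_mono subgrpD(1) unfolding K_def by blast
  thus ?thesis using H by simp
qed

section \<open>Maximal independent sets\<close>

definition mis :: "'a set \<Rightarrow> ('a \<Rightarrow> 'a \<Rightarrow> bool) \<Rightarrow> 'a set set" where
  "mis V R = {I. I \<subseteq> V \<and> (\<forall>x\<in>I. \<forall>y\<in>I. \<not> R x y) \<and> (\<forall>v\<in>V - I. \<exists>u\<in>I. R u v)}"

definition nbhd :: "'a set \<Rightarrow> ('a \<Rightarrow> 'a \<Rightarrow> bool) \<Rightarrow> 'a \<Rightarrow> 'a set" where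
  "nbhd V R v = {w\<in>V. R v w}"

text \<open>For symmetric irreflexive \<open>R\<close> this says that \<open>X\<close> induces a
  disjoint union of triangles: all degrees are two and the two neighbours are adjacent.\<close>

definition triangular :: "('a \<Rightarrow> 'a \<Rightarrow> bool) \<Rightarrow> 'a set \<Rightarrow> bool" where
  "triangular R X \<longleftrightarrow> (\<forall>x\<in>X. \<exists>y z. y \<noteq> z \<and> R y z \<and> nbhd X R x = {y, z})"

text \<open>This is $3^{1/3}/2^{1/2}$: a triangle component has three maximal independent sets, and
  $3 = \sqrt 2^3 \cdot \mathit{kappa}^3$.\<close>

definition kappa :: real where "kappa = root 6 (9 / 8)"

lemma kappa_ge1: "kappa \<ge> 1"
  unfolding kappa_def by simp

lemma sqrt2_kappa: "sqrt 2 ^ 3 * kappa ^ 3 = 3"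
proof (rule power2_eq_imp_eq)
  have "kappa ^ 6 = 9 / 8" unfolding kappa_def by (rule real_root_pow_pos2) auto
  moreover have "sqrt 2 ^ 6 = (8::real)"
    using power_mult[of "sqrt (2::real)" 2 3] by simp
  ultimately show "(sqrt 2 ^ 3 * kappa ^ 3)\<^sup>2 = 3\<^sup>2"
    by (simp add: power_mult_distrib flip: power_mult)
qed (use kappa_ge1 in auto)

lemma finite_mis: "finite V \<Longrightarrow> finite (mis V R)"
  by (rule finite_subset[of _ "Pow V"]) (auto simp: mis_def)

lemma mis_del: "{I \<in> mis V R. v \<notin> I} \<subseteq> mis (V - {v}) R"
  by (auto simp: mis_def)

text \<open>Removing \<open>v\<close> is injective because \<open>v\<close> is known to lie in
  \<open>I\<close>, and a vertex outside the closed neighbourhood of \<open>v\<close> must be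
  dominated by another member of \<open>I\<close>.\<close>

lemma card_mis_mem_le:
  assumes "finite V" "\<And>x y. R x y \<Longrightarrow> R y x" "\<And>x. \<not> R x x"
  shows "card {I \<in> mis V R. v \<in> I} \<le> card (mis (V - insert v (nbhd V R v)) R)"
proof (rule card_inj_on_le)
  show "inj_on (\<lambda>I. I - {v}) {I \<in> mis V R. v \<in> I}" by (auto simp: inj_on_def)
  show "(\<lambda>I. I - {v}) ` {I \<in> mis V R. v \<in> I} \<subseteq> mis (V - insert v (nbhd V R v)) R"
  proof safe
    fix I assume I: "I \<in> mis V R" "v \<in> I"
    hence ind: "\<not> R x y" if "x \<in> I" "y \<in> I" for x y using that by (simp add: mis_def)
    have sub: "I - {v} \<subseteq> V - insert v (nbhd V R v)"
      using I ind[OF I(2)] by (auto simp: mis_def nbhd_def)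
    have dom: "\<exists>u\<in>I - {v}. R u w" if w: "w \<in> V - insert v (nbhd V R v) - (I - {v})" for w
    proof -
      have "w \<in> V - I" "\<not> R v w" using w by (auto simp: nbhd_def)
      moreover from this obtain u where "u \<in> I" "R u w" using I unfolding mis_def by blast
      ultimately show ?thesis by blast
    qed
    show "I - {v} \<in> mis (V - insert v (nbhd V R v)) R"
      unfolding mis_def using sub ind dom by blast
  qed
qed (use assms in \<open>auto intro: finite_mis\<close>)

lemma triangular_Un:
  assumes "triangular R X" "triangular R Y" "\<And>x y. x \<in> X \<Longrightarrow> y \<in> Y \<Longrightarrow> \<not> R x y \<and> \<not> R y x"
  shows "triangular R (X \<union> Y)"
proof -
  have "nbhd (X \<union> Y) R x = nbhd X R x" if "x \<in> X" for x using that assms(3) by (auto simp: nbhd_def)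
  moreover have "nbhd (X \<union> Y) R y = nbhd Y R y" if "y \<in> Y" for y
    using that assms(3) by (auto simp: nbhd_def)
  ultimately show ?thesis using assms(1,2) by (auto simp: triangular_def)
qed

text \<open>Moon--Moser branching with the weight $\sqrt 2$ per vertex. It loses only at a triangle
  component, so the excess is governed by the largest induced disjoint union of triangles;
  \<open>c = card V\<close> gives the Moon--Moser bound $3^{|V|/3}$.\<close>

theorem card_mis_le:
  assumes sym: "\<And>x y. R x y \<Longrightarrow> R y x" and irr: "\<And>x. \<not> R x x"
    and "finite V" and "\<And>X. X \<subseteq> V \<Longrightarrow> triangular R X \<Longrightarrow> card X \<le> c"
  shows "real (card (mis V R)) \<le> sqrt 2 ^ card V * kappa ^ c"
  using assms(3,4)
proof (induction "card V" arbitrary: V c rule: less_induct)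
  case (less V c)
  define W where "W = sqrt 2 ^ card V * kappa ^ c"
  \<comment> \<open>The bound that induction gives after deleting \<open>j\<close> vertices while
    keeping the same \<open>c\<close>.\<close>
  define D where "D j = W / sqrt 2 ^ j" for j
  let ?N = "\<lambda>v. insert v (nbhd V R v)"
  note fin = less.prems(1)
  have W0: "W > 0" using kappa_ge1 by (simp add: W_def)
  have IH: "real (card (mis V' R)) \<le> D j" if "V' \<subseteq> V" "card V' + j \<le> card V" "j > 0" for V' j
  proof -
    have "real (card (mis V' R)) \<le> sqrt 2 ^ card V' * kappa ^ c"
      using that less.prems fin by (intro less.hyps) (auto intro: finite_subset)
    also have "\<dots> \<le> sqrt 2 ^ (card V - j) * kappa ^ c"
      using that kappa_ge1 by (intro mult_right_mono power_increasing) auto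
    also have "\<dots> = D j" using that by (simp add: power_diff D_def W_def)
    finally show ?thesis .
  qed
  have finN: "finite (nbhd U R v)" if "U \<subseteq> V" for v U
    using fin that by (auto simp: nbhd_def intro: finite_subset)
  have vN: "v \<notin> nbhd U R v" for v U using irr by (simp add: nbhd_def)
  have cN: "card (?N v) = Suc (card (nbhd V R v))" for v using finN vN by simp
  have NV: "?N v \<subseteq> V" if "v \<in> V" for v using that by (auto simp: nbhd_def)
  have hit: "I \<in> mis V R \<Longrightarrow> v \<in> V \<Longrightarrow> I \<inter> ?N v \<noteq> {}" for I v
  proof (cases "v \<in> I")
    case False
    assume "I \<in> mis V R" "v \<in> V"
    then obtain u where "u \<in> I" "R u v" "u \<in> V" using False unfolding mis_def by blast
    thus ?thesis using sym by (auto simp: nbhd_def)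
  qed auto
  have card_mem: "card {I \<in> mis U R. v \<in> I} \<le> card (mis (U - insert v (nbhd U R v)) R)"
    if "U \<subseteq> V" for U v
    by (rule card_mis_mem_le) (use that fin sym irr in \<open>auto intro: finite_subset\<close>)
  have mem: "real (card {I \<in> mis V R. v \<in> I}) \<le> D j" 
    if "v \<in> V" "j \<le> Suc (card (nbhd V R v))" "j > 0" for v j
  proof -
    have sub: "?N v \<subseteq> V" by (rule NV[OF that(1)])
    have "card (V - ?N v) = card V - card (?N v)"
      by (rule card_Diff_subset[OF finite_subset[OF sub fin] sub])
    hence "card (V - ?N v) + j \<le> card V"
      using card_mono[OF fin sub] cN[of v] that(2) by linarith
    hence "real (card (mis (V - ?N v) R)) \<le> D j" by (intro IH that(3)) auto
    thus ?thesis using card_mem[OF order_refl, of v] by linarith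
  qed
  have s: "sqrt 2 ^ 2 = (2::real)" "sqrt 2 ^ 3 = 2 * sqrt (2::real)" "sqrt 2 ^ 4 = (4::real)" 
    by (simp_all add: power3_eq_cube power4_eq_xxxx)
  \<comment> \<open>Precise enough for the branchings with slack: 71/100 + 1/4 at degree at least
    three, and 71/200 + 71/200 + 1/4 at a degree-two vertex outside a triangle, both stay below
    1.\<close>
  have s1: "1 / sqrt 2 \<le> (71/100 :: real)" 
  proof -
    have "100/71 \<le> sqrt (2::real)" by (rule real_le_rsqrt) (simp add: power2_eq_square)
    thus ?thesis by (simp add: field_simps)
  qed
  have "D 1 = 1 / sqrt 2 * W" "D 3 = 1 / sqrt 2 * (W / 2)" and w2: "D 2 = W / 2" and w4: "D 4 = W / 4"
    unfolding D_def s by simp_all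
  moreover have "1 / sqrt 2 * W \<le> 71/100 * W" "1 / sqrt 2 * (W / 2) \<le> 71/100 * (W / 2)"
    using W0 by (intro mult_right_mono s1; simp)+
  ultimately have w1: "D 1 \<le> 71/100 * W" and w3: "D 3 \<le> 71/200 * W" by simp_all
  consider (empty) "V = {}" | (big) v where "v \<in> V" "card (nbhd V R v) \<ge> 3"
    | (zero) v where "v \<in> V" "card (nbhd V R v) = 0"
    | (one) v where "v \<in> V" "card (nbhd V R v) = 1"
    | (two) "V \<noteq> {}" "\<And>v. v \<in> V \<Longrightarrow> card (nbhd V R v) = 2"
  proof (cases "\<exists>v\<in>V. card (nbhd V R v) \<noteq> 2")
    case True
    then obtain v where v: "v \<in> V" "card (nbhd V R v) \<noteq> 2" by auto
    hence "card (nbhd V R v) \<ge> 3 \<or> card (nbhd V R v) = 0 \<or> card (nbhd V R v) = 1" by linarith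
    thus thesis using v(1) big zero one by blast
  qed (use empty two in blast)
  thus ?case
  proof cases
    case empty
    have "mis V R = {{}}" using empty by (auto simp: mis_def)
    thus ?thesis using empty kappa_ge1 by simp
  next
    case big
    have "{I \<in> mis V R. v \<in> I} \<union> {I \<in> mis V R. v \<notin> I} = mis V R" by auto
    hence "card (mis V R) \<le> card {I \<in> mis V R. v \<in> I} + card {I \<in> mis V R. v \<notin> I}"
      using card_Un_le[of "{I \<in> mis V R. v \<in> I}" "{I \<in> mis V R. v \<notin> I}"] by simp
    moreover have "card {I \<in> mis V R. v \<notin> I} \<le> card (mis (V - {v}) R)"
      using fin by (intro card_mono finite_mis mis_del) auto
    moreover have "real (card (mis (V - {v}) R)) \<le> D 1"
    proof (rule IH)
      have "card V > 0" using big fin by (auto simp: card_gt_0_iff)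
      thus "card (V - {v}) + 1 \<le> card V" using big by simp
    qed auto
    moreover have "real (card {I \<in> mis V R. v \<in> I}) \<le> D 4"
      by (rule mem) (use big in simp_all)
    ultimately show ?thesis unfolding W_def[symmetric] using W0 w1 w2 w4 by linarith
  next
    case zero
    hence "nbhd V R v = {}" using finN[OF order_refl, of v] by simp
    hence "{I \<in> mis V R. v \<in> I} = mis V R" using hit[of _ v] zero(1) by auto
    moreover have "real (card {I \<in> mis V R. v \<in> I}) \<le> D 1"
      by (rule mem) (use zero in simp_all)
    ultimately have "real (card (mis V R)) \<le> D 1" by simp
    thus ?thesis unfolding W_def[symmetric] using W0 w1 by linarith
  next
    case one
    obtain u where u: "nbhd V R v = {u}" using card_1_singletonE[OF one(2)] by blast
    have uV: "u \<in> V" and "R v u" using u by (auto simp: nbhd_def)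
    hence "v \<in> nbhd V R u" using one(1) sym by (simp add: nbhd_def)
    hence cu: "card (nbhd V R u) > 0" using finN[OF order_refl, of u] by (auto simp: card_gt_0_iff)
    have "{I \<in> mis V R. v \<in> I} \<union> {I \<in> mis V R. u \<in> I} = mis V R" using hit[of _ v] one(1) u by auto
    hence "card (mis V R) \<le> card {I \<in> mis V R. v \<in> I} + card {I \<in> mis V R. u \<in> I}"
      using card_Un_le[of "{I \<in> mis V R. v \<in> I}" "{I \<in> mis V R. u \<in> I}"] by simp
    moreover have "real (card {I \<in> mis V R. v \<in> I}) \<le> D 2"
      by (rule mem) (use one in simp_all)
    moreover have "real (card {I \<in> mis V R. u \<in> I}) \<le> D 2"
      by (rule mem) (use uV cu in simp_all)
    ultimately show ?thesis unfolding W_def[symmetric] using W0 w1 w2 w4 by linarith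
  next
    case two
    obtain v where v: "v \<in> V" using two by auto
    obtain u w where uw: "nbhd V R v = {u, w}" "u \<noteq> w"
      using two(2)[OF v, unfolded card_2_iff] by blast
    have uV: "u \<in> V" "w \<in> V" and Rv: "R v u" "R v w" using uw by (auto simp: nbhd_def)
    have ne: "v \<noteq> u" "v \<noteq> w" using Rv irr by auto
    show ?thesis
    proof (cases "R u w")
      case True
      \<comment> \<open>All degrees are two, so the triangle is a whole component. Deleting it
        lowers \<open>c\<close> by three, and the factor \<open>sqrt 2 ^ 3 * kappa ^ 3 = 3\<close>
        thus saved pays for its three choices.\<close>
      let ?T = "{v, u, w}"
      note Rs = True Rv sym[OF True] sym[OF Rv(1)] sym[OF Rv(2)]
      have Nu: "nbhd V R u = {v, w}"
      proof (rule HOL.sym, rule card_subset_eq)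
        show "{v, w} \<subseteq> nbhd V R u" using Rs uV v by (simp add: nbhd_def)
      qed (use two(2)[OF uV(1)] ne finN in auto)
      have Nw: "nbhd V R w = {v, u}"
      proof (rule HOL.sym, rule card_subset_eq)
        show "{v, u} \<subseteq> nbhd V R w" using Rs uV v by (simp add: nbhd_def)
      qed (use two(2)[OF uV(2)] ne finN in auto)
      have tri: "triangular R ?T"
      proof -
        have "nbhd ?T R v = {u, w}" "nbhd ?T R u = {v, w}" "nbhd ?T R w = {v, u}"
          using uw Nu Nw by (auto simp: nbhd_def)
        thus ?thesis using Rs ne uw(2) unfolding triangular_def by blast
      qed
      have cT: "card ?T = 3" using ne uw by simp
      hence c3: "c \<ge> 3" using less.prems(2)[of ?T] tri v uV by auto
      have "card X \<le> c - 3" if X: "X \<subseteq> V - ?T" "triangular R X" for X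
      proof -
        have "\<not> R x y \<and> \<not> R y x" if "x \<in> X" "y \<in> ?T" for x y
        proof -
          have "x \<in> V" "x \<notin> ?T" using X that by auto
          hence "x \<notin> nbhd V R y" using uw Nu Nw that by auto
          hence "\<not> R y x" using \<open>x \<in> V\<close> by (simp add: nbhd_def)
          thus ?thesis using sym[of x y] by blast
        qed
        hence "triangular R (X \<union> ?T)" using X tri by (intro triangular_Un) auto
        hence "card (X \<union> ?T) \<le> c" using X v uV by (intro less.prems(2)) auto
        moreover have "card (X \<union> ?T) = card X + card ?T"
          using X fin by (intro card_Un_disjoint) (auto intro: finite_subset)
        ultimately show ?thesis using cT by simp
      qed
      moreover have cVT: "card (V - ?T) = card V - 3" using cT v uV fin by (subst card_Diff_subset) auto
      moreover have "card V \<ge> 3" using card_mono[OF fin, of ?T] cT v uV by auto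
      ultimately have B: "real (card (mis (V - ?T) R)) \<le> sqrt 2 ^ (card V - 3) * kappa ^ (c - 3)"
        using less.hyps[of "V - ?T" "c - 3"] fin by auto
      also have "\<dots> = W / (sqrt 2 ^ 3 * kappa ^ 3)"
        using c3 \<open>card V \<ge> 3\<close> kappa_ge1 by (simp add: power_diff W_def)
      finally have B: "real (card (mis (V - ?T) R)) \<le> W / 3" by (simp add: sqrt2_kappa)
      have "mis V R \<subseteq> {I \<in> mis V R. v \<in> I} \<union> {I \<in> mis V R. u \<in> I} \<union> {I \<in> mis V R. w \<in> I}"
        using hit[of _ v] v uw by auto
      hence "card (mis V R) \<le> card ({I \<in> mis V R. v \<in> I} \<union> {I \<in> mis V R. u \<in> I} \<union> {I \<in> mis V R. w \<in> I})"
        using finite_mis[OF fin] by (intro card_mono) auto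
      also have "\<dots> \<le> card {I \<in> mis V R. v \<in> I} + card {I \<in> mis V R. u \<in> I} + card {I \<in> mis V R. w \<in> I}"
        by (intro order_trans[OF card_Un_le] add_mono card_Un_le order_refl)
      also have "\<dots> \<le> card (mis (V - ?T) R) + card (mis (V - ?T) R) + card (mis (V - ?T) R)"
      proof (intro add_mono)
        show "card {I \<in> mis V R. v \<in> I} \<le> card (mis (V - ?T) R)"
          using card_mem[OF order_refl, of v] by (simp add: uw)
        show "card {I \<in> mis V R. u \<in> I} \<le> card (mis (V - ?T) R)"
          using card_mem[OF order_refl, of u] by (simp add: Nu insert_commute)
        show "card {I \<in> mis V R. w \<in> I} \<le> card (mis (V - ?T) R)"
          using card_mem[OF order_refl, of w] by (simp add: Nw insert_commute)
      qed
      finally show ?thesis unfolding W_def[symmetric] using B by linarith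
    next
      case False
      \<comment> \<open>A maximal set avoiding \<open>v\<close> and \<open>u\<close> must contain
        \<open>w\<close>. As \<open>u\<close> is not adjacent to \<open>w\<close>, this branch loses
        \<open>u\<close> in addition to the closed neighbourhood of \<open>w\<close>: four vertices
        in all.\<close>
      let ?U = "V - {v} - {u}"
      have "mis V R \<subseteq> {I \<in> mis V R. v \<in> I} \<union> {I \<in> mis V R. u \<in> I} \<union> {I \<in> mis ?U R. w \<in> I}"
      proof
        fix I assume I: "I \<in> mis V R"
        show "I \<in> {I \<in> mis V R. v \<in> I} \<union> {I \<in> mis V R. u \<in> I} \<union> {I \<in> mis ?U R. w \<in> I}"
        proof (cases "v \<in> I \<or> u \<in> I")
          case n: False
          hence "I \<in> mis (V - {v}) R" using I mis_del[of V R v] by blast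
          hence "I \<in> mis ?U R" using n mis_del[of "V - {v}" R u] by blast
          moreover have "w \<in> I" using n hit[OF I v] uw by auto
          ultimately show ?thesis by blast
        qed (use I in auto)
      qed
      hence "card (mis V R) \<le> card ({I \<in> mis V R. v \<in> I} \<union> {I \<in> mis V R. u \<in> I} \<union> {I \<in> mis ?U R. w \<in> I})"
        using finite_mis[OF fin] finite_mis[of ?U] fin by (intro card_mono) auto
      also have "\<dots> \<le> card {I \<in> mis V R. v \<in> I} + card {I \<in> mis V R. u \<in> I} + card {I \<in> mis ?U R. w \<in> I}"
        by (intro order_trans[OF card_Un_le] add_mono card_Un_le order_refl)
      finally have 1: "card (mis V R) \<le> card {I \<in> mis V R. v \<in> I} + card {I \<in> mis V R. u \<in> I} + card {I \<in> mis ?U R. w \<in> I}" .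
      have 2: "real (card {I \<in> mis V R. v \<in> I}) \<le> D 3" by (rule mem) (use v two(2) in simp_all)
      have 3: "real (card {I \<in> mis V R. u \<in> I}) \<le> D 3" by (rule mem) (use uV two(2) in simp_all)
      let ?D = "insert u (?N w)"
      have eq: "?U - insert w (nbhd ?U R w) = V - ?D"
        using sym[OF Rv(2)] v by (auto simp: nbhd_def)
      have "u \<notin> ?N w" using False sym[of w u] uw(2) by (auto simp: nbhd_def)
      hence "card ?D = 4" using cN[of w] two(2)[OF uV(2)] finN[OF order_refl, of w] by simp
      moreover have "?D \<subseteq> V" using NV uV by auto
      ultimately have "card (V - ?D) + 4 \<le> card V"
        using fin card_mono[OF fin \<open>?D \<subseteq> V\<close>] card_Diff_subset[OF finite_subset[OF \<open>?D \<subseteq> V\<close> fin] \<open>?D \<subseteq> V\<close>] by linarith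
      hence "real (card (mis (V - ?D) R)) \<le> D 4" by (intro IH) auto
      moreover have "card {I \<in> mis ?U R. w \<in> I} \<le> card (mis (V - ?D) R)"
        using card_mem[of ?U w] eq by auto
      ultimately have 4: "real (card {I \<in> mis ?U R. w \<in> I}) \<le> D 4" by linarith
      show ?thesis unfolding W_def[symmetric] using 1 2 3 4 w3 w4 W0 by linarith
    qed
  qed
qed

section \<open>Triangle removal\<close>

text \<open>The conditional expectation of \<open>f\<close> given the label \<open>\<pi>\<close>,
  for the uniform measure on \<open>P\<close>.\<close>

definition avg :: "'p set \<Rightarrow> ('p \<Rightarrow> 'l) \<Rightarrow> ('p \<Rightarrow> real) \<Rightarrow> 'p \<Rightarrow> real" where
  "avg P \<pi> f p = (\<Sum>q\<in>{q\<in>P. \<pi> q = \<pi> p}. f q) / card {q\<in>P. \<pi> q = \<pi> p}"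

text \<open>Averaging preserves inner products with functions of the label; this is the source of
  the orthogonality used below.\<close>

lemma sum_avg:
  assumes fin: "finite P"
  shows "(\<Sum>p\<in>P. u (\<pi> p) * avg P \<pi> f p) = (\<Sum>p\<in>P. u (\<pi> p) * f p)"
proof -
  let ?N = "\<lambda>p. real (card {q\<in>P. \<pi> q = \<pi> p})"
  have "(\<Sum>p\<in>P. u (\<pi> p) * avg P \<pi> f p) = (\<Sum>p\<in>P. \<Sum>q\<in>P. if \<pi> q = \<pi> p then u (\<pi> p) * f q / ?N p else 0)"
    unfolding avg_def
    by (intro sum.cong refl) (simp add: sum_distrib_left sum_divide_distrib sum.If_cases fin Int_def)
  also have "\<dots> = (\<Sum>q\<in>P. \<Sum>p\<in>P. if \<pi> q = \<pi> p then u (\<pi> p) * f q / ?N p else 0)"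
    by (rule sum.swap)
  also have "\<dots> = (\<Sum>q\<in>P. u (\<pi> q) * f q)"
  proof (rule sum.cong)
    fix q assume q: "q \<in> P"
    have "(\<Sum>p\<in>P. if \<pi> q = \<pi> p then u (\<pi> p) * f q / ?N p else 0)
        = (\<Sum>p\<in>P. if \<pi> q = \<pi> p then u (\<pi> q) * f q / ?N q else 0)"
      by (intro sum.cong) auto
    also have "\<dots> = card {p\<in>P. \<pi> p = \<pi> q} * (u (\<pi> q) * f q / ?N q)"
    proof -
      have "P \<inter> {p. \<pi> q = \<pi> p} = {p\<in>P. \<pi> p = \<pi> q}" by auto
      thus ?thesis using fin by (simp add: sum.If_cases)
    qed
    also have "\<dots> = u (\<pi> q) * f q"
      using q fin by (auto simp: card_eq_0_iff)
    finally show "(\<Sum>p\<in>P. if \<pi> q = \<pi> p then u (\<pi> p) * f q / ?N p else 0) = u (\<pi> q) * f q" .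
  qed simp
  finally show ?thesis .
qed

lemma avg_bounds:
  assumes "\<And>q. q \<in> P \<Longrightarrow> 0 \<le> f q \<and> f q \<le> 1" "finite P"
  shows "0 \<le> avg P \<pi> f p" "avg P \<pi> f p \<le> 1"
proof -
  show "0 \<le> avg P \<pi> f p" unfolding avg_def using assms by (intro divide_nonneg_nonneg sum_nonneg) auto
  have "(\<Sum>q\<in>{q\<in>P. \<pi> q = \<pi> p}. f q) \<le> (\<Sum>q\<in>{q\<in>P. \<pi> q = \<pi> p}. 1)"
    using assms by (intro sum_mono) auto
  thus "avg P \<pi> f p \<le> 1" unfolding avg_def by (auto simp: divide_le_eq_1)
qed

text \<open>The map \<open>h\<close> expresses that \<open>\<rho>\<close> refines
  \<open>\<pi>\<close>. The coarse average is then also a function of the fine label, so it is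
  orthogonal to the difference of the two averages.\<close>

lemma avg_pythagoras:
  assumes fin: "finite P" and ref: "\<And>p. \<pi> p = h (\<rho> p)"
  shows "(\<Sum>p\<in>P. (avg P \<rho> f p)\<^sup>2) - (\<Sum>p\<in>P. (avg P \<pi> f p)\<^sup>2) = (\<Sum>p\<in>P. (avg P \<rho> f p - avg P \<pi> f p)\<^sup>2)"
proof -
  let ?a = "avg P \<pi> f" and ?b = "avg P \<rho> f"
  define c where "c l = (\<Sum>q\<in>{q\<in>P. \<pi> q = l}. f q) / card {q\<in>P. \<pi> q = l}" for l
  have a: "?a p = c (\<pi> p)" for p by (simp add: avg_def c_def)
  have 1: "(\<Sum>p\<in>P. ?a p * ?a p) = (\<Sum>p\<in>P. ?a p * f p)"
    using sum_avg[OF fin, of c \<pi> f] by (simp only: a)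
  have 2: "(\<Sum>p\<in>P. ?a p * ?b p) = (\<Sum>p\<in>P. ?a p * f p)"
    using sum_avg[OF fin, of "\<lambda>l. c (h l)" \<rho> f] by (simp add: a ref)
  have "(\<Sum>p\<in>P. (?b p - ?a p)\<^sup>2) = (\<Sum>p\<in>P. (?b p)\<^sup>2) + (\<Sum>p\<in>P. (?a p)\<^sup>2) - 2 * (\<Sum>p\<in>P. ?a p * ?b p)"
    by (simp add: power2_diff sum.distrib sum_subtractf sum_distrib_left mult_ac)
  also have "(\<Sum>p\<in>P. ?a p * ?b p) = (\<Sum>p\<in>P. (?a p)\<^sup>2)" using 1 2 by (simp add: power2_eq_square)
  finally show ?thesis by simp
qed

text \<open>Partitions are given by finite families \<open>W\<close> of sets, their parts being the atoms of \<open>W\<close>; a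
  refinement is then an inclusion of families.\<close>

definition lab :: "'a set set \<Rightarrow> 'a \<Rightarrow> 'a set set" where
  "lab W v = {X\<in>W. v \<in> X}"

definition cell :: "'a set \<Rightarrow> 'a set set \<Rightarrow> 'a set set \<Rightarrow> 'a set" where
  "cell V W L = {v\<in>V. lab W v = L}"

definition edges :: "('a \<times> 'a) set \<Rightarrow> 'a set \<Rightarrow> 'a set \<Rightarrow> real" where
  "edges E X Y = real (card (E \<inter> X \<times> Y))"

definition dens :: "('a \<times> 'a) set \<Rightarrow> 'a set \<Rightarrow> 'a set \<Rightarrow> real" where
  "dens E X Y = edges E X Y / (real (card X) * real (card Y))"

text \<open>Regularity in the cut norm: the error is relative to \<open>X\<close> and \<open>Y\<close>, so no lower bound on the
  sizes of \<open>X'\<close> and \<open>Y'\<close> is needed.\<close>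

definition irreg :: "real \<Rightarrow> ('a \<times> 'a) set \<Rightarrow> 'a set \<Rightarrow> 'a set \<Rightarrow> bool" where
  "irreg \<epsilon> E X Y \<longleftrightarrow> (\<exists>X'\<subseteq>X. \<exists>Y'\<subseteq>Y.
     \<bar>edges E X' Y' - dens E X Y * (real (card X') * real (card Y'))\<bar> > \<epsilon> * (real (card X) * real (card Y)))"

definition pair_lab :: "'a set set \<Rightarrow> 'a \<times> 'a \<Rightarrow> 'a set set \<times> 'a set set" where
  "pair_lab W p = (lab W (fst p), lab W (snd p))"

definition edge_ind :: "('a \<times> 'a) set \<Rightarrow> 'a \<times> 'a \<Rightarrow> real" where
  "edge_ind E p = of_bool (p \<in> E)"

text \<open>The mean-square density of the partition, left unnormalised: it ranges up to the square
  of \<open>card V\<close>.\<close>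

definition energy :: "'a set \<Rightarrow> ('a \<times> 'a) set \<Rightarrow> 'a set set \<Rightarrow> real" where
  "energy V E W = (\<Sum>p\<in>V \<times> V. (avg (V \<times> V) (pair_lab W) (edge_ind E) p)\<^sup>2)"

text \<open>Counting pairs of vertices weights each pair of cells by the product of their sizes, so
  the partition may be far from equitable.\<close>

definition irreg_pairs :: "real \<Rightarrow> 'a set \<Rightarrow> ('a \<times> 'a) set \<Rightarrow> 'a set set \<Rightarrow> ('a \<times> 'a) set" where
  "irreg_pairs \<epsilon> V E W =
     {p\<in>V \<times> V. irreg \<epsilon> E (cell V W (lab W (fst p))) (cell V W (lab W (snd p)))}"

section \<open>Energy increment and the regularity lemma\<close>

lemma sum_edge_ind:
  assumes "finite Q" shows "(\<Sum>p\<in>Q. edge_ind E p) = real (card (E \<inter> Q))"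
proof -
  have "(\<Sum>p\<in>Q. edge_ind E p) = (\<Sum>p\<in>Q \<inter> E. 1)"
    using assms by (simp add: edge_ind_def of_bool_def sum.If_cases)
  also have "Q \<inter> E = E \<inter> Q" by (rule Int_commute)
  finally show ?thesis by simp
qed

lemma fibre_pair_lab: "{q\<in>V \<times> V. pair_lab W q = (L, M)} = cell V W L \<times> cell V W M"
  by (auto simp: pair_lab_def cell_def)

lemma avg_pair_lab:
  assumes "finite V"
  shows "avg (V \<times> V) (pair_lab W) (edge_ind E) p = dens E (cell V W (lab W (fst p))) (cell V W (lab W (snd p)))"
proof -
  have "{q\<in>V \<times> V. pair_lab W q = pair_lab W p} = cell V W (lab W (fst p)) \<times> cell V W (lab W (snd p))"
    unfolding pair_lab_def[of W p] by (rule fibre_pair_lab)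
  moreover have "finite (cell V W L)" for L using assms by (auto simp: cell_def)
  ultimately show ?thesis
    unfolding avg_def by (simp add: sum_edge_ind dens_def edges_def card_cartesian_product)
qed

lemma energy_le:
  assumes "finite V" shows "energy V E W \<le> real (card V) ^ 2"
proof -
  have "energy V E W \<le> (\<Sum>p\<in>V \<times> V. 1)" unfolding energy_def
  proof (rule sum_mono)
    fix p
    show "(avg (V \<times> V) (pair_lab W) (edge_ind E) p)\<^sup>2 \<le> 1"
      using avg_bounds[of "V \<times> V" "edge_ind E" "pair_lab W" p] assms by (simp add: edge_ind_def power_le_one)
  qed
  thus ?thesis by (simp add: card_cartesian_product power2_eq_square)
qed

lemma energy_nonneg: "0 \<le> energy V E W"
  unfolding energy_def by (intro sum_nonneg) simp

lemma lab_Int: "W \<subseteq> W' \<Longrightarrow> lab W v = lab W' v \<inter> W"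
  by (auto simp: lab_def)

text \<open>As \<open>X\<close> and \<open>Y\<close> belong to \<open>W'\<close>, they are unions of
  its atoms, and the sum of \<open>b - a\<close> over \<open>X \<times> Y\<close> is exactly the
  discrepancy of the pair. Cauchy--Schwarz turns it into a lower bound for the sum of
  squares.\<close>

lemma energy_increment_cell:
  assumes V: "finite V" and ref: "W \<subseteq> W'" and eps: "\<epsilon> > 0"
    and X: "X \<subseteq> cell V W L" "X \<in> W'" and Y: "Y \<subseteq> cell V W M" "Y \<in> W'"
    and irr: "\<bar>edges E X Y - dens E (cell V W L) (cell V W M) * (real (card X) * real (card Y))\<bar>
      > \<epsilon> * (real (card (cell V W L)) * real (card (cell V W M)))"
  defines "a \<equiv> avg (V \<times> V) (pair_lab W) (edge_ind E)" and "b \<equiv> avg (V \<times> V) (pair_lab W') (edge_ind E)"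
  shows "(\<Sum>p\<in>X \<times> Y. (b p - a p)\<^sup>2) \<ge> \<epsilon>\<^sup>2 * (real (card (cell V W L)) * real (card (cell V W M)))"
proof -
  let ?P = "V \<times> V"
  let ?w = "real (card (cell V W L)) * real (card (cell V W M))"
  have XV: "X \<subseteq> V" "Y \<subseteq> V" using X Y by (auto simp: cell_def)
  have fin: "finite X" "finite Y" using XV V finite_subset by auto
  have finc: "finite (cell V W L)" "finite (cell V W M)" using V by (auto simp: cell_def)
  define u :: "'a set set \<times> 'a set set \<Rightarrow> real" where "u l = of_bool (X \<in> fst l \<and> Y \<in> snd l)" for l
  have u: "u (pair_lab W' p) = of_bool (p \<in> X \<times> Y)" for p
    using X Y by (cases p) (auto simp: u_def pair_lab_def lab_def)
  have restr: "(\<Sum>p\<in>?P. u (pair_lab W' p) * g p) = (\<Sum>p\<in>X \<times> Y. g p)" for g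
  proof -
    have "(\<Sum>p\<in>X \<times> Y. g p) = (\<Sum>p\<in>X \<times> Y. u (pair_lab W' p) * g p)" by (intro sum.cong) (auto simp: u)
    also have "\<dots> = (\<Sum>p\<in>?P. u (pair_lab W' p) * g p)"
      using XV V by (intro sum.mono_neutral_left) (auto simp: u)
    finally show ?thesis by simp
  qed
  have sb: "(\<Sum>p\<in>X \<times> Y. b p) = edges E X Y"
    using sum_avg[of ?P u "pair_lab W'" "edge_ind E"] V fin
    unfolding restr b_def[symmetric] by (simp add: sum_edge_ind edges_def)
  have "(\<Sum>p\<in>X \<times> Y. a p) = (\<Sum>p\<in>X \<times> Y. dens E (cell V W L) (cell V W M))"
  proof (rule sum.cong)
    fix p assume "p \<in> X \<times> Y"
    hence "lab W (fst p) = L" "lab W (snd p) = M" using X Y by (auto simp: cell_def)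
    thus "a p = dens E (cell V W L) (cell V W M)" unfolding a_def avg_pair_lab[OF V] by simp
  qed simp
  hence sa: "(\<Sum>p\<in>X \<times> Y. a p) = dens E (cell V W L) (cell V W M) * (real (card X) * real (card Y))"
    by (simp add: card_cartesian_product)
  have w0: "?w \<ge> 0" by simp
  have le: "real (card X) * real (card Y) \<le> ?w"
    using X Y finc by (intro mult_mono) (auto intro: card_mono)
  have "(\<epsilon> * ?w)\<^sup>2 \<le> (\<Sum>p\<in>X \<times> Y. b p - a p)\<^sup>2"
    using irr eps w0 unfolding sum_subtractf sa sb by (intro abs_le_square_iff[THEN iffD1]) auto
  also have "\<dots> \<le> (\<Sum>p\<in>X \<times> Y. (b p - a p)\<^sup>2) * card (X \<times> Y)"
    by (rule sum_squared_le_sum_of_squares)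
  also have "\<dots> = (\<Sum>p\<in>X \<times> Y. (b p - a p)\<^sup>2) * (real (card X) * real (card Y))"
    by (simp add: card_cartesian_product)
  also have "\<dots> \<le> (\<Sum>p\<in>X \<times> Y. (b p - a p)\<^sup>2) * ?w"
    using le by (intro mult_left_mono sum_nonneg) auto
  finally have *: "\<epsilon>\<^sup>2 * ?w * ?w \<le> (\<Sum>p\<in>X \<times> Y. (b p - a p)\<^sup>2) * ?w"
    by (simp add: power2_eq_square mult_ac)
  show ?thesis
  proof (cases "?w = 0")
    case True
    show ?thesis unfolding True by (simp add: sum_nonneg)
  next
    case False
    hence "?w > 0" using w0 by linarith
    from mult_right_le_imp_le[OF * this] show ?thesis .
  qed
qed

text \<open>The new family adds the two witnesses of every irregular pair of labels, at most
  \<open>4 ^ card W\<close> pairs. Each pair of cells gains \<epsilon>^2 times its weight, and the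
  irregular pairs have total weight above \<epsilon> times that of all pairs; hence the third
  power.\<close>

lemma energy_increment:
  fixes V :: "'a set"
  assumes V: "finite V" and W: "finite W" and eps: "\<epsilon> > 0"
    and irr: "real (card (irreg_pairs \<epsilon> V E W)) > \<epsilon> * real (card V) ^ 2"
  shows "\<exists>W'. finite W' \<and> card W' \<le> card W + 2 * 4 ^ card W \<and>
    energy V E W' \<ge> energy V E W + \<epsilon> ^ 3 * real (card V) ^ 2"
proof -
  let ?c = "cell V W"
  define B where "B = {(L, M). L \<in> Pow W \<and> M \<in> Pow W \<and> irreg \<epsilon> E (?c L) (?c M)}"
  define wit where "wit l Z \<longleftrightarrow> fst Z \<subseteq> ?c (fst l) \<and> snd Z \<subseteq> ?c (snd l) \<and>
     \<bar>edges E (fst Z) (snd Z) - dens E (?c (fst l)) (?c (snd l)) * (real (card (fst Z)) * real (card (snd Z)))\<bar>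
      > \<epsilon> * (real (card (?c (fst l))) * real (card (?c (snd l))))" for l Z
  have "\<exists>Z. wit l Z" if "l \<in> B" for l
  proof -
    have "irreg \<epsilon> E (?c (fst l)) (?c (snd l))" using that by (auto simp: B_def)
    then obtain X Y where "wit l (X, Y)" unfolding irreg_def wit_def fst_conv snd_conv by blast
    thus ?thesis by blast
  qed
  then obtain Z where "\<And>l. l \<in> B \<Longrightarrow> wit l (Z l)" by metis
  note Z = this[unfolded wit_def]
  define W' where "W' = W \<union> (\<lambda>l. fst (Z l)) ` B \<union> (\<lambda>l. snd (Z l)) ` B"
  have Bsub: "B \<subseteq> Pow W \<times> Pow W" by (auto simp: B_def)
  have finB: "finite B" by (rule finite_subset[OF Bsub]) (use W in simp)
  have "card B \<le> card (Pow W \<times> Pow W)" by (rule card_mono[OF _ Bsub]) (use W in simp)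
  also have "\<dots> = 4 ^ card W"
    by (simp add: card_cartesian_product card_Pow W flip: power_mult_distrib)
  finally have cB: "card B \<le> 4 ^ card W" .
  have "card W' \<le> card (W \<union> (\<lambda>l. fst (Z l)) ` B) + card ((\<lambda>l. snd (Z l)) ` B)"
    unfolding W'_def by (rule card_Un_le)
  also have "\<dots> \<le> card W + card ((\<lambda>l. fst (Z l)) ` B) + card ((\<lambda>l. snd (Z l)) ` B)"
    by (intro add_right_mono card_Un_le)
  also have "\<dots> \<le> card W + card B + card B" by (intro add_mono card_image_le finB order_refl)
  finally have cW': "card W' \<le> card W + 2 * 4 ^ card W" using cB by linarith
  have ref: "W \<subseteq> W'" by (auto simp: W'_def)
  define a where "a = avg (V \<times> V) (pair_lab W) (edge_ind E)"
  define b where "b = avg (V \<times> V) (pair_lab W') (edge_ind E)"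
  let ?w = "\<lambda>l. real (card (?c (fst l))) * real (card (?c (snd l)))"
  let ?R = "\<lambda>l. fst (Z l) \<times> snd (Z l)"
  have cellsub: "?R l \<subseteq> ?c (fst l) \<times> ?c (snd l)" if "l \<in> B" for l using Z[OF that] by auto
  have finc: "finite (?c L)" for L using V by (auto simp: cell_def)
  have finR: "finite (?R l)" if "l \<in> B" for l
    by (rule finite_subset[OF cellsub[OF that]]) (simp add: finc)
  have disj: "(?c (fst l) \<times> ?c (snd l)) \<inter> (?c (fst m) \<times> ?c (snd m)) = {}" if "l \<noteq> m" for l m
    using that by (auto simp: cell_def prod_eq_iff)
  have "irreg_pairs \<epsilon> V E W = (\<Union>l\<in>B. ?c (fst l) \<times> ?c (snd l))"
    by (auto simp: irreg_pairs_def B_def cell_def lab_def)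
  hence "card (irreg_pairs \<epsilon> V E W) = (\<Sum>l\<in>B. card (?c (fst l) \<times> ?c (snd l)))"
    using finB finc disj by (simp add: card_UN_disjoint)
  hence card_irr: "real (card (irreg_pairs \<epsilon> V E W)) = (\<Sum>l\<in>B. ?w l)"
    by (simp add: card_cartesian_product)
  have "\<epsilon> ^ 3 * real (card V) ^ 2 \<le> \<epsilon>\<^sup>2 * real (card (irreg_pairs \<epsilon> V E W))"
    using mult_left_mono[OF less_imp_le[OF irr], of "\<epsilon>\<^sup>2"] by (simp add: power3_eq_cube power2_eq_square mult_ac)
  also have "\<dots> = (\<Sum>l\<in>B. \<epsilon>\<^sup>2 * ?w l)" by (simp add: card_irr sum_distrib_left)
  also have "\<dots> \<le> (\<Sum>l\<in>B. \<Sum>p\<in>?R l. (b p - a p)\<^sup>2)"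
  proof (rule sum_mono)
    fix l assume l: "l \<in> B"
    show "\<epsilon>\<^sup>2 * ?w l \<le> (\<Sum>p\<in>?R l. (b p - a p)\<^sup>2)"
      unfolding a_def b_def
      by (rule energy_increment_cell[OF V ref eps]) (use Z[OF l] l in \<open>auto simp: W'_def\<close>)
  qed
  also have "\<dots> = (\<Sum>p\<in>(\<Union>l\<in>B. ?R l). (b p - a p)\<^sup>2)"
  proof (rule sum.UNION_disjoint[symmetric, OF finB])
    show "\<forall>l\<in>B. \<forall>m\<in>B. l \<noteq> m \<longrightarrow> ?R l \<inter> ?R m = {}"
      using disj cellsub by blast
  qed (use finR in blast)
  also have "\<dots> \<le> (\<Sum>p\<in>V \<times> V. (b p - a p)\<^sup>2)"
  proof (rule sum_mono2)
    show "(\<Union>l\<in>B. ?R l) \<subseteq> V \<times> V" using cellsub by (fastforce simp: cell_def)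
  qed (use V in auto)
  also have "\<dots> = energy V E W' - energy V E W"
  proof -
    have "pair_lab W p = (fst (pair_lab W' p) \<inter> W, snd (pair_lab W' p) \<inter> W)" for p
      by (simp add: pair_lab_def lab_Int[OF ref])
    thus ?thesis
      using avg_pythagoras[where P="V \<times> V" and \<pi>="pair_lab W" and \<rho>="pair_lab W'" and f="edge_ind E"
          and h="\<lambda>l. (fst l \<inter> W, snd l \<inter> W)"] V
      unfolding energy_def a_def b_def by simp
  qed
  finally have "energy V E W' \<ge> energy V E W + \<epsilon> ^ 3 * real (card V) ^ 2" by simp
  moreover have "finite W'" unfolding W'_def using W finB by simp
  ultimately show ?thesis using cW' by blast
qed

text \<open>Bounds the number of generating sets; a partition generated by that many sets has at
  most \<open>2 ^ tower k\<close> atoms.\<close>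

fun tower :: "nat \<Rightarrow> nat" where
  "tower 0 = 0" | "tower (Suc k) = tower k + 2 * 4 ^ tower k"

text \<open>With \<open>k\<close> chosen so that k \<epsilon>^3 > 1, \<open>k\<close> successive
  increments would push the energy above its maximum, so some stage is regular. The bound
  \<open>tower k\<close> depends on \<open>\<epsilon>\<close> only.\<close>

lemma regularity:
  assumes eps: "\<epsilon> > 0"
  shows "\<exists>K. \<forall>V E. finite V \<longrightarrow> V \<noteq> {} \<longrightarrow>
    (\<exists>W. finite W \<and> card W \<le> K \<and> real (card (irreg_pairs \<epsilon> V E W)) \<le> \<epsilon> * real (card V) ^ 2)"
proof -
  obtain k :: nat where k: "1 < real k * \<epsilon> ^ 3" using eps by (metis zero_less_power reals_Archimedean3)
  have "\<exists>W. finite W \<and> card W \<le> tower k \<and> real (card (irreg_pairs \<epsilon> V E W)) \<le> \<epsilon> * real (card V) ^ 2"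
    if V: "finite V" "V \<noteq> {}" for V :: "'a set" and E
  proof (rule ccontr)
    assume no: "\<not> ?thesis"
    have "\<exists>W. finite W \<and> card W \<le> tower j \<and> energy V E W \<ge> real j * \<epsilon> ^ 3 * real (card V) ^ 2" if "j \<le> k" for j
      using that
    proof (induction j)
      case 0
      show ?case using energy_nonneg by (intro exI[of _ "{}"]) simp
    next
      case (Suc j)
      then obtain W where W: "finite W" "card W \<le> tower j" "energy V E W \<ge> real j * \<epsilon> ^ 3 * real (card V) ^ 2"
        by auto
      have mono: "tower j \<le> tower i" if "j \<le> i" for i
        by (rule lift_Suc_mono_le[of tower, OF _ that]) simp
      have "card W \<le> tower k" using W(2) mono[of k] Suc.prems by linarith
      hence "real (card (irreg_pairs \<epsilon> V E W)) > \<epsilon> * real (card V) ^ 2" using no W(1) not_le by blast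
      from energy_increment[OF V(1) W(1) eps this]
      obtain W' where W': "finite W'" "card W' \<le> card W + 2 * 4 ^ card W"
        "energy V E W' \<ge> energy V E W + \<epsilon> ^ 3 * real (card V) ^ 2" by blast
      have "(4::nat) ^ card W \<le> 4 ^ tower j" using W(2) by (intro power_increasing) auto
      hence "card W' \<le> tower (Suc j)" using W'(2) W(2) unfolding tower.simps by linarith
      moreover have "energy V E W' \<ge> real (Suc j) * \<epsilon> ^ 3 * real (card V) ^ 2"
        using W'(3) W(3) by (simp add: algebra_simps)
      ultimately show ?case using W'(1) by blast
    qed
    from this[of k] obtain W where W: "energy V E W \<ge> real k * \<epsilon> ^ 3 * real (card V) ^ 2" by auto
    have "real (card V) ^ 2 > 0" using V by (simp add: card_gt_0_iff)
    hence "1 * real (card V) ^ 2 < real k * \<epsilon> ^ 3 * real (card V) ^ 2" using k by (intro mult_strict_right_mono) auto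
    thus False using W energy_le[OF V(1), of E W] by linarith
  qed
  thus ?thesis by blast
qed


section \<open>Counting and removing triangles\<close>

lemma not_irregD:
  assumes "\<not> irreg \<epsilon> E X Y" "X' \<subseteq> X" "Y' \<subseteq> Y"
  shows "edges E X' Y' \<ge> dens E X Y * (real (card X') * real (card Y')) - \<epsilon> * (real (card X) * real (card Y))"
proof -
  have "\<not> \<bar>edges E X' Y' - dens E X Y * (real (card X') * real (card Y'))\<bar> > \<epsilon> * (real (card X) * real (card Y))"
    using assms unfolding irreg_def by blast
  thus ?thesis by linarith
qed

lemma edges_sum2:
  assumes "finite A" "finite B"
  shows "edges E A B = (\<Sum>z\<in>B. real (card {y\<in>A. (y, z) \<in> E}))"
proof -
  have "card (E \<inter> A \<times> B) = card (SIGMA z:B. {y\<in>A. (y, z) \<in> E})"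
    by (rule bij_betw_same_card[of prod.swap]) (auto simp: bij_betw_def inj_on_def)
  thus ?thesis using assms by (simp add: edges_def)
qed

lemma edges_sum1:
  assumes "finite A" "finite B"
  shows "edges E A B = (\<Sum>x\<in>A. real (card {z\<in>B. (x, z) \<in> E}))"
proof -
  have "E \<inter> A \<times> B = (SIGMA x:A. {z\<in>B. (x, z) \<in> E})" by auto
  thus ?thesis using assms by (simp add: edges_def)
qed

lemma dens_le_1:
  assumes "finite X" "finite Y" shows "0 \<le> dens E X Y" "dens E X Y \<le> 1"
proof -
  have "card (E \<inter> X \<times> Y) \<le> card (X \<times> Y)" using assms by (intro card_mono) auto
  hence "edges E X Y \<le> real (card X) * real (card Y)"
    by (simp add: edges_def card_cartesian_product flip: of_nat_mult)
  thus "dens E X Y \<le> 1" by (auto simp: dens_def divide_le_eq_1 zero_less_mult_iff)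
qed (simp add: dens_def edges_def)

lemma edges_dens:
  assumes "finite X" "finite Y"
  shows "edges E X Y = dens E X Y * (real (card X) * real (card Y))"
proof (cases "X = {} \<or> Y = {}")
  case False
  thus ?thesis using assms by (simp add: dens_def)
qed (auto simp: edges_def)

text \<open>Regularity of \<open>X\<close>, \<open>Y\<close> is applied to the two neighbourhoods of
  each \<open>z\<close>. After an exchange of sums, regularity of \<open>Y\<close>, \<open>Z\<close>
  is applied to \<open>Y\<close> and the neighbourhood of each \<open>x\<close>, and the edges
  between \<open>X\<close> and \<open>Z\<close> are counted exactly. Each application costs one
  \<open>\<epsilon>\<close>.\<close>

lemma count_triangles:
  assumes fin: "finite X" "finite Y" "finite Z" and reg: "\<not> irreg \<epsilon> E X Y" "\<not> irreg \<epsilon> E Y Z"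
    and eps: "\<epsilon> \<ge> 0"
  shows "real (card {(x, y, z). x \<in> X \<and> y \<in> Y \<and> z \<in> Z \<and> (x, y) \<in> E \<and> (y, z) \<in> E \<and> (x, z) \<in> E})
    \<ge> (dens E X Y * dens E Y Z * dens E X Z - 2 * \<epsilon>) * (real (card X) * real (card Y) * real (card Z))"
proof -
  define Xz where "Xz z = {x\<in>X. (x, z) \<in> E}" for z
  define Yz where "Yz z = {y\<in>Y. (y, z) \<in> E}" for z
  define Zx where "Zx x = {z\<in>Z. (x, z) \<in> E}" for x
  let ?d1 = "dens E X Y" and ?d2 = "dens E Y Z" and ?d3 = "dens E X Z"
  let ?a = "real (card X)" and ?b = "real (card Y)" and ?c = "real (card Z)"
  let ?T = "{(x, y, z). x \<in> X \<and> y \<in> Y \<and> z \<in> Z \<and> (x, y) \<in> E \<and> (y, z) \<in> E \<and> (x, z) \<in> E}"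
  have finz: "finite (Xz z)" "finite (Yz z)" "finite (Zx z)" for z
    using fin by (simp_all add: Xz_def Yz_def Zx_def)
  have "card (SIGMA z:Z. E \<inter> Xz z \<times> Yz z) = card ?T"
    by (rule bij_betw_same_card[of "\<lambda>(z, x, y). (x, y, z)"])
      (force simp: bij_betw_def inj_on_def Xz_def Yz_def)
  hence N: "real (card ?T) = (\<Sum>z\<in>Z. edges E (Xz z) (Yz z))"
    using fin finz by (simp add: edges_def flip: of_nat_sum)
  have "(\<Sum>z\<in>Z. ?d1 * (real (card (Xz z)) * real (card (Yz z))) - \<epsilon> * (?a * ?b)) \<le> real (card ?T)"
    unfolding N by (intro sum_mono not_irregD reg) (auto simp: Xz_def Yz_def)
  hence 1: "?d1 * (\<Sum>z\<in>Z. real (card (Xz z)) * real (card (Yz z))) - \<epsilon> * (?a * ?b * ?c) \<le> real (card ?T)"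
    by (simp add: sum_subtractf sum_distrib_left mult_ac)
  have "(\<Sum>z\<in>Z. real (card (Xz z)) * real (card (Yz z)))
      = (\<Sum>z\<in>Z. \<Sum>x\<in>X. if (x, z) \<in> E then real (card (Yz z)) else 0)"
    using fin by (intro sum.cong[OF refl]) (simp add: Xz_def sum.If_cases Int_def)
  also have "\<dots> = (\<Sum>x\<in>X. \<Sum>z\<in>Z. if (x, z) \<in> E then real (card (Yz z)) else 0)" by (rule sum.swap)
  also have "\<dots> = (\<Sum>x\<in>X. \<Sum>z\<in>Zx x. real (card (Yz z)))"
    using fin by (intro sum.cong[OF refl], subst sum.If_cases) (auto simp: Zx_def Int_def intro: sum.cong)
  also have "\<dots> = (\<Sum>x\<in>X. edges E Y (Zx x))"
    unfolding Yz_def by (rule sum.cong[OF refl], rule edges_sum2[symmetric]) (simp_all add: fin finz)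
  finally have sw: "(\<Sum>z\<in>Z. real (card (Xz z)) * real (card (Yz z))) = (\<Sum>x\<in>X. edges E Y (Zx x))" .
  have "(\<Sum>x\<in>X. ?d2 * (?b * real (card (Zx x))) - \<epsilon> * (?b * ?c))
      = ?d2 * ?b * (\<Sum>x\<in>X. real (card (Zx x))) - \<epsilon> * (?a * ?b * ?c)"
    by (simp add: sum_subtractf sum_distrib_left mult_ac)
  also have "(\<Sum>x\<in>X. real (card (Zx x))) = ?d3 * (?a * ?c)"
    unfolding Zx_def edges_sum1[OF fin(1,3), symmetric] by (rule edges_dens[OF fin(1,3)])
  finally have "?d2 * ?b * (?d3 * (?a * ?c)) - \<epsilon> * (?a * ?b * ?c)
      = (\<Sum>x\<in>X. ?d2 * (?b * real (card (Zx x))) - \<epsilon> * (?b * ?c))" by (rule HOL.sym)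
  also have "\<dots> \<le> (\<Sum>x\<in>X. edges E Y (Zx x))"
    by (intro sum_mono not_irregD reg) (auto simp: Zx_def)
  finally have 2: "?d2 * ?b * (?d3 * (?a * ?c)) - \<epsilon> * (?a * ?b * ?c)
    \<le> (\<Sum>z\<in>Z. real (card (Xz z)) * real (card (Yz z)))" unfolding sw .
  note d1 = dens_le_1[OF fin(1,2), of E]
  have "\<epsilon> * (?a * ?b * ?c) \<ge> 0" using eps by simp
  hence "?d1 * (\<epsilon> * (?a * ?b * ?c)) \<le> \<epsilon> * (?a * ?b * ?c)" using d1 by (intro mult_left_le_one_le) auto
  moreover have "?d1 * (?d2 * ?b * (?d3 * (?a * ?c)) - \<epsilon> * (?a * ?b * ?c))
     \<le> ?d1 * (\<Sum>z\<in>Z. real (card (Xz z)) * real (card (Yz z)))"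
    by (intro mult_left_mono 2 d1)
  ultimately have "?d1 * (?d2 * ?b * (?d3 * (?a * ?c))) - 2 * (\<epsilon> * (?a * ?b * ?c)) \<le> real (card ?T)"
    using 1 unfolding right_diff_distrib by linarith
  thus ?thesis by (simp add: algebra_simps)
qed

text \<open>\<open>F\<close> collects the pairs in irregular, sparse or small cells. A triangle
  avoiding it would sit in large, dense, regular cells and force too many triangles. The oriented
  pattern allows a non-symmetric \<open>E\<close>, as needed for the pairs with difference in a
  given set.\<close>

lemma triangle_removal:
  assumes eta: "\<eta> > 0"
  shows "\<exists>\<epsilon>>0. \<forall>(V :: 'a set) E. finite V \<longrightarrow> E \<subseteq> V \<times> V \<longrightarrow>
    real (card {(x, y, z). (x, y) \<in> E \<and> (y, z) \<in> E \<and> (x, z) \<in> E}) \<le> \<epsilon> * real (card V) ^ 3 \<longrightarrow>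
    (\<exists>F\<subseteq>V \<times> V. real (card F) \<le> \<eta> * real (card V) ^ 2 \<and>
      (\<forall>x y z. (x, y) \<in> E \<longrightarrow> (y, z) \<in> E \<longrightarrow> (x, z) \<in> E \<longrightarrow> (x, y) \<in> F \<or> (y, z) \<in> F \<or> (x, z) \<in> F))"
proof -
  \<comment> \<open>\<open>F\<close> costs \<epsilon>' \<le> \<delta> for irregular pairs, \<delta>
    for edges of low density and 2\<delta> for the two sides of small cells, hence the division by
    four.\<close>
  define \<delta> where "\<delta> = min 1 \<eta> / 4"
  have \<delta>: "\<delta> > 0" "\<delta> \<le> 1" "4 * \<delta> \<le> \<eta>" using eta by (auto simp: \<delta>_def min_def)
  define \<epsilon>' where "\<epsilon>' = \<delta> ^ 3 / 4"
  have \<epsilon>': "\<epsilon>' > 0" using \<delta> by (simp add: \<epsilon>'_def)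
  have "\<delta> ^ 3 \<le> \<delta> ^ 1" using \<delta> by (intro power_decreasing) auto
  hence \<epsilon>'2: "\<epsilon>' \<le> \<delta>" using \<delta> by (simp add: \<epsilon>'_def)
  obtain K where K: "\<And>(V :: 'a set) E. finite V \<Longrightarrow> V \<noteq> {} \<Longrightarrow>
    (\<exists>W. finite W \<and> card W \<le> K \<and> real (card (irreg_pairs \<epsilon>' V E W)) \<le> \<epsilon>' * real (card V) ^ 2)"
    using regularity[OF \<epsilon>'] by blast
  \<comment> \<open>There are at most \<open>2 ^ K\<close> cells, so those below this relative size
    cover at most a fraction \<open>\<delta>\<close> of \<open>V\<close>. The value of
    \<open>\<epsilon>\<close> below is half of what counting guarantees in cells above it.\<close>
  define \<gamma> where "\<gamma> = \<delta> / 2 ^ K"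
  have \<gamma>: "\<gamma> > 0" using \<delta> by (simp add: \<gamma>_def)
  define \<epsilon> where "\<epsilon> = \<delta> ^ 3 / 4 * \<gamma> ^ 3"
  have eps0: "\<epsilon> > 0" using \<gamma> \<delta> by (simp add: \<epsilon>_def)
  have "\<exists>F\<subseteq>V \<times> V. real (card F) \<le> \<eta> * real (card V) ^ 2 \<and>
      (\<forall>x y z. (x, y) \<in> E \<longrightarrow> (y, z) \<in> E \<longrightarrow> (x, z) \<in> E \<longrightarrow> (x, y) \<in> F \<or> (y, z) \<in> F \<or> (x, z) \<in> F)"
    if V: "finite V" and E: "E \<subseteq> V \<times> V"
    and tri: "real (card {(x, y, z). (x, y) \<in> E \<and> (y, z) \<in> E \<and> (x, z) \<in> E}) \<le> \<epsilon> * real (card V) ^ 3"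
    for V :: "'a set" and E
  proof (cases "V = {}")
    case True
    thus ?thesis using E by (intro exI[of _ "{}"]) auto
  next
    case False
    let ?n = "real (card V)"
    have n0: "?n > 0" using False V by (simp add: card_gt_0_iff)
    obtain W where W: "finite W" "card W \<le> K" "real (card (irreg_pairs \<epsilon>' V E W)) \<le> \<epsilon>' * ?n ^ 2"
      using K[OF V False] by blast
    define c where "c v = cell V W (lab W v)" for v
    have finc: "finite (c v)" for v using V by (simp add: c_def cell_def)
    define Sm where "Sm = {v\<in>V. real (card (c v)) < \<gamma> * ?n}"
    have U: "(\<Union>L\<in>Pow W. {v\<in>Sm. lab W v = L}) = Sm"
    proof (rule Set.set_eqI)
      fix v
      have "lab W v \<in> Pow W" unfolding lab_def by simp
      thus "v \<in> (\<Union>L\<in>Pow W. {v\<in>Sm. lab W v = L}) \<longleftrightarrow> v \<in> Sm"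
        unfolding UN_iff mem_Collect_eq by metis
    qed
    have "card (\<Union>L\<in>Pow W. {v\<in>Sm. lab W v = L}) \<le> (\<Sum>L\<in>Pow W. card {v\<in>Sm. lab W v = L})"
      by (rule card_UN_le) (use W in simp)
    hence "card Sm \<le> (\<Sum>L\<in>Pow W. card {v\<in>Sm. lab W v = L})" unfolding U .
    hence "real (card Sm) \<le> (\<Sum>L\<in>Pow W. real (card {v\<in>Sm. lab W v = L}))"
      unfolding of_nat_sum[symmetric] by (rule of_nat_mono)
    also have "\<dots> \<le> (\<Sum>L\<in>Pow W. \<gamma> * ?n)"
    proof (rule sum_mono)
      fix L
      show "real (card {v\<in>Sm. lab W v = L}) \<le> \<gamma> * ?n"
      proof (cases "{v\<in>Sm. lab W v = L} = {}")
        case True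
        show ?thesis unfolding True using \<gamma> n0 by simp
      next
        case False
        then obtain v where v: "v \<in> Sm" "lab W v = L" by auto
        have "card {v\<in>Sm. lab W v = L} \<le> card (c v)"
          using v by (intro card_mono finc) (auto simp: c_def cell_def Sm_def)
        moreover have "real (card (c v)) < \<gamma> * ?n" using v by (simp add: Sm_def)
        ultimately show ?thesis by linarith
      qed
    qed
    also have "\<dots> = 2 ^ card W * (\<gamma> * ?n)" using W by (simp add: card_Pow)
    also have "\<dots> \<le> 2 ^ K * (\<gamma> * ?n)" using W \<gamma> n0 by (intro mult_right_mono power_increasing) auto
    also have "\<dots> = \<delta> * ?n" by (simp add: \<gamma>_def)
    finally have Sm: "real (card Sm) \<le> \<delta> * ?n" .
    define Lo where "Lo = {p\<in>E. dens E (c (fst p)) (c (snd p)) < \<delta>}"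
    \<comment> \<open>Being in a sparse pair of cells depends on the label only, so by
      \<open>sum_avg\<close> the edges there can be counted by summing densities, each below
      \<open>\<delta>\<close>.\<close>
    define u :: "'a set set \<times> 'a set set \<Rightarrow> real"
      where "u l = of_bool (dens E (cell V W (fst l)) (cell V W (snd l)) < \<delta>)" for l
    have "real (card Lo) = (\<Sum>p\<in>V \<times> V. if p \<in> Lo then 1 else 0)"
    proof -
      have "(V \<times> V) \<inter> Lo = Lo" using E by (auto simp: Lo_def)
      thus ?thesis using V by (simp add: sum.If_cases)
    qed
    also have "\<dots> = (\<Sum>p\<in>V \<times> V. u (pair_lab W p) * edge_ind E p)"
      by (intro sum.cong) (auto simp: Lo_def u_def pair_lab_def edge_ind_def c_def)
    also have "\<dots> = (\<Sum>p\<in>V \<times> V. u (pair_lab W p) * avg (V \<times> V) (pair_lab W) (edge_ind E) p)"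
      by (rule sum_avg[symmetric]) (use V in simp)
    also have "\<dots> \<le> (\<Sum>p\<in>V \<times> V. \<delta>)"
      unfolding avg_pair_lab[OF V] using \<delta> by (intro sum_mono) (simp add: u_def pair_lab_def)
    also have "\<dots> = \<delta> * ?n ^ 2" by (simp add: card_cartesian_product power2_eq_square)
    finally have Lo: "real (card Lo) \<le> \<delta> * ?n ^ 2" .
    define F where "F = irreg_pairs \<epsilon>' V E W \<union> Lo \<union> Sm \<times> V \<union> V \<times> Sm"
    have "card F \<le> card (irreg_pairs \<epsilon>' V E W) + card Lo + card (Sm \<times> V) + card (V \<times> Sm)"
      unfolding F_def by (intro order_trans[OF card_Un_le] add_mono card_Un_le order_refl)
    hence "real (card F) \<le> real (card (irreg_pairs \<epsilon>' V E W)) + real (card Lo) + 2 * (real (card Sm) * ?n)"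
      by (simp add: card_cartesian_product mult_ac flip: of_nat_add of_nat_mult)
    also have "\<dots> \<le> \<epsilon>' * ?n ^ 2 + \<delta> * ?n ^ 2 + 2 * (\<delta> * ?n * ?n)"
      using W Lo Sm n0 by (intro add_mono mult_left_mono mult_right_mono) auto
    also have "\<dots> = (\<epsilon>' + 3 * \<delta>) * ?n ^ 2" by (simp add: algebra_simps power2_eq_square)
    also have "\<dots> \<le> \<eta> * ?n ^ 2" using \<epsilon>'2 \<delta> by (intro mult_right_mono) auto
    finally have cF: "real (card F) \<le> \<eta> * ?n ^ 2" .
    have "(x, y) \<in> F \<or> (y, z) \<in> F \<or> (x, z) \<in> F" if xyz: "(x, y) \<in> E" "(y, z) \<in> E" "(x, z) \<in> E" for x y z
    proof (rule ccontr)
      assume n: "\<not> ?thesis"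
      have inV: "x \<in> V" "y \<in> V" "z \<in> V" using xyz E by auto
      have big: "\<gamma> * ?n \<le> real (card (c x))" "\<gamma> * ?n \<le> real (card (c y))" "\<gamma> * ?n \<le> real (card (c z))"
        using n inV by (auto simp: F_def Sm_def not_less)
      have reg: "\<not> irreg \<epsilon>' E (c x) (c y)" "\<not> irreg \<epsilon>' E (c y) (c z)"
        using n inV by (auto simp: F_def irreg_pairs_def c_def)
      have d: "\<delta> \<le> dens E (c x) (c y)" "\<delta> \<le> dens E (c y) (c z)" "\<delta> \<le> dens E (c x) (c z)"
        using n xyz by (auto simp: F_def Lo_def not_less)
      let ?T = "{(x', y', z'). x' \<in> c x \<and> y' \<in> c y \<and> z' \<in> c z \<and> (x', y') \<in> E \<and> (y', z') \<in> E \<and> (x', z') \<in> E}"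
      let ?T' = "{(x, y, z). (x, y) \<in> E \<and> (y, z) \<in> E \<and> (x, z) \<in> E}"
      have "finite ?T'" by (rule finite_subset[of _ "V \<times> V \<times> V"]) (use E V in auto)
      hence "card ?T \<le> card ?T'" by (rule card_mono) auto
      hence le: "real (card ?T) \<le> \<epsilon> * ?n ^ 3" using tri by linarith
      have "\<delta> * \<delta> * \<delta> \<le> dens E (c x) (c y) * dens E (c y) (c z) * dens E (c x) (c z)"
        using d \<delta> by (intro mult_mono) auto
      hence dd: "\<delta> ^ 3 / 2 \<le> dens E (c x) (c y) * dens E (c y) (c z) * dens E (c x) (c z) - 2 * \<epsilon>'"
        by (simp add: \<epsilon>'_def power3_eq_cube)
      have "\<delta> ^ 3 / 2 * (\<gamma> * ?n * (\<gamma> * ?n) * (\<gamma> * ?n)) \<le>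
        (dens E (c x) (c y) * dens E (c y) (c z) * dens E (c x) (c z) - 2 * \<epsilon>')
         * (real (card (c x)) * real (card (c y)) * real (card (c z)))"
      proof (rule mult_mono[OF dd])
        show "0 \<le> dens E (c x) (c y) * dens E (c y) (c z) * dens E (c x) (c z) - 2 * \<epsilon>'"
          by (rule order_trans[OF _ dd]) (use \<delta> in simp)
        show "\<gamma> * ?n * (\<gamma> * ?n) * (\<gamma> * ?n) \<le> real (card (c x)) * real (card (c y)) * real (card (c z))"
          using big \<gamma> n0 by (intro mult_mono) auto
      qed (use \<gamma> n0 in auto)
      also have "\<dots> \<le> real (card ?T)"
        by (rule count_triangles) (use finc reg \<epsilon>' in auto)
      also have "\<dots> \<le> \<epsilon> * ?n ^ 3" by (rule le)
      finally have "2 * (\<epsilon> * ?n ^ 3) \<le> \<epsilon> * ?n ^ 3" by (simp add: \<epsilon>_def power3_eq_cube mult_ac)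
      moreover have "\<epsilon> * ?n ^ 3 > 0" using eps0 n0 by simp
      ultimately show False by linarith
    qed
    moreover have "F \<subseteq> V \<times> V" using E by (auto simp: F_def irreg_pairs_def Lo_def Sm_def)
    ultimately show ?thesis using cF by blast
  qed
  thus ?thesis using eps0 by blast
qed

section \<open>Containers and removal for Schur triples\<close>

definition sumfree :: "'a::ab_group_add set \<Rightarrow> bool" where
  "sumfree S \<longleftrightarrow> (\<forall>x\<in>S. \<forall>y\<in>S. x + y \<notin> S)"

definition schur :: "'a::ab_group_add set \<Rightarrow> ('a \<times> 'a) set" where
  "schur A = {(x, y). x \<in> A \<and> y \<in> A \<and> x + y \<in> A}"

definition codeg :: "'a::ab_group_add set \<Rightarrow> 'a \<Rightarrow> nat" where
  "codeg A v = card {x\<in>A. x + v \<in> A}"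

text \<open>This set depends on \<open>S\<close> only through \<open>T\<close> and \<open>F\<close>,
  so there are no more such sets than pairs (T, F).\<close>

definition shrunk :: "nat \<Rightarrow> 'a::ab_group_add set \<Rightarrow> 'a set \<Rightarrow> 'a set \<Rightarrow> 'a set" where
  "shrunk d A T F = {x\<in>A - (F + T). card {t\<in>T. x + t \<in> A \<and> x + t \<notin> F + T} < d}"

lemma sumfree_subset: "sumfree S \<Longrightarrow> T \<subseteq> S \<Longrightarrow> sumfree T"
  unfolding sumfree_def by blast

text \<open>A sum-free \<open>S \<supseteq> T\<close> is independent in the graph on \<open>A\<close> joining \<open>x\<close> to \<open>x + t\<close> for \<open>t \<in> T\<close>. A greedy
  small \<open>F \<subseteq> S\<close> leaves every vertex of \<open>S\<close> with fewer than \<open>d\<close> neighbours outside \<open>F + T\<close>.\<close>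

lemma fingerprint:
  fixes A S T :: "'a::ab_group_add set"
  assumes A: "finite A" and S: "S \<subseteq> A" "sumfree S" and T: "T \<subseteq> S" and d: "d > 0"
  shows "\<exists>F\<subseteq>S. d * card F \<le> card A \<and> S \<subseteq> shrunk d A T F"
proof -
  have fS: "finite S" by (rule finite_subset[OF S(1) A])
  have fT: "finite T" by (rule finite_subset[OF T fS])
  \<comment> \<open>The greedy choice, recast as an \<open>F\<close> of largest cardinality all of
    whose members can be charged to \<open>d\<close> elements of \<open>F + T\<close>. An
    \<open>s\<close> with \<open>d\<close> neighbours outside \<open>F + T\<close> could still be
    added.\<close>
  define P where "P F \<longleftrightarrow> F \<subseteq> S \<and> d * card F \<le> card ((F + T) \<inter> A)" for F
  have P0: "P {}" by (simp add: P_def)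
  have bnd: "\<forall>F. P F \<longrightarrow> card F < Suc (card S)" using card_mono[OF fS] by (simp add: P_def less_Suc_eq_le)
  have "\<exists>F. P F \<and> (\<forall>F'. P F' \<longrightarrow> card F' \<le> card F)" by (rule ex_has_greatest_nat[OF P0 bnd])
  then obtain F where F: "P F" and max: "\<And>F'. P F' \<Longrightarrow> card F' \<le> card F" by auto
  have fF: "finite F" using F fS by (auto simp: P_def intro: finite_subset)
  have "S \<subseteq> shrunk d A T F"
  proof
    fix s assume s: "s \<in> S"
    let ?N = "{t\<in>T. s + t \<in> A \<and> s + t \<notin> F + T}"
    have "s \<notin> F + T"
    proof
      assume "s \<in> F + T"
      then obtain f t where "s = f + t" "f \<in> F" "t \<in> T" by (rule set_plus_elim)
      moreover from this have "f \<in> S" "t \<in> S" using F T by (auto simp: P_def)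
      ultimately show False using S(2) s by (auto simp: sumfree_def)
    qed
    moreover have "card ?N < d"
    proof (rule ccontr)
      assume n: "\<not> card ?N < d"
      hence "card ?N > 0" using d by linarith
      hence "?N \<noteq> {}" by (simp only: card_gt_0_iff simp_thms)
      then obtain t where "t \<in> T" "s + t \<notin> F + T" by blast
      hence sF: "s \<notin> F" using set_plus_intro[of s F t T] by blast
      have "(\<lambda>t. s + t) ` ?N \<subseteq> (insert s F + T) \<inter> A" by (auto intro: set_plus_intro)
      moreover have "(F + T) \<inter> A \<subseteq> (insert s F + T) \<inter> A" by (auto elim!: set_plus_elim)
      ultimately have "card (((F + T) \<inter> A) \<union> (\<lambda>t. s + t) ` ?N) \<le> card ((insert s F + T) \<inter> A)"
        using A by (intro card_mono) auto
      moreover have "card (((F + T) \<inter> A) \<union> (\<lambda>t. s + t) ` ?N) = card ((F + T) \<inter> A) + card ?N"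
        using A fT by (subst card_Un_disjoint) (auto simp: card_translate)
      ultimately have "d * card (insert s F) \<le> card ((insert s F + T) \<inter> A)"
        using F n sF fF by (simp add: P_def)
      hence "P (insert s F)" using F s by (simp add: P_def)
      from max[OF this] show False using sF fF by simp
    qed
    ultimately show "s \<in> shrunk d A T F" using s S by (auto simp: shrunk_def)
  qed
  moreover have "card ((F + T) \<inter> A) \<le> card A" using A by (intro card_mono) auto
  ultimately show ?thesis using F unfolding P_def by (intro exI[of _ F]) simp
qed

text \<open>Count the pairs (x, t) with \<open>x\<close> and \<open>x + t\<close> in
  \<open>A\<close>, at least \<open>card T * e\<close> of them. A removed \<open>x\<close> accounts
  for at most \<open>card T\<close> pairs. A kept \<open>x\<close> has fewer than \<open>d\<close>
  partners outside \<open>F + T\<close>, and its other partners are themselves removed elements,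
  which gives the second \<open>card T * card (A - shrunk d A T F)\<close>.\<close>

lemma card_shrunk:
  fixes A T F :: "'a::ab_group_add set"
  assumes A: "finite A" and T: "finite T" and e: "\<And>t. t \<in> T \<Longrightarrow> e \<le> codeg A t"
  shows "card T * e \<le> 2 * card T * card (A - shrunk d A T F) + d * card A"
proof -
  let ?A' = "shrunk d A T F" and ?U = "A \<inter> (F + T)"
  have sub: "?A' \<subseteq> A" and US: "?U \<subseteq> A - ?A'" by (auto simp: shrunk_def)
  have finA': "finite ?A'" by (rule finite_subset[OF sub A])
  have swap: "(\<Sum>t\<in>T. card {x\<in>X. x + t \<in> Y}) = (\<Sum>x\<in>X. card {t\<in>T. x + t \<in> Y})" if "finite X" for X Y
  proof -
    have "(\<Sum>t\<in>T. card {x\<in>X. x + t \<in> Y}) = (\<Sum>t\<in>T. \<Sum>x\<in>X. if x + t \<in> Y then 1 else 0)"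
      using that by (intro sum.cong[OF refl]) (simp add: sum.If_cases Int_def)
    also have "\<dots> = (\<Sum>x\<in>X. \<Sum>t\<in>T. if x + t \<in> Y then 1 else 0)" by (rule sum.swap)
    also have "\<dots> = (\<Sum>x\<in>X. card {t\<in>T. x + t \<in> Y})"
      using T by (intro sum.cong[OF refl]) (simp add: sum.If_cases Int_def)
    finally show ?thesis .
  qed
  have "card T * e = (\<Sum>t\<in>T. e)" by simp
  also have "\<dots> \<le> (\<Sum>t\<in>T. card {x\<in>A. x + t \<in> A})" using e by (intro sum_mono) (simp add: codeg_def)
  also have "\<dots> = (\<Sum>x\<in>A. card {t\<in>T. x + t \<in> A})" by (rule swap[OF A])
  also have "\<dots> = (\<Sum>x\<in>A - ?A'. card {t\<in>T. x + t \<in> A}) + (\<Sum>x\<in>?A'. card {t\<in>T. x + t \<in> A})"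
    by (rule sum.subset_diff[OF sub A])
  also have "\<dots> \<le> (\<Sum>x\<in>A - ?A'. card T) + (\<Sum>x\<in>?A'. card {t\<in>T. x + t \<in> ?U} + d)"
  proof (intro add_mono sum_mono)
    fix x show "card {t\<in>T. x + t \<in> A} \<le> card T" using T by (intro card_mono) auto
  next
    fix x assume x: "x \<in> ?A'"
    have "{t\<in>T. x + t \<in> A} = {t\<in>T. x + t \<in> ?U} \<union> {t\<in>T. x + t \<in> A \<and> x + t \<notin> F + T}" by auto
    hence "card {t\<in>T. x + t \<in> A} \<le> card {t\<in>T. x + t \<in> ?U} + card {t\<in>T. x + t \<in> A \<and> x + t \<notin> F + T}"
      using card_Un_le[of "{t\<in>T. x + t \<in> ?U}" "{t\<in>T. x + t \<in> A \<and> x + t \<notin> F + T}"] by simp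
    thus "card {t\<in>T. x + t \<in> A} \<le> card {t\<in>T. x + t \<in> ?U} + d"
      using x by (simp add: shrunk_def)
  qed
  also have "\<dots> = card (A - ?A') * card T + (\<Sum>x\<in>?A'. card {t\<in>T. x + t \<in> ?U}) + d * card ?A'"
    by (simp add: sum.distrib)
  also have "(\<Sum>x\<in>?A'. card {t\<in>T. x + t \<in> ?U}) = (\<Sum>t\<in>T. card {x\<in>?A'. x + t \<in> ?U})"
    by (rule swap[OF finA', symmetric])
  also have "\<dots> \<le> (\<Sum>t\<in>T. card (A - ?A'))"
  proof (rule sum_mono)
    fix t
    show "card {x\<in>?A'. x + t \<in> ?U} \<le> card (A - ?A')"
      by (rule card_inj_on_le[of "\<lambda>x. x + t"]) (use US A in \<open>auto simp: inj_on_def\<close>)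
  qed
  also have "(\<Sum>t\<in>T. card (A - ?A')) = card T * card (A - ?A')" by simp
  also have "d * card ?A' \<le> d * card A" by (intro mult_left_mono card_mono sub A) simp
  finally show ?thesis by (simp add: mult_ac)
qed

text \<open>Sort the Schur pairs by their second entry: outside \<open>B\<close> it occurs fewer
  than \<open>e\<close> times, and the at most \<open>q\<close> entries in \<open>B\<close> occur at
  most \<open>card A\<close> times each.\<close>

lemma card_schur_le:
  assumes A: "finite A" and B: "finite B" "card B \<le> q"
    and C: "C \<subseteq> {v\<in>A. codeg A v < e} \<union> B" "C \<subseteq> A"
  shows "card (schur C) \<le> card A * (e + q)"
proof -
  have fC: "finite C" using C A finite_subset by blast
  have le: "codeg C v \<le> codeg A v" for v unfolding codeg_def using A C by (intro card_mono) auto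
  have "card (schur C) = card (SIGMA v:C. {x\<in>C. x + v \<in> C})"
    by (rule bij_betw_same_card[of prod.swap]) (auto simp: bij_betw_def inj_on_def schur_def image_iff)
  also have "\<dots> = (\<Sum>v\<in>C. codeg C v)" using fC by (simp add: codeg_def)
  also have "\<dots> \<le> (\<Sum>v\<in>C. e + (if v \<in> B then card A else 0))"
  proof (rule sum_mono)
    fix v assume v: "v \<in> C"
    have "codeg A v \<le> card A" unfolding codeg_def using A by (intro card_mono) auto
    moreover have "codeg A v < e" if "v \<notin> B" using that v C by auto
    ultimately show "codeg C v \<le> e + (if v \<in> B then card A else 0)" using le[of v] by auto
  qed
  also have "\<dots> = card C * e + card (C \<inter> B) * card A" using fC by (simp add: sum.distrib sum.If_cases)
  also have "\<dots> \<le> card A * e + q * card A"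
    using card_mono[OF A C(2)] card_mono[OF B(1), of "C \<inter> B"] B(2) by (intro add_mono mult_right_mono) auto
  finally show ?thesis by (simp add: algebra_simps)
qed

text \<open>If at most \<open>q\<close> elements of \<open>S\<close> have large codegree, a container with few Schur pairs is found
  at once. Otherwise \<open>q\<close> of them serve as \<open>T\<close>, and the ambient set loses \<open>c\<close> elements.\<close>

lemma containers_iterate:
  fixes G :: "'a::ab_group_add set"
  assumes G: "finite G" and dq: "d > 0" and e: "2 * q * c + d * card G \<le> q * e" and q: "q > 0"
  defines "X \<equiv> 2 * card {B. B \<subseteq> G \<and> card B \<le> q} * card {F. F \<subseteq> G \<and> d * card F \<le> card G}"
  assumes A: "A \<subseteq> G" "card A \<le> k * c"
  shows "\<exists>\<F>. finite \<F> \<and> card \<F> \<le> X ^ k \<and> (\<forall>C\<in>\<F>. C \<subseteq> G \<and> card (schur C) \<le> card G * (e + q)) \<and>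
    (\<forall>S\<subseteq>A. sumfree S \<longrightarrow> (\<exists>C\<in>\<F>. S \<subseteq> C))"
  using A
proof (induction k arbitrary: A)
  case 0
  have "finite A" by (rule finite_subset[OF 0(1) G])
  hence "A = {}" using 0(2) by simp
  thus ?case by (intro exI[of _ "{{}}"]) (auto simp: schur_def)
next
  case (Suc k)
  let ?Q = "{B. B \<subseteq> G \<and> card B \<le> q}" and ?R = "{F. F \<subseteq> G \<and> d * card F \<le> card G}"
  have finA: "finite A" by (rule finite_subset[OF Suc.prems(1) G])
  have finQ: "finite ?Q" "finite ?R" using G by (auto intro: finite_subset[of _ "Pow G"])
  have Q1: "card ?Q \<ge> 1" "card ?R \<ge> 1"
    using finQ by (auto simp: Suc_le_eq card_gt_0_iff intro: exI[of _ "{}"])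
  \<comment> \<open>\<open>\<F>1\<close> serves the sum-free sets with at most \<open>q\<close>
    elements of large codegree; \<open>I\<close> indexes the pairs (T, F) whose shrunken set is
    small enough for the induction hypothesis. The factor 2 in \<open>X\<close> pays for the two
    kinds.\<close>
  define \<F>1 where "\<F>1 = (\<lambda>B. ({v\<in>A. codeg A v < e} \<union> B) \<inter> A) ` ?Q"
  define I where "I = {(T, F). T \<in> ?Q \<and> F \<in> ?R \<and> card (shrunk d A T F) \<le> k * c}"
  have Isub: "I \<subseteq> ?Q \<times> ?R" by (auto simp: I_def)
  have finI: "finite I" by (rule finite_subset[OF Isub]) (use finQ in simp)
  define good where "good A \<F> \<longleftrightarrow> finite \<F> \<and> card \<F> \<le> X ^ k \<and>
    (\<forall>C\<in>\<F>. C \<subseteq> G \<and> card (schur C) \<le> card G * (e + q)) \<and>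
    (\<forall>S\<subseteq>A. sumfree S \<longrightarrow> (\<exists>C\<in>\<F>. S \<subseteq> C))" for A \<F>
  have "\<exists>\<F>. good (shrunk d A (fst z) (snd z)) \<F>" if "z \<in> I" for z
    unfolding good_def
  proof (rule Suc.IH)
    show "shrunk d A (fst z) (snd z) \<subseteq> G" using Suc.prems by (auto simp: shrunk_def)
  qed (use that in \<open>auto simp: I_def\<close>)
  then obtain \<Phi> where "\<And>z. z \<in> I \<Longrightarrow> good (shrunk d A (fst z) (snd z)) (\<Phi> z)" by metis
  note \<Phi> = this[unfolded good_def]
  define \<F> where "\<F> = \<F>1 \<union> (\<Union>z\<in>I. \<Phi> z)"
  have "finite \<F>" unfolding \<F>_def \<F>1_def using finQ finI \<Phi> by blast
  moreover have "card \<F> \<le> X ^ Suc k"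
  proof -
    have X1: "X ^ k \<ge> 1" using Q1 unfolding X_def by simp
    have "card \<F> \<le> card \<F>1 + card (\<Union>z\<in>I. \<Phi> z)" unfolding \<F>_def by (rule card_Un_le)
    also have "\<dots> \<le> card ?Q + (\<Sum>z\<in>I. card (\<Phi> z))"
      unfolding \<F>1_def by (intro add_mono card_image_le card_UN_le finI finQ)
    also have "\<dots> \<le> card ?Q + (\<Sum>z\<in>I. X ^ k)" using \<Phi> by (intro add_left_mono sum_mono) blast
    also have "\<dots> = card ?Q * 1 * 1 + card I * X ^ k" by simp
    also have "\<dots> \<le> card ?Q * card ?R * X ^ k + card (?Q \<times> ?R) * X ^ k"
      using X1 Q1 card_mono[OF _ Isub] finQ by (intro add_mono mult_mono) auto
    also have "\<dots> = X ^ Suc k" by (simp add: X_def card_cartesian_product mult_ac)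
    finally show ?thesis .
  qed
  moreover have "C \<subseteq> G \<and> card (schur C) \<le> card G * (e + q)" if C: "C \<in> \<F>" for C
  proof (cases "C \<in> \<F>1")
    case True
    then obtain B where B: "B \<subseteq> G" "card B \<le> q" "C = ({v\<in>A. codeg A v < e} \<union> B) \<inter> A"
      by (auto simp: \<F>1_def)
    have "card (schur C) \<le> card A * (e + q)"
      by (rule card_schur_le[OF finA finite_subset[OF B(1) G] B(2)]) (auto simp: B(3))
    also have "\<dots> \<le> card G * (e + q)" using card_mono[OF G Suc.prems(1)] by (rule mult_right_mono) simp
    finally show ?thesis using B Suc.prems by auto
  next
    case False
    then obtain z where "z \<in> I" "C \<in> \<Phi> z" using C by (auto simp: \<F>_def)
    thus ?thesis using \<Phi> by blast
  qed
  moreover have "\<exists>C\<in>\<F>. S \<subseteq> C" if S: "S \<subseteq> A" "sumfree S" for S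
  proof -
    define Bad where "Bad = {v\<in>S. e \<le> codeg A v}"
    have finBad: "finite Bad" unfolding Bad_def using finite_subset[OF S(1) finA] by simp
    show ?thesis
    proof (cases "card Bad \<le> q")
      case True
      have "Bad \<in> ?Q" using True S Suc.prems by (auto simp: Bad_def)
      hence "({v\<in>A. codeg A v < e} \<union> Bad) \<inter> A \<in> \<F>" by (auto simp: \<F>_def \<F>1_def)
      moreover have "S \<subseteq> ({v\<in>A. codeg A v < e} \<union> Bad) \<inter> A" using S by (auto simp: Bad_def)
      ultimately show ?thesis by blast
    next
      case False
      then obtain T where T: "T \<subseteq> Bad" "card T = q" using obtain_subset_with_card_n[of q Bad] by auto
      have TS: "T \<subseteq> S" using T by (auto simp: Bad_def)
      have finT: "finite T" by (rule finite_subset[OF T(1) finBad])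
      obtain F where F: "F \<subseteq> S" "d * card F \<le> card A" "S \<subseteq> shrunk d A T F"
        using fingerprint[OF finA S TS dq] by blast
      have cA: "card A \<le> card G" by (rule card_mono[OF G Suc.prems(1)])
      have "card T * e \<le> 2 * card T * card (A - shrunk d A T F) + d * card A"
        by (rule card_shrunk[OF finA finT]) (use T in \<open>auto simp: Bad_def\<close>)
      hence "q * e \<le> 2 * q * card (A - shrunk d A T F) + d * card G"
        unfolding T(2) using mult_le_mono2[OF cA, of d] by linarith
      hence "2 * q * c \<le> 2 * q * card (A - shrunk d A T F)" using e by linarith
      hence "c \<le> card (A - shrunk d A T F)" using q by simp
      moreover have sub: "shrunk d A T F \<subseteq> A" by (auto simp: shrunk_def)
      moreover have "card (A - shrunk d A T F) = card A - card (shrunk d A T F)"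
        by (rule card_Diff_subset[OF finite_subset[OF sub finA] sub])
      moreover have "card (shrunk d A T F) \<le> card A" by (rule card_mono[OF finA sub])
      ultimately have "card (shrunk d A T F) \<le> k * c" using Suc.prems(2) by simp
      hence I: "(T, F) \<in> I" using T(2) TS F S Suc.prems cA by (auto simp: I_def)
      have "\<exists>C\<in>\<Phi> (T, F). S \<subseteq> C" using \<Phi>[OF I] F(3) S(2) by simp
      thus ?thesis using I unfolding \<F>_def by blast
    qed
  qed
  ultimately show ?case by blast
qed

section \<open>Entropy estimates and the container theorem\<close>

lemma card_small_subsets:
  assumes "finite G"
  shows "card {B. B \<subseteq> G \<and> card B \<le> q} \<le> (card G + 1) ^ q"
proof (induction q)
  case 0
  have "B = {}" if "B \<subseteq> G" "card B = 0" for B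
    using that finite_subset[OF that(1) assms] by simp
  hence "{B. B \<subseteq> G \<and> card B \<le> 0} = {{}}" by auto
  thus ?case by simp
next
  case (Suc q)
  let ?S = "\<lambda>q. {B. B \<subseteq> G \<and> card B \<le> q}"
  have fin: "finite (?S q)" for q using assms by (auto intro: finite_subset[of _ "Pow G"])
  have "?S (Suc q) \<subseteq> ?S q \<union> (\<lambda>(x, B). insert x B) ` (G \<times> ?S q)"
  proof
    fix B assume B: "B \<in> ?S (Suc q)"
    show "B \<in> ?S q \<union> (\<lambda>(x, B). insert x B) ` (G \<times> ?S q)"
    proof (cases "B = {}")
      case False
      then obtain x where x: "x \<in> B" by auto
      have "finite B" using B by (intro finite_subset[OF _ assms]) simp
      from card_Suc_Diff1[OF this x] have "card (B - {x}) \<le> q" using B by simp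
      moreover have "B = insert x (B - {x})" using x by auto
      ultimately show ?thesis using B x by (intro UnI2 image_eqI[of _ _ "(x, B - {x})"]) auto
    qed auto
  qed
  hence "card (?S (Suc q)) \<le> card (?S q \<union> (\<lambda>(x, B). insert x B) ` (G \<times> ?S q))"
    using fin assms by (intro card_mono) auto
  also have "\<dots> \<le> card (?S q) + card (G \<times> ?S q)"
    using fin assms by (intro order_trans[OF card_Un_le] add_mono card_image_le) auto
  also have "\<dots> = (card G + 1) * card (?S q)" by (simp add: card_cartesian_product)
  also have "\<dots> \<le> (card G + 1) * (card G + 1) ^ q" by (intro mult_left_mono Suc.IH) simp
  finally show ?case by simp
qed

lemma sum_power_card_Pow:
  assumes "finite G" shows "(\<Sum>F\<in>Pow G. (x::real) ^ card F) = (1 + x) ^ card G"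
proof -
  have "(\<Sum>F\<in>Pow G. x ^ card F) = (\<Sum>F\<in>Pow G. (\<Prod>_\<in>F. x) * (\<Prod>_\<in>G - F. 1))" by simp
  also have "\<dots> = (\<Prod>_\<in>G. x + 1)" by (rule prod_add[OF assms, symmetric])
  finally show ?thesis by (simp add: add.commute)
qed

text \<open>Weight every subset by (1/d)^|F|. All weights together sum to (1 + 1/d)^n, and a subset
  with at most n/d elements has weight at least d^(-n/d).\<close>

lemma card_sparse_subsets:
  assumes G: "finite G" and d: "d > 0"
  shows "real (card {F. F \<subseteq> G \<and> d * card F \<le> card G}) \<le> exp (real (card G) * ((1 + ln (real d)) / real d))"
proof -
  let ?R = "{F. F \<subseteq> G \<and> d * card F \<le> card G}" and ?n = "real (card G)"
  have "real (card ?R) * exp (- (?n * ln d / d)) = (\<Sum>F\<in>?R. exp (- (?n * ln d / d)))" by simp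
  also have "\<dots> \<le> (\<Sum>F\<in>?R. (1 / real d) ^ card F)"
  proof (rule sum_mono)
    fix F assume "F \<in> ?R"
    hence "real d * real (card F) \<le> ?n" by (simp flip: of_nat_mult)
    hence "real (card F) \<le> ?n / d" using d by (simp add: field_simps)
    moreover have "ln (real d) \<ge> 0" using d by simp
    ultimately have "real (card F) * ln d \<le> ?n / d * ln d" by (rule mult_right_mono)
    hence "exp (- (?n * ln d / d)) \<le> exp (- (real (card F) * ln d))" by simp
    also have "\<dots> = (1 / real d) ^ card F"
      using d by (simp add: exp_minus exp_of_nat_mult power_one_over inverse_eq_divide)
    finally show "exp (- (?n * ln d / d)) \<le> (1 / real d) ^ card F" .
  qed
  also have "\<dots> \<le> (\<Sum>F\<in>Pow G. (1 / real d) ^ card F)" using G by (intro sum_mono2) auto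
  also have "\<dots> = (1 + 1 / real d) ^ card G" by (rule sum_power_card_Pow[OF G])
  also have "\<dots> \<le> exp (1 / real d) ^ card G" using exp_ge_add_one_self[of "1 / real d"] by (intro power_mono) auto
  also have "\<dots> = exp (?n / d)" by (simp flip: exp_of_nat_mult)
  finally have "real (card ?R) \<le> exp (?n / d) * exp (?n * ln d / d)"
    by (simp add: exp_minus field_simps)
  also have "\<dots> = exp (?n * ((1 + ln (real d)) / real d))"
    by (simp add: algebra_simps add_divide_distrib flip: exp_add)
  finally show ?thesis .
qed


text \<open>The constants are fixed in the order \<open>k\<close>, \<open>d\<close>,
  \<open>q\<close>, \<open>N\<close>: \<open>k\<close> bounds the number of rounds, \<open>d\<close>
  makes the sets \<open>F\<close> cheap, \<open>q\<close> absorbs the loss caused by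
  \<open>d\<close>, and \<open>N\<close> makes the polynomially many sets \<open>T\<close>
  negligible. Either kind of set may cost at most \<delta> / (2(k + 1)) per round and
  element.\<close>

lemma containers:
  fixes \<epsilon> \<delta> :: real
  assumes \<epsilon>: "\<epsilon> > 0" and \<delta>: "\<delta> > 0"
  shows "\<exists>N. \<forall>G :: 'a::ab_group_add set. finite G \<longrightarrow> N \<le> card G \<longrightarrow>
    (\<exists>\<F>. finite \<F> \<and> real (card \<F>) \<le> exp (\<delta> * real (card G)) \<and>
      (\<forall>C\<in>\<F>. C \<subseteq> G \<and> real (card (schur C)) \<le> \<epsilon> * real (card G) ^ 2) \<and>
      (\<forall>S\<subseteq>G. sumfree S \<longrightarrow> (\<exists>C\<in>\<F>. S \<subseteq> C)))"
proof -
  define k where "k = nat \<lceil>32 / \<epsilon>\<rceil>"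
  have k: "real k \<ge> 32 / \<epsilon>" unfolding k_def by linarith
  have "((\<lambda>d. (1 + ln (real d)) / real d) \<longlongrightarrow> 0) at_top" by real_asymp
  moreover have "\<delta> / (2 * (real k + 1)) > 0" using \<delta> by simp
  ultimately have "eventually (\<lambda>d. (1 + ln (real d)) / real d < \<delta> / (2 * (real k + 1))) at_top"
    by (rule order_tendstoD(2))
  then obtain d0 where d0: "\<And>d. d \<ge> d0 \<Longrightarrow> (1 + ln (real d)) / real d < \<delta> / (2 * (real k + 1))"
    unfolding eventually_at_top_linorder by blast
  obtain d where d: "d > 0" "(1 + ln (real d)) / real d < \<delta> / (2 * (real k + 1))"
    by (rule that[of "Suc d0"]) (simp, rule d0, simp)
  define q where "q = nat \<lceil>8 * real d / \<epsilon>\<rceil> + 1"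
  have q: "real q \<ge> 8 * real d / \<epsilon>" "q > 0"
    unfolding q_def using real_nat_ceiling_ge[of "8 * real d / \<epsilon>"] by simp_all
  have qd: "real d \<le> real q * \<epsilon> / 8" using q \<epsilon> by (simp add: field_simps)
  have "((\<lambda>n. (ln 2 + real q * ln (real n + 1)) / real n) \<longlongrightarrow> 0) at_top" by real_asymp
  moreover have "\<delta> / (2 * (real k + 1)) > 0" using \<delta> by simp
  ultimately have "eventually (\<lambda>n. (ln 2 + real q * ln (real n + 1)) / real n < \<delta> / (2 * (real k + 1))) at_top"
    by (rule order_tendstoD(2))
  then obtain N0 where N0: "\<And>n. n \<ge> N0 \<Longrightarrow> (ln 2 + real q * ln (real n + 1)) / real n < \<delta> / (2 * (real k + 1))"
    unfolding eventually_at_top_linorder by blast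
  define N where "N = N0 + nat \<lceil>32 / \<epsilon>\<rceil> + nat \<lceil>2 * real q / \<epsilon>\<rceil> + 1"
  have "\<exists>\<F>. finite \<F> \<and> real (card \<F>) \<le> exp (\<delta> * real (card G)) \<and>
      (\<forall>C\<in>\<F>. C \<subseteq> G \<and> real (card (schur C)) \<le> \<epsilon> * real (card G) ^ 2) \<and>
      (\<forall>S\<subseteq>G. sumfree S \<longrightarrow> (\<exists>C\<in>\<F>. S \<subseteq> C))"
    if G: "finite G" and n: "N \<le> card G" for G :: "'a set"
  proof -
    let ?n = "real (card G)"
    have nN: "card G \<ge> N0" "card G > 0" using n by (auto simp: N_def)
    have "?n \<ge> real N" using n by simp
    moreover have "real N \<ge> 32 / \<epsilon>" "real N \<ge> 2 * real q / \<epsilon>"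
      unfolding N_def using real_nat_ceiling_ge[of "32 / \<epsilon>"] real_nat_ceiling_ge[of "2 * real q / \<epsilon>"] by simp_all
    ultimately have "?n \<ge> 32 / \<epsilon>" "?n \<ge> 2 * real q / \<epsilon>" by linarith+
    hence n32: "\<epsilon> * ?n \<ge> 32" and nq: "\<epsilon> * ?n \<ge> 2 * real q" using \<epsilon> by (simp_all add: field_simps)
    \<comment> \<open>Both 2qc and dn are at most q\<epsilon>n/8, together at most q\<epsilon>n/4
      \<le> qe. The threshold 32 for \<epsilon>n keeps \<open>c\<close> at least \<epsilon>n/32
      after rounding, so \<open>k\<close> rounds exhaust \<open>G\<close>. Finally e + q \<le>
      \<epsilon>n/2 + \<epsilon>n/2 bounds the Schur pairs.\<close>
    define e where "e = nat \<lfloor>\<epsilon> * ?n / 2\<rfloor>"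
    define c where "c = nat \<lfloor>\<epsilon> * ?n / 16\<rfloor>"
    have e: "real e \<le> \<epsilon> * ?n / 2" "real e \<ge> \<epsilon> * ?n / 4" unfolding e_def using n32 by linarith+
    have c: "real c \<le> \<epsilon> * ?n / 16" "real c \<ge> \<epsilon> * ?n / 32" unfolding c_def using n32 by linarith+
    have "2 * (real q * real c) + real d * ?n \<le> real q * real e"
    proof -
      have "real q * real c \<le> real q * (\<epsilon> * ?n / 16)" using c by (intro mult_left_mono) auto
      moreover have "real d * ?n \<le> real q * \<epsilon> / 8 * ?n" using qd by (intro mult_right_mono) auto
      moreover have "real q * (\<epsilon> * ?n / 4) \<le> real q * real e" using e by (intro mult_left_mono) auto
      ultimately show ?thesis by (simp add: field_simps)
    qed
    hence "real (2 * q * c + d * card G) \<le> real (q * e)" by simp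
    hence ineq: "2 * q * c + d * card G \<le> q * e" by (simp only: of_nat_le_iff)
    have "?n = 32 / \<epsilon> * (\<epsilon> * ?n / 32)" using \<epsilon> by simp
    also have "\<dots> \<le> real k * real c" using k c \<epsilon> by (intro mult_mono) auto
    finally have kc: "card G \<le> k * c" by (simp flip: of_nat_mult)
    let ?Q = "card {B. B \<subseteq> G \<and> card B \<le> q}" and ?R = "card {F. F \<subseteq> G \<and> d * card F \<le> card G}"
    obtain \<F> where F: "finite \<F>" "card \<F> \<le> (2 * ?Q * ?R) ^ k"
      "\<forall>C\<in>\<F>. C \<subseteq> G \<and> card (schur C) \<le> card G * (e + q)"
      "\<forall>S\<subseteq>G. sumfree S \<longrightarrow> (\<exists>C\<in>\<F>. S \<subseteq> C)"
      using containers_iterate[OF G d(1) ineq q(2) order_refl kc] by blast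
    have "real (card (schur C)) \<le> \<epsilon> * ?n ^ 2" if "C \<in> \<F>" for C
    proof -
      have "real (card (schur C)) \<le> real (card G * (e + q))" using F(3) that by (intro of_nat_mono) blast
      also have "\<dots> = ?n * (real e + real q)" by simp
      also have "\<dots> \<le> ?n * (\<epsilon> * ?n)" using e nq by (intro mult_left_mono) auto
      finally show ?thesis by (simp add: power2_eq_square mult_ac)
    qed
    moreover have "real (card \<F>) \<le> exp (\<delta> * ?n)"
    proof -
      have "real ?Q \<le> real ((card G + 1) ^ q)" by (intro of_nat_mono card_small_subsets G)
      also have "\<dots> = exp (real q * ln (?n + 1))" by (simp add: exp_of_nat_mult add.commute)
      finally have Q: "real ?Q \<le> exp (real q * ln (?n + 1))" .
      have "real (card \<F>) \<le> real ((2 * ?Q * ?R) ^ k)" using F(2) by (rule of_nat_mono)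
      also have "\<dots> = (exp (ln 2) * real ?Q * real ?R) ^ k" by simp
      also have "\<dots> \<le> (exp (ln 2) * exp (real q * ln (?n + 1)) * exp (?n * ((1 + ln (real d)) / real d))) ^ k"
        by (intro power_mono mult_mono Q card_sparse_subsets[OF G d(1)] order_refl mult_nonneg_nonneg
            exp_ge_zero of_nat_0_le_iff)
      also have "\<dots> = exp (real k * (ln 2 + real q * ln (?n + 1) + ?n * ((1 + ln (real d)) / real d)))"
        by (simp only: exp_of_nat_mult[of k] exp_add)
      also have "\<dots> \<le> exp (\<delta> * ?n)"
      proof -
        define s where "s = \<delta> / (2 * (real k + 1))"
        have s0: "s \<ge> 0" "2 * s * (real k + 1) = \<delta>" using \<delta> by (simp_all add: s_def field_simps)
        have 1: "ln 2 + real q * ln (?n + 1) \<le> s * ?n"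
          using less_imp_le[OF N0[OF nN(1)]] nN(2) unfolding s_def[symmetric] by (simp add: pos_divide_le_eq)
        have 2: "?n * ((1 + ln (real d)) / real d) \<le> ?n * s"
          by (rule mult_left_mono[OF less_imp_le]) (use d(2) in \<open>simp_all add: s_def\<close>)
        have "ln 2 + real q * ln (?n + 1) + ?n * ((1 + ln (real d)) / real d) \<le> 2 * s * ?n"
          using 1 2 by (simp add: mult.commute[of _ s])
        hence "real k * (ln 2 + real q * ln (?n + 1) + ?n * ((1 + ln (real d)) / real d)) \<le> real k * (2 * s * ?n)"
          by (rule mult_left_mono) simp
        also have "\<dots> \<le> (real k + 1) * (2 * s * ?n)" using s0 by (intro mult_right_mono) auto
        also have "\<dots> = (2 * s * (real k + 1)) * ?n" by (simp only: ac_simps)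
        also have "\<dots> = \<delta> * ?n" unfolding s0(2) ..
        finally show ?thesis by simp
      qed
      finally show ?thesis .
    qed
    moreover have "C \<subseteq> G" if "C \<in> \<F>" for C using F(3) that by blast
    ultimately show ?thesis using F(1,4) by (intro exI[of _ \<F>] conjI ballI) simp_all
  qed
  thus ?thesis by (intro exI[of _ N] allI impI)
qed

text \<open>A Schur pair \<open>(a, b)\<close> of \<open>A\<close> yields the \<open>card G\<close> edge-disjoint triangles
  \<open>x, x + a, x + a + b\<close> in the graph of the pairs \<open>(x, y)\<close> with \<open>y - x \<in> A\<close>.\<close>

lemma removal:
  assumes eta: "\<eta> > 0"
  shows "\<exists>\<epsilon>>0. \<forall>(G :: 'a::ab_group_add set) A. subgrp G \<longrightarrow> A \<subseteq> G \<longrightarrow>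
    real (card (schur A)) \<le> \<epsilon> * real (card G) ^ 2 \<longrightarrow>
    (\<exists>C\<subseteq>A. real (card C) \<le> \<eta> * real (card G) \<and> sumfree (A - C))"
proof -
  have "\<eta> / 3 > 0" using eta by simp
  from triangle_removal[OF this] obtain \<epsilon> where eps: "\<epsilon> > 0" and
    "\<forall>(V :: 'a set) E. finite V \<longrightarrow> E \<subseteq> V \<times> V \<longrightarrow>
    real (card {(x, y, z). (x, y) \<in> E \<and> (y, z) \<in> E \<and> (x, z) \<in> E}) \<le> \<epsilon> * real (card V) ^ 3 \<longrightarrow>
    (\<exists>F\<subseteq>V \<times> V. real (card F) \<le> \<eta> / 3 * real (card V) ^ 2 \<and>
      (\<forall>x y z. (x, y) \<in> E \<longrightarrow> (y, z) \<in> E \<longrightarrow> (x, z) \<in> E \<longrightarrow> (x, y) \<in> F \<or> (y, z) \<in> F \<or> (x, z) \<in> F))"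
    by (elim exE conjE) (rule that)
  note rem = this(2)[rule_format]
  have "\<exists>C\<subseteq>A. real (card C) \<le> \<eta> * real (card G) \<and> sumfree (A - C)"
    if G: "subgrp G" and A: "A \<subseteq> G" and s: "real (card (schur A)) \<le> \<epsilon> * real (card G) ^ 2"
    for G A :: "'a set"
  proof -
    let ?n = "real (card G)"
    note finG = subgrpD(1)[OF G]
    have finA: "finite A" by (rule finite_subset[OF A finG])
    have n0: "card G > 0" using G by (auto simp: subgrp_def card_gt_0_iff)
    have finS: "finite (schur A)" by (rule finite_subset[of _ "A \<times> A"]) (auto simp: schur_def finA)
    define E where "E = {(x, y). x \<in> G \<and> y \<in> G \<and> y - x \<in> A}"
    let ?T = "{(x, y, z). (x, y) \<in> E \<and> (y, z) \<in> E \<and> (x, z) \<in> E}"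
    have "card ?T \<le> card (G \<times> schur A)"
    proof (rule card_inj_on_le)
      show "inj_on (\<lambda>(x, y, z). (x, y - x, z - y)) ?T" by (auto simp: inj_on_def)
      show "(\<lambda>(x, y, z). (x, y - x, z - y)) ` ?T \<subseteq> G \<times> schur A" by (auto simp: E_def schur_def)
    qed (use finG finS in simp)
    hence "real (card ?T) \<le> ?n * real (card (schur A))"
      by (simp add: card_cartesian_product flip: of_nat_mult)
    also have "\<dots> \<le> ?n * (\<epsilon> * ?n ^ 2)" using s by (intro mult_left_mono) auto
    finally have T: "real (card ?T) \<le> \<epsilon> * ?n ^ 3" by (simp add: power2_eq_square power3_eq_cube mult_ac)
    have "E \<subseteq> G \<times> G" by (auto simp: E_def)
    from rem[OF finG this T] obtain F0 where F0: "F0 \<subseteq> G \<times> G" "real (card F0) \<le> \<eta> / 3 * ?n ^ 2"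
      "\<And>x y z. (x, y) \<in> E \<Longrightarrow> (y, z) \<in> E \<Longrightarrow> (x, z) \<in> E \<Longrightarrow> (x, y) \<in> F0 \<or> (y, z) \<in> F0 \<or> (x, z) \<in> F0"
      by blast
    have finF: "finite F0" by (rule finite_subset[OF F0(1)]) (use finG in simp)
    define m where "m a = card {x\<in>G. (x, x + a) \<in> F0}" for a
    \<comment> \<open>An element goes when at least a third of its \<open>card G\<close> edges lie
      in \<open>F0\<close>, which turns the budget \<eta>/3 into \<eta>. If \<open>a\<close>,
      \<open>b\<close> and \<open>a + b\<close> all survived, fewer than \<open>card G\<close> of
      their triangles could be hit.\<close>
    define C where "C = {a\<in>A. card G \<le> 3 * m a}"
    have finC: "finite C" using finA by (simp add: C_def)
    have "card C * card G = (\<Sum>a\<in>C. card G)" by simp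
    also have "\<dots> \<le> (\<Sum>a\<in>C. 3 * m a)" by (intro sum_mono) (simp add: C_def)
    also have "\<dots> = 3 * card (SIGMA a:C. {x\<in>G. (x, x + a) \<in> F0})"
      using finC finG by (simp add: m_def sum_distrib_left)
    also have "\<dots> \<le> 3 * card F0"
      by (intro mult_left_mono card_inj_on_le[of "\<lambda>(a, x). (x, x + a)"] finF) (auto simp: inj_on_def)
    finally have "real (card C) * ?n \<le> 3 * real (card F0)" by (simp flip: of_nat_mult)
    also have "\<dots> \<le> \<eta> * ?n * ?n" using F0(2) by (simp add: power2_eq_square)
    finally have cC: "real (card C) \<le> \<eta> * ?n" using n0 by simp
    have "a + b \<notin> A - C" if ab: "a \<in> A - C" "b \<in> A - C" for a b
    proof
      assume s: "a + b \<in> A - C"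
      have inG: "a \<in> G" "b \<in> G" "a + b \<in> G" using ab s A by auto
      let ?X = "\<lambda>a. {x\<in>G. (x, x + a) \<in> F0}"
      let ?Y = "{x\<in>G. (x + a, x + a + b) \<in> F0}"
      have lt: "3 * m a < card G" "3 * m b < card G" "3 * m (a + b) < card G"
        using ab s by (auto simp: C_def not_le)
      have "G \<subseteq> ?X a \<union> ?Y \<union> ?X (a + b)"
      proof
        fix x assume x: "x \<in> G"
        hence "x + a \<in> G" "x + a + b \<in> G" using inG subgrpD(5)[OF G] by blast+
        moreover have "x + a + b - x = a + b" by simp
        ultimately have "(x, x + a) \<in> E" "(x + a, x + a + b) \<in> E" "(x, x + a + b) \<in> E"
          using x ab s by (auto simp: E_def)
        from F0(3)[OF this] show "x \<in> ?X a \<union> ?Y \<union> ?X (a + b)" using x by (auto simp: add.assoc)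
      qed
      hence "card G \<le> card (?X a \<union> ?Y \<union> ?X (a + b))" using finG by (intro card_mono) auto
      also have "\<dots> \<le> card (?X a) + card ?Y + card (?X (a + b))"
        by (intro order_trans[OF card_Un_le] add_mono card_Un_le order_refl)
      also have "card ?Y \<le> card (?X b)"
      proof (rule card_inj_on_le)
        show "(\<lambda>x. x + a) ` ?Y \<subseteq> ?X b" using inG subgrpD(5)[OF G] by auto
      qed (use finG in \<open>auto simp: inj_on_def\<close>)
      finally have "card G \<le> m a + m b + m (a + b)" by (simp add: m_def)
      thus False using lt by linarith
    qed
    hence "sumfree (A - C)" by (simp add: sumfree_def)
    moreover have "C \<subseteq> A" by (auto simp: C_def)
    ultimately show ?thesis using cC by blast
  qed
  thus ?thesis by (intro exI[of _ \<epsilon>] conjI eps allI impI)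
qed

section \<open>Link graphs and large sum-free sets\<close>

definition msf :: "'a::ab_group_add set \<Rightarrow> 'a set \<Rightarrow> bool" where
  "msf G S \<longleftrightarrow> S \<subseteq> G \<and> sumfree S \<and> (\<forall>x\<in>G - S. \<not> sumfree (insert x S))"

definition link :: "'a::ab_group_add set \<Rightarrow> 'a \<Rightarrow> 'a \<Rightarrow> bool" where
  "link T x y \<longleftrightarrow> x \<noteq> y \<and> (\<exists>t\<in>T. x + y = t \<or> x + t = y \<or> y + t = x)"

text \<open>An element excluded by \<open>T\<close> alone, for instance one whose double lies in
  \<open>T\<close>, is dropped here instead of becoming a vertex with a loop.\<close>

definition avail :: "'a::ab_group_add set \<Rightarrow> 'a set \<Rightarrow> 'a set" where
  "avail B T = {x\<in>B. sumfree (insert x T)}"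

lemma sumfreeD: "sumfree S \<Longrightarrow> x \<in> S \<Longrightarrow> y \<in> S \<Longrightarrow> x + y \<notin> S"
  by (auto simp: sumfree_def)

lemma zero_notin_sumfree: "sumfree S \<Longrightarrow> 0 \<notin> S"
  using sumfreeD[of S 0 0] by auto

lemma link_sym: "link T x y \<Longrightarrow> link T y x"
  by (auto simp: link_def add.commute)

text \<open>Adding \<open>x\<close> to the maximal set \<open>S\<close> creates a Schur triple. It
  does not lie within \<open>B\<close>, which is sum-free, nor within \<open>T\<close> and
  \<open>x\<close>, since \<open>x\<close> is available; nor does it contain \<open>x\<close> twice.
  So it consists of \<open>x\<close>, an element of \<open>S \<inter> B\<close> and an element of
  \<open>T\<close>, which is an edge.\<close>

lemma msf_mis:
  assumes S: "msf G S" and B: "B \<subseteq> G" "sumfree B"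
  shows "S \<inter> B \<in> mis (avail B (S - B)) (link (S - B))"
proof -
  let ?T = "S - B"
  have sf: "sumfree S" using S by (simp add: msf_def)
  have "S \<inter> B \<subseteq> avail B ?T" unfolding avail_def using sumfree_subset[OF sf] by auto
  moreover have "\<not> link ?T x y" if "x \<in> S \<inter> B" "y \<in> S \<inter> B" for x y
    using that sf unfolding link_def sumfree_def by blast
  moreover have "\<exists>y\<in>S \<inter> B. link ?T y x" if x: "x \<in> avail B ?T - S \<inter> B" for x
  proof -
    have xB: "x \<in> B" "x \<notin> S" and sfx: "sumfree (insert x ?T)" using x by (auto simp: avail_def)
    hence "\<not> sumfree (insert x S)" using S B by (auto simp: msf_def)
    then obtain a b where ab: "a \<in> insert x S" "b \<in> insert x S" "a + b \<in> insert x S"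
      unfolding sumfree_def by blast
    have x0: "x \<noteq> 0" using xB(1) zero_notin_sumfree[OF B(2)] by blast
    have S0: "0 \<notin> S" by (rule zero_notin_sumfree[OF sf])
    have xx: "x + x \<notin> insert x S"
    proof
      assume "x + x \<in> insert x S"
      hence "x + x \<in> S" using x0 by simp
      thus False using sumfreeD[OF B(2) xB(1) xB(1)] sumfreeD[OF sfx, of x x] by blast
    qed
    have shift: "\<exists>y\<in>S \<inter> B. \<exists>t\<in>?T. x + y = t \<or> x + t = y \<or> y + t = x" if c: "c \<in> S" "x + c \<in> S" for c
    proof (cases "c \<in> B")
      case True
      hence "x + c \<notin> B" using sumfreeD[OF B(2) xB(1)] by blast
      thus ?thesis using True c by (intro bexI[of _ c] bexI[of _ "x + c"]) auto
    next
      case False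
      hence "x + c \<in> B" using sumfreeD[OF sfx, of x c] c by blast
      thus ?thesis using False c by (intro bexI[of _ "x + c"] bexI[of _ c]) auto
    qed
    have "\<exists>y\<in>S \<inter> B. \<exists>t\<in>?T. x + y = t \<or> x + t = y \<or> y + t = x"
    proof (cases "a = x \<or> b = x")
      case True
      define c where "c = (if a = x then b else a)"
      have c: "c \<in> insert x S" "x + c \<in> insert x S" "a + b = x + c"
        using True ab by (auto simp: c_def add.commute)
      have "c \<noteq> x" using c(2) xx by blast
      hence "c \<in> S" using c(1) by blast
      moreover from this have "c \<noteq> 0" using S0 by blast
      ultimately show ?thesis using shift[of c] c(2) by simp
    next
      case False
      hence abS: "a \<in> S" "b \<in> S" using ab by auto
      hence eq: "a + b = x" using ab(3) sumfreeD[OF sf] by blast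
      have "\<not> (a \<in> B \<and> b \<in> B)" using sumfreeD[OF B(2), of a b] eq xB by auto
      moreover have "\<not> (a \<notin> B \<and> b \<notin> B)" using sumfreeD[OF sfx, of a b] eq abS by auto
      ultimately consider "a \<in> B" "b \<notin> B" | "a \<notin> B" "b \<in> B" by blast
      thus ?thesis
      proof cases
        case 1
        thus ?thesis using abS eq by (intro bexI[of _ a] bexI[of _ b]) auto
      next
        case 2
        thus ?thesis using abS eq by (intro bexI[of _ b] bexI[of _ a]) (auto simp: add.commute)
      qed
    qed
    then obtain y t where "y \<in> S \<inter> B" "t \<in> ?T" "x + y = t \<or> x + t = y \<or> y + t = x" by blast
    moreover from this have "y \<noteq> x" using xB by auto
    ultimately show ?thesis unfolding link_def by (intro bexI[of _ y]) (auto simp: add.commute)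
  qed
  ultimately show ?thesis unfolding mis_def by blast
qed

text \<open>\<open>S\<close> is determined by \<open>S - B\<close>, a subset of \<open>C\<close>,
  and by the maximal independent set \<open>S \<inter> B\<close> of the link graph of
  \<open>S - B\<close>.\<close>

lemma card_msf_le:
  assumes G: "finite G" and B: "B \<subseteq> G" "sumfree B" and C: "C \<subseteq> G"
    and M: "\<And>T. T \<subseteq> C - B \<Longrightarrow> sumfree T \<Longrightarrow> real (card (mis (avail B T) (link T))) \<le> M"
  shows "real (card {S. msf G S \<and> S \<subseteq> B \<union> C}) \<le> 2 ^ card C * M"
proof -
  let ?\<T> = "{T. T \<subseteq> C - B \<and> sumfree T}"
  let ?S = "SIGMA T:?\<T>. mis (avail B T) (link T)"
  have finC: "finite C" and finB: "finite B" using finite_subset[OF C G] finite_subset[OF B(1) G] .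
  have fT: "finite ?\<T>" by (rule finite_subset[of _ "Pow C"]) (use finC in auto)
  have fm: "finite (mis (avail B T) (link T))" for T
    by (rule finite_mis) (simp add: avail_def finB)
  have "card {S. msf G S \<and> S \<subseteq> B \<union> C} \<le> card ?S"
  proof (rule card_inj_on_le[of "\<lambda>S. (S - B, S \<inter> B)"])
    show "inj_on (\<lambda>S. (S - B, S \<inter> B)) {S. msf G S \<and> S \<subseteq> B \<union> C}"
      by (rule inj_on_inverseI[of _ "\<lambda>(T, I). T \<union> I"]) auto
    show "(\<lambda>S. (S - B, S \<inter> B)) ` {S. msf G S \<and> S \<subseteq> B \<union> C} \<subseteq> ?S"
    proof safe
      fix S assume S: "msf G S" "S \<subseteq> B \<union> C"
      show "sumfree (S - B)" using S by (auto simp: msf_def intro: sumfree_subset)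
      show "S \<inter> B \<in> mis (avail B (S - B)) (link (S - B))" by (rule msf_mis[OF S(1) B])
    qed auto
  qed (use fT fm in auto)
  also have "card ?S = (\<Sum>T\<in>?\<T>. card (mis (avail B T) (link T)))" using fT fm by simp
  finally have "real (card {S. msf G S \<and> S \<subseteq> B \<union> C}) \<le> (\<Sum>T\<in>?\<T>. real (card (mis (avail B T) (link T))))"
    by (simp flip: of_nat_sum)
  also have "\<dots> \<le> (\<Sum>T\<in>?\<T>. M)" by (intro sum_mono M) auto
  also have "\<dots> = real (card ?\<T>) * M" by simp
  also have "\<dots> \<le> 2 ^ card C * M"
  proof (rule mult_right_mono)
    have "card ?\<T> \<le> card (Pow C)" using finC by (intro card_mono) auto
    thus "real (card ?\<T>) \<le> 2 ^ card C" using finC by (simp add: card_Pow)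
    show "M \<ge> 0" by (rule order_trans[OF _ M[of "{}"]]) (auto simp: sumfree_def)
  qed
  finally show ?thesis .
qed

section \<open>Triangles in link graphs and the structure of large sum-free sets\<close>

lemma double_zero_iff:
  fixes G :: "'a::ab_group_add set"
  assumes G: "subgrp G" "odd (card G)" and x: "x \<in> G" "x + x = 0"
  shows "x = 0"
proof (rule ccontr)
  assume "x \<noteq> 0"
  have "- x = x" using x(2) by (simp add: minus_unique)
  hence "subgrp {0, x}" using x(2) by (auto simp: subgrp_def)
  moreover have "periodic {0, x} G" using x subgrpD(5)[OF G(1)] by (auto simp: periodic_def)
  ultimately have "card {0, x} dvd card G" using card_dvd_periodic subgrpD(1)[OF G(1)] by blast
  moreover have "card {0, x} = 2" using \<open>x \<noteq> 0\<close> by auto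
  ultimately show False using G(2) by simp
qed

text \<open>For \<open>t = y0 - x0 \<in> T\<close> and \<open>x \<in> x0 + H\<close> the vertex \<open>x + t\<close> is joined to \<open>x\<close> and to \<open>- x\<close>. If all
  three lie in \<open>X\<close>, they form a triangle component, so \<open>x\<close> is joined to \<open>- x\<close>, which forces
  \<open>x + x \<in> T \<union> - T\<close> and is therefore rare.\<close>

lemma card_triangular_link:
  fixes G H B T X :: "'a::ab_group_add set"
  assumes G: "subgrp G" "odd (card G)" and H: "subgrp H" and B: "B \<subseteq> G" "sumfree B" "periodic H B"
    and neg: "\<And>x. x \<in> B \<Longrightarrow> - x \<in> B" and diff: "\<And>g. g \<in> G - B \<Longrightarrow> \<exists>x\<in>B. \<exists>y\<in>B. g = y - x"
    and T: "T \<subseteq> G - B" "sumfree T" and X: "X \<subseteq> B" "triangular (link T) X"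
  shows "3 * card X + card H \<le> 3 * card B + 2 * card T"
proof (cases "T = {}")
  case True
  have "X = {}"
  proof (rule ccontr)
    assume "X \<noteq> {}"
    then obtain x where "x \<in> X" by auto
    then obtain y z where "link T y z" using X(2) unfolding triangular_def by blast
    thus False using True by (simp add: link_def)
  qed
  have finB: "finite B" by (rule finite_subset[OF B(1) subgrpD(1)[OF G(1)]])
  show ?thesis
  proof (cases "B = {}")
    case True
    hence "0 \<in> G - B" using subgrpD(2)[OF G(1)] by simp
    from diff[OF this] True have False by simp
    thus ?thesis ..
  next
    case False
    from card_periodic_ge[OF H B(3) this finB] show ?thesis using \<open>X = {}\<close> by simp
  qed
next
  case False
  then obtain t where t: "t \<in> T" by auto
  obtain x0 y0 where xy: "x0 \<in> B" "y0 \<in> B" "t = y0 - x0" using diff t T(1) by blast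
  have finG: "finite G" and finB: "finite B" using subgrpD(1)[OF G(1)] finite_subset[OF B(1)] by auto
  have finX: "finite X" and finT: "finite T" using finite_subset[OF X(1) finB] finite_subset[OF T(1)] finG by auto
  define P where "P = (\<lambda>h. x0 + h) ` H"
  have cP: "card P = card H" by (simp add: P_def card_translate)
  have finP: "finite P" using subgrpD(1)[OF H] by (simp add: P_def)
  have PB: "x \<in> B" "x + t \<in> B" "- x \<in> B" if x: "x \<in> P" for x
  proof -
    obtain h where h: "h \<in> H" "x = x0 + h" using x by (auto simp: P_def)
    show "x \<in> B" using periodicD[OF B(3) xy(1) h(1)] h(2) by simp
    thus "- x \<in> B" by (rule neg)
    have "x + t = y0 + h" using h xy(3) by simp
    thus "x + t \<in> B" using periodicD[OF B(3) xy(2) h(1)] by simp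
  qed
  define Q where "Q = {x\<in>P. x \<in> X \<and> x + t \<in> X \<and> - x \<in> X}"
  have t0: "t \<noteq> 0" using zero_notin_sumfree[OF T(2)] t by auto
  have "x + x \<in> T \<union> uminus ` T" if x: "x \<in> Q" for x
  proof (rule ccontr)
    assume n: "x + x \<notin> T \<union> uminus ` T"
    have xX: "x \<in> X" "x + t \<in> X" "- x \<in> X" using x by (auto simp: Q_def)
    have x0: "x \<noteq> 0" using xX X B(2) zero_notin_sumfree by blast
    have ne: "x \<noteq> - x"
    proof
      assume "x = - x"
      hence "x + x = 0" by (metis add.right_inverse)
      moreover have "x \<in> G" using xX(1) X(1) B(1) by blast
      ultimately show False using double_zero_iff[OF G] x0 by blast
    qed
    have ne2: "x + t \<noteq> - x"
    proof
      assume "x + t = - x"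
      hence "x + x = - t" by (metis add.commute add_eq_0_iff minus_add_cancel)
      thus False using n t by blast
    qed
    have "x + t \<noteq> x" using t0 by simp
    hence 1: "x \<in> nbhd X (link T) (x + t)" using xX t by (auto simp: nbhd_def link_def)
    have "x + t + - x = t" by simp
    hence 2: "- x \<in> nbhd X (link T) (x + t)" using xX t ne2 by (auto simp: nbhd_def link_def)
    obtain u v where uv: "u \<noteq> v" "link T u v" "nbhd X (link T) (x + t) = {u, v}"
      using X(2) xX(2) unfolding triangular_def by blast
    have "link T x (- x)" using 1 2 uv ne link_sym by auto
    then obtain t' where t': "t' \<in> T" "x + - x = t' \<or> x + t' = - x \<or> - x + t' = x"
      by (auto simp: link_def)
    from t'(2) show False
    proof (elim disjE)
      assume "x + - x = t'"
      thus False using t'(1) zero_notin_sumfree[OF T(2)] by simp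
    next
      assume "x + t' = - x"
      hence "x + x = - t'" by (metis add.commute add_eq_0_iff minus_add_cancel)
      thus False using n t'(1) by blast
    next
      assume a: "- x + t' = x"
      have "x + x = t'" by (subst (2) a[symmetric]) simp
      thus False using n t'(1) by blast
    qed
  qed
  hence img: "(\<lambda>x. x + x) ` Q \<subseteq> T \<union> uminus ` T" by blast
  have "inj_on (\<lambda>x. x + x) Q"
  proof (rule inj_onI)
    fix x y assume xy: "x \<in> Q" "y \<in> Q" "x + x = y + y"
    have "x \<in> G" "y \<in> G" using xy X(1) B(1) by (auto simp: Q_def)
    hence "x - y \<in> G" by (rule subgrpD(3)[OF G(1)])
    moreover have "(x - y) + (x - y) = (x + x) - (y + y)" by (simp add: algebra_simps)
    moreover have "(x + x) - (y + y) = 0" using xy(3) by simp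
    ultimately have "x - y = 0" using double_zero_iff[OF G, of "x - y"] by metis
    thus "x = y" by simp
  qed
  hence "card Q \<le> card (T \<union> uminus ` T)" using img finT by (intro card_inj_on_le) auto
  also have "\<dots> \<le> card T + card (uminus ` T)" by (rule card_Un_le)
  also have "card (uminus ` T) \<le> card T" by (rule card_image_le[OF finT])
  finally have cQ: "card Q \<le> 2 * card T" by simp
  let ?D = "B - X"
  \<comment> \<open>For \<open>x\<close> outside \<open>Q\<close> one of \<open>x\<close>,
    \<open>x + t\<close>, \<open>- x\<close> is missing from \<open>X\<close>. Each of the three
    maps sends such points injectively into \<open>B - X\<close>, hence the factor three.\<close>
  have "P \<subseteq> Q \<union> {x\<in>P. x \<notin> X} \<union> {x\<in>P. x + t \<notin> X} \<union> {x\<in>P. - x \<notin> X}" by (auto simp: Q_def)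
  hence "card P \<le> card (Q \<union> {x\<in>P. x \<notin> X} \<union> {x\<in>P. x + t \<notin> X} \<union> {x\<in>P. - x \<notin> X})"
    using finP by (intro card_mono) (auto simp: Q_def)
  also have "\<dots> \<le> card Q + card {x\<in>P. x \<notin> X} + card {x\<in>P. x + t \<notin> X} + card {x\<in>P. - x \<notin> X}"
    by (intro order_trans[OF card_Un_le] add_mono card_Un_le order_refl)
  also have "\<dots> \<le> 2 * card T + card ?D + card ?D + card ?D"
  proof (intro add_mono cQ)
    show "card {x\<in>P. x \<notin> X} \<le> card ?D" using PB(1) finB by (intro card_mono) auto
    show "card {x\<in>P. x + t \<notin> X} \<le> card ?D"
      by (rule card_inj_on_le[of "\<lambda>x. x + t"]) (use PB(2) finB in \<open>auto simp: inj_on_def\<close>)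
    show "card {x\<in>P. - x \<notin> X} \<le> card ?D"
      by (rule card_inj_on_le[of uminus]) (use PB(3) finB in \<open>auto simp: inj_on_def\<close>)
  qed
  finally have "card H \<le> 2 * card T + 3 * card ?D" using cP by simp
  moreover have "card ?D = card B - card X" by (rule card_Diff_subset[OF finX X(1)])
  moreover have "card X \<le> card B" by (rule card_mono[OF finB X(1)])
  ultimately show ?thesis by linarith
qed

text \<open>Filling \<open>B\<close> up by the stabilizer \<open>H\<close> of \<open>B + B\<close>
  keeps it disjoint from \<open>B + B\<close>, so Kneser gives 3|B'| \<le> |G| + |H|. In units of
  |H| this is 3k \<le> m + 1, and the divisors \<open>m\<close> of 207p leave only (m, k) = (23, 8)
  with density above 10/29.\<close>

lemma sumfree_structure:
  fixes G B :: "'a::ab_group_add set"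
  assumes G: "subgrp G" "card G = 207 * p" and p: "prime p" "p \<ge> 29" and B: "B \<subseteq> G" "sumfree B"
  shows "29 * card B \<le> 10 * card G \<or>
    (\<exists>H B'. subgrp H \<and> 23 * card H = card G \<and> B \<subseteq> B' \<and> B' \<subseteq> G \<and> sumfree B' \<and> periodic H B' \<and>
      card B' = 8 * card H \<and> (\<forall>x\<in>B'. - x \<in> B') \<and> (\<forall>g\<in>G - B'. \<exists>x\<in>B'. \<exists>y\<in>B'. g = y - x))"
proof (cases "B = {}")
  case False
  note finG = subgrpD(1)[OF G(1)]
  have finB: "finite B" by (rule finite_subset[OF B(1) finG])
  have sumG: "X + Y \<subseteq> G" if "X \<subseteq> G" "Y \<subseteq> G" for X Y
    using that subgrpD(5)[OF G(1)] by (auto elim!: set_plus_elim)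
  have BBG: "B + B \<subseteq> G" by (rule sumG[OF B(1) B(1)])
  have BBne: "B + B \<noteq> {}" using False by (auto simp: set_plus_def)
  have finBB: "finite (B + B)" by (rule finite_subset[OF BBG finG])
  define H where "H = stab (B + B)"
  have H: "subgrp H" unfolding H_def by (rule subgrp_stab[OF finBB BBne])
  have perBB: "periodic H (B + B)" unfolding H_def by (rule periodic_stab)
  have HG: "H \<subseteq> G" unfolding H_def by (rule stab_subset[OF G(1) BBG BBne])
  define B' where "B' = B + H"
  have B'G: "B' \<subseteq> G" unfolding B'_def by (rule sumG[OF B(1) HG])
  have finB': "finite B'" by (rule finite_subset[OF B'G finG])
  have BB': "x \<in> B'" if "x \<in> B" for x
    using set_plus_intro[OF that subgrpD(2)[OF H]] by (simp add: B'_def)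
  have perB': "periodic H B'"
    unfolding periodic_def B'_def
  proof (intro ballI)
    fix x h assume "x \<in> B + H" "h \<in> H"
    then obtain b k where bk: "x = b + k" "b \<in> B" "k \<in> H" by (auto elim: set_plus_elim)
    have "b + (k + h) \<in> B + H" using bk subgrpD(5)[OF H] \<open>h \<in> H\<close> by (intro set_plus_intro) auto
    thus "x + h \<in> B + H" using bk(1) by (simp add: add.assoc)
  qed
  have disj: "x \<notin> B + B" if "x \<in> B'" for x
  proof
    assume x: "x \<in> B + B"
    obtain b k where bk: "x = b + k" "b \<in> B" "k \<in> H" using \<open>x \<in> B'\<close> unfolding B'_def by (rule set_plus_elim)
    have "b \<in> B + B" using x bk(1) periodic_iff[OF H perBB bk(3)] by simp
    then obtain u v where "b = u + v" "u \<in> B" "v \<in> B" by (rule set_plus_elim)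
    thus False using sumfreeD[OF B(2)] bk(2) by blast
  qed
  have sumB': "x + y \<in> B + B" if xy: "x \<in> B'" "y \<in> B'" for x y
  proof -
    obtain b k where bk: "x = b + k" "b \<in> B" "k \<in> H" using xy(1) unfolding B'_def by (rule set_plus_elim)
    obtain c l where cl: "y = c + l" "c \<in> B" "l \<in> H" using xy(2) unfolding B'_def by (rule set_plus_elim)
    have "(b + c) + (k + l) \<in> B + B"
      by (rule periodicD[OF perBB set_plus_intro[OF bk(2) cl(2)] subgrpD(5)[OF H bk(3) cl(3)]])
    thus ?thesis using bk(1) cl(1) by (simp add: ac_simps)
  qed
  have sfB': "sumfree B'" using disj sumB' unfolding sumfree_def by blast
  have kn: "card B' + card B' \<le> card (B + B) + card H"
    using kneser[OF finB finB False False] unfolding B'_def H_def .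
  have "card B' + card (B + B) = card (B' \<union> (B + B))"
    using disj finB' finBB by (subst card_Un_disjoint) auto
  also have "\<dots> \<le> card G" using B'G BBG finG by (intro card_mono) auto
  finally have le: "3 * card B' \<le> card G + card H" using kn by linarith
  have h0: "card H > 0" using H by (auto simp: subgrp_def card_gt_0_iff)
  have perHG: "periodic H G" using HG subgrpD(5)[OF G(1)] by (auto simp: periodic_def)
  obtain m where m: "card G = card H * m" using card_dvd_periodic[OF H perHG finG] by (rule dvdE)
  obtain k where k: "card B' = card H * k" using card_dvd_periodic[OF H perB' finB'] by (rule dvdE)
  have "card H * (3 * k) \<le> card H * (m + 1)" using le m k by simp
  hence km: "3 * k \<le> m + 1" using h0 by (simp only: mult_le_cancel1)
  have "card B' > 0" using False BB' finB' by (auto simp: card_gt_0_iff)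
  hence k0: "k > 0" using k by (cases k) auto
  have m0: "m > 0" using km k0 by simp
  have cB: "card B \<le> card B'" using BB' finB' by (intro card_mono) auto
  have small: "29 * card B \<le> 10 * card G" if "29 * k \<le> 10 * m"
  proof -
    have "29 * card B \<le> card H * (29 * k)" using cB k by simp
    also have "\<dots> \<le> card H * (10 * m)" using that by (rule mult_le_mono2)
    finally show ?thesis using m by simp
  qed
  have "9 * (23 * p) = card H * m" using m G(2) by simp
  hence mdvd: "m dvd 9 * (23 * p)" by simp
  \<comment> \<open>The excess 1 in 3k \<le> m + 1 matters only when \<open>m\<close> is small and
    not divisible by 3. A multiple of \<open>p\<close> is at least 29, where (m + 1)/(3m) \<le>
    10/29; for m = 1 no k > 0 is possible.\<close>
  have "29 * k \<le> 10 * m \<or> (m = 23 \<and> k = 8)"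
  proof (cases "3 dvd m")
    case True
    then obtain j where j: "m = 3 * j" by (rule dvdE)
    hence "k \<le> j" using km by presburger
    hence "29 * k \<le> 10 * m" using j by linarith
    thus ?thesis ..
  next
    case n3: False
    have "prime (3::nat)" by simp
    hence "coprime 3 m" using n3 by (rule prime_imp_coprime)
    hence "coprime (3 * 3) m" unfolding coprime_mult_left_iff by simp
    hence "coprime m 9" by (simp add: coprime_commute)
    hence m23: "m dvd 23 * p" using coprime_dvd_mult_right_iff[of m 9 "23 * p"] mdvd by blast
    show ?thesis
    proof (cases "p dvd m")
      case True
      hence "29 \<le> m" using p(2) dvd_imp_le[OF True m0] by linarith
      hence "29 * k \<le> 10 * m" using km by linarith
      thus ?thesis ..
    next
      case np: False
      have "coprime p m" using p(1) np by (rule prime_imp_coprime)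
      hence "m dvd 23" using coprime_dvd_mult_left_iff[of m p 23] m23 by (simp add: coprime_commute)
      moreover have "prime (23::nat)" by simp
      ultimately have "m = 1 \<or> m = 23" by (simp add: prime_nat_iff)
      thus ?thesis using km k0 by presburger
    qed
  qed
  thus ?thesis
  proof
    assume mk: "m = 23 \<and> k = 8"
    hence cG: "card G = 23 * card H" and cB': "card B' = 8 * card H" using m k by simp_all
    \<comment> \<open>A second use of Kneser, now for \<open>B' - B'\<close>. Its stabilizer
      contains \<open>H\<close> with ratio dividing 23; ratio 23 would make the difference set all
      of \<open>G\<close>, although it misses \<open>B'\<close>. So it has at least 8 + 8 - 1 = 15
      cosets, exactly those outside \<open>B'\<close>.\<close>
    define N where "N = uminus ` B'"
    define D where "D = B' + N"
    define K where "K = stab D"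
    have B'ne: "B' \<noteq> {}" using False BB' by blast
    have NG: "N \<subseteq> G" unfolding N_def using B'G subgrpD(4)[OF G(1)] by auto
    have finN: "finite N" unfolding N_def using finB' by simp
    have Nne: "N \<noteq> {}" unfolding N_def using B'ne by simp
    have cN: "card N = card B'" unfolding N_def by (simp add: card_image)
    have DG: "D \<subseteq> G" unfolding D_def by (rule sumG[OF B'G NG])
    have finD: "finite D" by (rule finite_subset[OF DG finG])
    have Dne: "D \<noteq> {}" using B'ne Nne by (auto simp: D_def set_plus_def)
    have D_iff: "g \<in> D \<longleftrightarrow> (\<exists>x\<in>B'. \<exists>y\<in>B'. g = y - x)" for g
    proof
      assume "g \<in> D"
      then obtain u v where "g = u + v" "u \<in> B'" "v \<in> N" unfolding D_def by (rule set_plus_elim)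
      thus "\<exists>x\<in>B'. \<exists>y\<in>B'. g = y - x" unfolding N_def by force
    next
      assume "\<exists>x\<in>B'. \<exists>y\<in>B'. g = y - x"
      then obtain x y where xy: "x \<in> B'" "y \<in> B'" "g = y - x" by blast
      hence "y + - x \<in> D" unfolding D_def N_def by (intro set_plus_intro) auto
      thus "g \<in> D" using xy(3) by simp
    qed
    have Ddisj: "b \<notin> D" if "b \<in> B'" for b
    proof
      assume "b \<in> D"
      then obtain x y where xy: "x \<in> B'" "y \<in> B'" "b = y - x" using D_iff by blast
      hence "b + x = y" by simp
      thus False using sumfreeD[OF sfB' that xy(1)] xy(2) by simp
    qed
    have K: "subgrp K" unfolding K_def by (rule subgrp_stab[OF finD Dne])
    have KG: "K \<subseteq> G" unfolding K_def by (rule stab_subset[OF G(1) DG Dne])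
    have perD: "periodic H D" unfolding periodic_def
    proof (intro ballI)
      fix g h assume "g \<in> D" "h \<in> H"
      then obtain x y where xy: "x \<in> B'" "y \<in> B'" "g = y - x" using D_iff by blast
      have "y + h \<in> B'" using periodicD[OF perB' xy(2) \<open>h \<in> H\<close>] .
      moreover have "g + h = (y + h) - x" using xy(3) by simp
      ultimately show "g + h \<in> D" using xy(1) D_iff by blast
    qed
    have HK: "H \<subseteq> K" unfolding K_def by (rule subset_stab[OF H perD])
    have "periodic H K" using HK subgrpD(5)[OF K] by (auto simp: periodic_def)
    from card_dvd_periodic[OF H this subgrpD(1)[OF K]] obtain j where j: "card K = card H * j" by (rule dvdE)
    have "periodic K G" using KG subgrpD(5)[OF G(1)] by (auto simp: periodic_def)
    from card_dvd_periodic[OF K this finG] have "card H * j dvd card H * 23" using j cG by (simp add: mult.commute)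
    hence "j dvd 23" using h0 by simp
    moreover have "prime (23::nat)" by simp
    ultimately have "j = 1 \<or> j = 23" by (simp add: prime_nat_iff)
    moreover have "j \<noteq> 23"
    proof
      assume "j = 23"
      hence "K = G" using j cG KG finG by (intro card_subset_eq) auto
      obtain b where b: "b \<in> B'" using B'ne by blast
      hence "0 \<in> D" using D_iff by force
      moreover have "b \<in> K" using b B'G \<open>K = G\<close> by blast
      ultimately have "0 + b \<in> D" using periodicD[OF periodic_stab[of D]] unfolding K_def by blast
      thus False using Ddisj b by simp
    qed
    ultimately have cK: "card K = card H" using j by simp
    have ge: "card X \<le> card (X + K)" if "finite X" for X
    proof (rule card_mono)
      show "finite (X + K)" using that subgrpD(1)[OF K] by (rule finite_set_plus)
      show "X \<subseteq> X + K" using set_plus_intro[OF _ subgrpD(2)[OF K]] by fastforce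
    qed
    have "card (B' + K) + card (N + K) \<le> card D + card K"
      using kneser[OF finB' finN B'ne Nne] unfolding D_def K_def .
    hence "15 * card H \<le> card D" using ge[OF finB'] ge[OF finN] cN cB' cK by linarith
    moreover have "card (G - B') = 15 * card H"
      using card_Diff_subset[OF finB' B'G] cG cB' by simp
    moreover have "D \<subseteq> G - B'" using DG Ddisj by blast
    ultimately have DGB: "D = G - B'" using finG by (intro card_seteq) auto
    \<comment> \<open>A difference set is symmetric, hence so is its complement
      \<open>B'\<close>.\<close>
    have neg: "- x \<in> B'" if x: "x \<in> B'" for x
    proof (rule ccontr)
      assume "- x \<notin> B'"
      moreover have "- x \<in> G" using x B'G subgrpD(4)[OF G(1)] by blast
      ultimately have "- x \<in> D" using DGB by blast
      then obtain u v where uv: "u \<in> B'" "v \<in> B'" "- x = v - u" using D_iff by blast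
      have "x = - (v - u)" using uv(3) by (metis minus_minus)
      hence "x = u - v" by simp
      hence "x \<in> D" using uv D_iff by blast
      thus False using Ddisj x by blast
    qed
    show ?thesis
    proof (intro disjI2 exI conjI)
      show "subgrp H" by (rule H)
      show "23 * card H = card G" using cG by simp
      show "B \<subseteq> B'" using BB' by blast
      show "\<forall>g\<in>G - B'. \<exists>x\<in>B'. \<exists>y\<in>B'. g = y - x" using D_iff DGB by blast
    qed (use B'G sfB' perB' cB' neg in auto)
  qed (use small in blast)
qed simp

section \<open>The upper bound\<close>

lemma ln_kappa: "ln kappa = (2 * ln 3 - 3 * ln 2) / 6"
proof -
  have "ln kappa = ln (9 / 8) / 6" unfolding kappa_def by (subst ln_root) auto
  also have "ln (9 / 8 :: real) = ln (3 ^ 2) - ln (2 ^ 3)" by (subst ln_div) auto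
  also have "ln ((3::real) ^ 2) = 2 * ln 3" by (rule trans[OF ln_realpow]) simp_all
  also have "ln ((2::real) ^ 3) = 3 * ln 2" by (rule trans[OF ln_realpow]) simp_all
  finally show ?thesis .
qed

lemma sqrt2_kappa_exp: "sqrt 2 ^ a * kappa ^ b = exp (real a * (ln 2 / 2) + real b * ln kappa)"
proof -
  have "sqrt 2 ^ a = exp (real a * (ln 2 / 2))"
    unfolding exp_of_nat_mult by (simp add: ln_sqrt[symmetric])
  moreover have "kappa ^ b = exp (real b * ln kappa)"
    unfolding exp_of_nat_mult using kappa_ge1 by simp
  ultimately show ?thesis by (simp add: exp_add)
qed

text \<open>Over the denominator 24840 the gap (ln 3)/216 - (ln 2)/138 has numerator 115 ln 3 - 180
  ln 2. Proving 182 in place of 180 leaves 2 ln 2 \<ge> 1 for it, more than the required 3 * 24840 /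
  100000.\<close>

lemma ln3_ln2: "182 * ln 2 \<le> 115 * ln (3::real)"
proof -
  have "(2::nat) ^ 182 \<le> 3 ^ 115" by simp
  hence "(2::real) ^ 182 \<le> 3 ^ 115" by (simp only: of_nat_le_iff[symmetric, where 'a=real] of_nat_power of_nat_numeral)
  hence "ln ((2::real) ^ 182) \<le> ln (3 ^ 115)" by (subst ln_le_cancel_iff) simp_all
  moreover have "ln ((2::real) ^ 182) = 182 * ln 2" by (rule trans[OF ln_realpow]) simp_all
  moreover have "ln ((3::real) ^ 115) = 115 * ln 3" by (rule trans[OF ln_realpow]) simp_all
  ultimately show ?thesis by (simp only:)
qed

lemma ln2_bounds: "1 / 2 \<le> ln (2::real)" "ln (2::real) \<le> 1"
proof -
  have "ln (1 / 2 :: real) \<le> 1 / 2 - 1" by (rule ln_le_minus_one) simp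
  moreover have "ln (1 / 2 :: real) = - ln 2" by (simp add: ln_div)
  ultimately show "1 / 2 \<le> ln (2::real)" by simp
  show "ln (2::real) \<le> 1" using ln_le_minus_one[of "2::real"] by simp
qed

lemma card_mis_avail_le:
  assumes "finite B" and "\<And>X. X \<subseteq> avail B T \<Longrightarrow> triangular (link T) X \<Longrightarrow> card X \<le> c"
  shows "real (card (mis (avail B T) (link T))) \<le> exp (real (card B) * (ln 2 / 2) + real c * ln kappa)"
proof -
  have sub: "avail B T \<subseteq> B" by (auto simp: avail_def)
  have "real (card (mis (avail B T) (link T))) \<le> sqrt 2 ^ card (avail B T) * kappa ^ c"
  proof (rule card_mis_le)
    show "link T y x" if "link T x y" for x y by (rule link_sym[OF that])
    show "\<not> link T x x" for x by (simp add: link_def)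
    show "card X \<le> c" if "X \<subseteq> avail B T" "triangular (link T) X" for X by (rule assms(2)[OF that])
  qed (rule finite_subset[OF sub assms(1)])
  also have "\<dots> \<le> sqrt 2 ^ card B * kappa ^ c"
    using card_mono[OF assms(1) sub] kappa_ge1 by (intro mult_right_mono power_increasing) auto
  finally show ?thesis unfolding sqrt2_kappa_exp .
qed

text \<open>Three times $10^{-5}$ has to fit below both $(25/216 - 10/87) \cdot \ln 3$ and
  $25/216 \cdot \ln 3 - (4/23 \cdot \ln 2 + \ln \mathit{kappa}/3) = (\ln 3)/216 - (\ln 2)/138$;
  the latter is positive by \<open>ln3_ln2\<close>, with very little room.\<close>

lemma card_msf_container_le:
  fixes G A C :: "'a::ab_group_add set" and \<eta> :: real
  assumes G: "subgrp G" "card G = 207 * p" and p: "prime p" "p \<ge> 29"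
    and C: "C \<subseteq> A" "A \<subseteq> G" "sumfree (A - C)" and cC: "real (card C) \<le> real (card G) / 100000"
  shows "real (card {S. msf G S \<and> S \<subseteq> A}) \<le> exp (real (card G) * (25 / 216 * ln 3 - 1 / 100000))"
proof -
  let ?n = "real (card G)"
  note finG = subgrpD(1)[OF G(1)]
  define B where "B = A - C"
  have BG: "B \<subseteq> G" and CG: "C \<subseteq> G" using C by (auto simp: B_def)
  have finB: "finite B" by (rule finite_subset[OF BG finG])
  have sfB: "sumfree B" using C(3) by (simp add: B_def)
  have n0: "?n \<ge> 0" by simp
  have two: "(2::real) ^ card C = exp (real (card C) * ln 2)" by (simp add: exp_of_nat_mult)
  have odd: "odd (card G)" using G(2) prime_odd_nat[OF p(1)] p(2) by simp
  have reduce: "real (card {S. msf G S \<and> S \<subseteq> A}) \<le> 2 ^ card C * M"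
    if "B \<subseteq> D" "D \<subseteq> G" "sumfree D"
      "\<And>T. T \<subseteq> C - D \<Longrightarrow> sumfree T \<Longrightarrow> real (card (mis (avail D T) (link T))) \<le> M" for D M
  proof -
    have "finite {S. msf G S \<and> S \<subseteq> D \<union> C}" by (rule finite_subset[of _ "Pow G"]) (auto simp: msf_def finG)
    moreover have "{S. msf G S \<and> S \<subseteq> A} \<subseteq> {S. msf G S \<and> S \<subseteq> D \<union> C}" using that(1) by (auto simp: B_def)
    ultimately have "card {S. msf G S \<and> S \<subseteq> A} \<le> card {S. msf G S \<and> S \<subseteq> D \<union> C}" by (rule card_mono)
    also have "real (card {S. msf G S \<and> S \<subseteq> D \<union> C}) \<le> 2 ^ card C * M"
      by (rule card_msf_le[OF finG that(2,3) CG that(4)])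
    finally show ?thesis by simp
  qed
  from sumfree_structure[OF G p BG sfB] show ?thesis
  proof (elim disjE exE conjE)
    assume small: "29 * card B \<le> 10 * card G"
    have "real (card {S. msf G S \<and> S \<subseteq> A}) \<le> 2 ^ card C * exp (real (card B) * (ln 2 / 2) + real (card B) * ln kappa)"
    proof (rule reduce[OF order_refl BG sfB])
      fix T assume "T \<subseteq> C - B" "sumfree T"
      show "real (card (mis (avail B T) (link T))) \<le> exp (real (card B) * (ln 2 / 2) + real (card B) * ln kappa)"
        by (rule card_mis_avail_le[OF finB]) (auto simp: avail_def intro!: card_mono[OF finB])
    qed
    also have "\<dots> = exp (real (card C) * ln 2 + real (card B) * (ln 3 / 3))"
      unfolding two exp_add[symmetric] ln_kappa by (simp add: field_simps)
    also have "\<dots> \<le> exp (?n * (25 / 216 * ln 3 - 1 / 100000))"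
    proof -
      have b: "real (card B) \<le> 10 / 29 * ?n" using small by linarith
      have "real (card C) * ln 2 \<le> ?n / 100000 * 1" using cC ln2_bounds by (intro mult_mono) auto
      moreover have "real (card B) * (ln 3 / 3) \<le> 10 / 29 * ?n * (ln 3 / 3)" using b by (intro mult_right_mono) auto
      moreover have "10 / 29 * ?n * (ln 3 / 3) = ?n * (10 / 87 * ln 3)" by simp
      moreover have "?n * (10 / 87 * ln 3 + 2 / 100000) \<le> ?n * (25 / 216 * ln 3)"
        using ln3_ln2 ln2_bounds by (intro mult_left_mono n0) linarith
      ultimately have "real (card C) * ln 2 + real (card B) * (ln 3 / 3) \<le> ?n * (25 / 216 * ln 3 - 1 / 100000)"
        unfolding right_diff_distrib distrib_left by linarith
      thus ?thesis by simp
    qed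
    finally show ?thesis .
  next
    fix H D :: "'a set"
    assume H: "subgrp H" "23 * card H = card G" and D: "B \<subseteq> D" "D \<subseteq> G" "sumfree D" "periodic H D"
      and cD: "card D = 8 * card H" and neg: "\<forall>x\<in>D. - x \<in> D" and diff: "\<forall>g\<in>G - D. \<exists>x\<in>D. \<exists>y\<in>D. g = y - x"
    have finD: "finite D" by (rule finite_subset[OF D(2) finG])
    \<comment> \<open>From 3|X| + |H| \<le> 3 * 8|H| + 2|T| and |T| \<le> |C|. As 23|H| = n, this is
      about n/3.\<close>
    define c where "c = (23 * card H + 2 * card C) div 3"
    have "real (card {S. msf G S \<and> S \<subseteq> A}) \<le> 2 ^ card C * exp (real (card D) * (ln 2 / 2) + real c * ln kappa)"
    proof (rule reduce[OF D(1-3)])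
      fix T assume T: "T \<subseteq> C - D" "sumfree T"
      have cT: "card T \<le> card C" using T(1) finite_subset[OF CG finG] by (intro card_mono) auto
      have TG: "T \<subseteq> G - D" using T(1) CG by auto
      show "real (card (mis (avail D T) (link T))) \<le> exp (real (card D) * (ln 2 / 2) + real c * ln kappa)"
      proof (rule card_mis_avail_le[OF finD])
        fix X assume X: "X \<subseteq> avail D T" "triangular (link T) X"
        have "X \<subseteq> D" using X(1) by (auto simp: avail_def)
        hence "3 * card X + card H \<le> 3 * card D + 2 * card T"
          using neg diff by (intro card_triangular_link[OF G(1) odd H(1) D(2-4) _ _ TG T(2) _ X(2)]) blast+
        thus "card X \<le> c" unfolding c_def using cT cD by linarith
      qed
    qed
    also have "\<dots> \<le> exp (?n * (25 / 216 * ln 3 - 1 / 100000))"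
    proof -
      have h: "real (card H) = ?n / 23" using H(2) by linarith
      have lk: "0 \<le> ln kappa" "ln kappa \<le> 1"
      proof -
        show "0 \<le> ln kappa" using kappa_ge1 by simp
        have "ln (9 / 8 :: real) \<le> 9 / 8 - 1" by (rule ln_le_minus_one) simp
        moreover have "ln kappa = ln (9 / 8) / 6" unfolding kappa_def by (subst ln_root) auto
        ultimately show "ln kappa \<le> 1" by simp
      qed
      have "3 * c \<le> 23 * card H + 2 * card C" unfolding c_def by simp
      hence "3 * real c \<le> 23 * real (card H) + 2 * real (card C)" by linarith
      hence "3 * real c \<le> ?n + 2 * (?n / 100000)" using cC unfolding h by simp
      hence "real c \<le> ?n / 3 + ?n / 100000" using n0 by linarith
      hence "real c \<le> ?n * (1 / 3 + 1 / 100000)" by simp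
      hence "real c * ln kappa \<le> ?n * (1 / 3 + 1 / 100000) * ln kappa" using lk by (intro mult_right_mono) auto
      also have "\<dots> = ?n * (1 / 3 * ln kappa + 1 / 100000 * ln kappa)" by (simp add: algebra_simps)
      also have "\<dots> \<le> ?n * (1 / 3 * ln kappa + 1 / 100000)" using lk by (intro mult_left_mono n0) auto
      finally have 1: "real c * ln kappa \<le> ?n * (1 / 3 * ln kappa + 1 / 100000)" .
      have 2: "real (card D) * (ln 2 / 2) = ?n * (4 / 23 * ln 2)" using cD h by simp
      have "real (card C) * ln 2 \<le> ?n / 100000 * 1" using cC ln2_bounds by (intro mult_mono) auto
      hence 3: "real (card C) * ln 2 \<le> ?n * (1 / 100000)" by simp
      have "1 / 100000 + (4 / 23 * ln 2 + (1 / 3 * ln kappa + 1 / 100000)) \<le> 25 / 216 * ln 3 - 1 / 100000"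
      proof -
        have "25 / 216 * ln 3 - 1 / 100000 - (1 / 100000 + (4 / 23 * ln 2 + (1 / 3 * ln kappa + 1 / 100000)))
            = (115 * ln 3 - 180 * ln 2) / 24840 - 3 / 100000"
          unfolding ln_kappa by (simp add: field_simps)
        moreover have "115 * ln 3 - 180 * ln 2 \<ge> (1::real)" using ln3_ln2 ln2_bounds by linarith
        ultimately show ?thesis by simp
      qed
      hence "?n * (1 / 100000 + (4 / 23 * ln 2 + (1 / 3 * ln kappa + 1 / 100000))) \<le> ?n * (25 / 216 * ln 3 - 1 / 100000)"
        by (rule mult_left_mono[OF _ n0])
      hence "real (card C) * ln 2 + (real (card D) * (ln 2 / 2) + real c * ln kappa) \<le> ?n * (25 / 216 * ln 3 - 1 / 100000)"
        using 1 2 3 by (simp only: distrib_left)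
      thus ?thesis unfolding two exp_add[symmetric] by simp
    qed
    finally show ?thesis .
  qed
qed

text \<open>The exp(n/100000) containers use up exactly the slack 1/100000 left in the bound for a
  single container, so from some \<open>N\<close> on no error term remains.\<close>

theorem card_msf_upper:
  "\<exists>N. \<forall>(G :: 'a::ab_group_add set) p. subgrp G \<longrightarrow> card G = 207 * p \<longrightarrow> prime p \<longrightarrow> 29 \<le> p \<longrightarrow> N \<le> p \<longrightarrow>
     real (card {S. msf G S}) \<le> 3 powr (25 * real (card G) / 216)"
proof -
  let ?\<eta> = "1 / 100000 :: real"
  have eta: "?\<eta> > 0" by simp
  obtain \<epsilon> where eps: "\<epsilon> > 0" and "\<forall>(G :: 'a set) A. subgrp G \<longrightarrow> A \<subseteq> G \<longrightarrow>
    real (card (schur A)) \<le> \<epsilon> * real (card G) ^ 2 \<longrightarrow>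
    (\<exists>C\<subseteq>A. real (card C) \<le> ?\<eta> * real (card G) \<and> sumfree (A - C))"
    using removal[OF eta] by (elim exE conjE) (rule that)
  note rem = this(2)[rule_format]
  obtain N where "\<forall>G :: 'a::ab_group_add set. finite G \<longrightarrow> N \<le> card G \<longrightarrow>
    (\<exists>\<F>. finite \<F> \<and> real (card \<F>) \<le> exp (?\<eta> * real (card G)) \<and>
      (\<forall>C\<in>\<F>. C \<subseteq> G \<and> real (card (schur C)) \<le> \<epsilon> * real (card G) ^ 2) \<and>
      (\<forall>S\<subseteq>G. sumfree S \<longrightarrow> (\<exists>C\<in>\<F>. S \<subseteq> C)))"
    using containers[OF eps eta] by (elim exE) (rule that)
  note con = this[rule_format]
  have "real (card {S. msf G S}) \<le> 3 powr (25 * real (card G) / 216)"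
    if G: "subgrp G" "card G = 207 * p" and p: "prime p" "29 \<le> p" "N \<le> p" for G :: "'a set" and p
  proof -
    let ?n = "real (card G)"
    note finG = subgrpD(1)[OF G(1)]
    have "N \<le> card G" using G(2) p(3) by simp
    from con[OF finG this] obtain \<F> where F: "finite \<F>" "real (card \<F>) \<le> exp (?\<eta> * ?n)"
      "\<forall>C\<in>\<F>. C \<subseteq> G \<and> real (card (schur C)) \<le> \<epsilon> * ?n ^ 2"
      "\<forall>S\<subseteq>G. sumfree S \<longrightarrow> (\<exists>C\<in>\<F>. S \<subseteq> C)" by (elim exE conjE) (rule that)
    have fin: "finite {S. msf G S \<and> S \<subseteq> A}" for A by (rule finite_subset[of _ "Pow G"]) (auto simp: msf_def finG)
    have "{S. msf G S} \<subseteq> (\<Union>A\<in>\<F>. {S. msf G S \<and> S \<subseteq> A})"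
    proof
      fix S assume S: "S \<in> {S. msf G S}"
      hence "S \<subseteq> G" "sumfree S" by (auto simp: msf_def)
      then obtain A where "A \<in> \<F>" "S \<subseteq> A" using F(4) by blast
      thus "S \<in> (\<Union>A\<in>\<F>. {S. msf G S \<and> S \<subseteq> A})" using S by auto
    qed
    hence "card {S. msf G S} \<le> card (\<Union>A\<in>\<F>. {S. msf G S \<and> S \<subseteq> A})" using fin F(1) by (intro card_mono) auto
    also have "\<dots> \<le> (\<Sum>A\<in>\<F>. card {S. msf G S \<and> S \<subseteq> A})" by (rule card_UN_le[OF F(1)])
    finally have "real (card {S. msf G S}) \<le> (\<Sum>A\<in>\<F>. real (card {S. msf G S \<and> S \<subseteq> A}))"
      unfolding of_nat_sum[symmetric] by (rule of_nat_mono)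
    also have "\<dots> \<le> (\<Sum>A\<in>\<F>. exp (?n * (25 / 216 * ln 3 - ?\<eta>)))"
    proof (rule sum_mono)
      fix A assume "A \<in> \<F>"
      hence A: "A \<subseteq> G" "real (card (schur A)) \<le> \<epsilon> * ?n ^ 2" using F(3) by auto
      from rem[OF G(1) A] obtain C where C: "C \<subseteq> A" "real (card C) \<le> ?\<eta> * ?n" "sumfree (A - C)" by blast
      show "real (card {S. msf G S \<and> S \<subseteq> A}) \<le> exp (?n * (25 / 216 * ln 3 - ?\<eta>))"
        by (rule card_msf_container_le[OF G p(1,2) C(1) A(1) C(3)]) (use C(2) in simp)
    qed
    also have "\<dots> = real (card \<F>) * exp (?n * (25 / 216 * ln 3 - ?\<eta>))" by simp
    also have "\<dots> \<le> exp (?\<eta> * ?n) * exp (?n * (25 / 216 * ln 3 - ?\<eta>))"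
      by (intro mult_right_mono F(2)) simp
    also have "\<dots> = exp (25 * ?n / 216 * ln 3)"
      unfolding exp_add[symmetric] by (simp add: algebra_simps)
    also have "\<dots> = 3 powr (25 * ?n / 216)" by (simp add: powr_def)
    finally show ?thesis .
  qed
  thus ?thesis by (intro exI[of _ N] allI impI)
qed

text \<open>In the first alternative 2070p/29 < 72p, in the second 8n/23 = 72p: here the exceptional
  structure is the extremal one.\<close>

lemma card_sumfree_le:
  fixes G B :: "'a::ab_group_add set"
  assumes G: "subgrp G" "card G = 207 * p" and p: "prime p" "p \<ge> 29" and B: "B \<subseteq> G" "sumfree B"
  shows "card B \<le> 72 * p"
  using sumfree_structure[OF assms]
proof (elim disjE exE conjE)
  assume "29 * card B \<le> 10 * card G"
  thus ?thesis using G(2) by linarith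
next
  fix H D :: "'a set" assume D: "23 * card H = card G" "B \<subseteq> D" "D \<subseteq> G" "card D = 8 * card H"
  have "card B \<le> card D" by (rule card_mono[OF finite_subset[OF D(3) subgrpD(1)[OF G(1)]] D(2)])
  thus ?thesis using D G(2) by linarith
qed

section \<open>The groups of the theorem\<close>

definition qz_rel :: "rat \<Rightarrow> rat \<Rightarrow> bool" where
  "qz_rel x y \<longleftrightarrow> x - y \<in> \<int>"

text \<open>All the groups \<open>grp p\<close> embed into a power of $\mathbb{Q}/\mathbb{Z}$, so that the results for
  finite subgroups of a type of class \<open>ab_group_add\<close> apply to them.\<close>

quotient_type qz = rat / qz_rel
proof (rule equivpI)
  show "reflp qz_rel" by (rule reflpI) (simp add: qz_rel_def)
  show "symp qz_rel"
  proof (rule sympI)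
    fix x y assume "qz_rel x y"
    hence "- (x - y) \<in> \<int>" unfolding qz_rel_def by (rule Ints_minus)
    thus "qz_rel y x" by (simp add: qz_rel_def)
  qed
  show "transp qz_rel"
  proof (rule transpI)
    fix x y z assume "qz_rel x y" "qz_rel y z"
    hence "(x - y) + (y - z) \<in> \<int>" unfolding qz_rel_def by (rule Ints_add)
    thus "qz_rel x z" by (simp add: qz_rel_def)
  qed
qed

lemma qz_rel_add: "qz_rel x x' \<Longrightarrow> qz_rel y y' \<Longrightarrow> qz_rel (x + y) (x' + y')"
  using Ints_add[of "x - x'" "y - y'"] by (simp add: qz_rel_def algebra_simps)

lemma qz_rel_minus: "qz_rel x x' \<Longrightarrow> qz_rel (- x) (- x')"
  using Ints_minus[of "x - x'"] by (simp add: qz_rel_def algebra_simps)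

instantiation qz :: ab_group_add
begin

lift_definition zero_qz :: qz is 0 .
lift_definition plus_qz :: "qz \<Rightarrow> qz \<Rightarrow> qz" is "(+)" by (rule qz_rel_add)
lift_definition uminus_qz :: "qz \<Rightarrow> qz" is uminus by (rule qz_rel_minus)
definition minus_qz :: "qz \<Rightarrow> qz \<Rightarrow> qz" where "minus_qz x y = x + - y"

instance
proof
  fix a b c :: qz
  show "a + b + c = a + (b + c)" by transfer (simp add: qz_rel_def add.assoc)
  show "a + b = b + a" by transfer (simp add: qz_rel_def add.commute)
  show "0 + a = a" by transfer (simp add: qz_rel_def)
  show "- a + a = 0" by transfer (simp add: qz_rel_def)
  show "a - b = a + - b" by (rule minus_qz_def)
qed

end

definition residue_qz :: "nat \<Rightarrow> int \<Rightarrow> qz" where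
  "residue_qz m a = abs_qz (of_int a / of_nat m)"

lemma residue_qz_add:
  assumes "m > 0"
  shows "residue_qz m ((a + b) mod int m) = residue_qz m a + residue_qz m b"
proof -
  have "of_int ((a + b) mod int m) = (of_int (a + b) - of_nat m * of_int ((a + b) div int m) :: rat)"
    by (metis minus_mult_div_eq_mod of_int_diff of_int_mult of_int_of_nat_eq)
  hence "of_int ((a + b) mod int m) / of_nat m - (of_int a / of_nat m + of_int b / of_nat m)
      = (- of_int ((a + b) div int m) :: rat)"
    using assms by (simp add: field_simps)
  hence "qz_rel (of_int ((a + b) mod int m) / of_nat m) (of_int a / of_nat m + of_int b / of_nat m)"
    by (simp add: qz_rel_def)
  thus ?thesis by (simp add: residue_qz_def plus_qz.abs_eq qz.abs_eq_iff)
qed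

lemma residue_qz_inj:
  assumes "a \<in> {0..<int m}" "b \<in> {0..<int m}" "residue_qz m a = residue_qz m b"
  shows "a = b"
proof -
  have m0: "m > 0" using assms(1) by (cases m) auto
  have "of_int a / of_nat m - of_int b / of_nat m \<in> (\<int> :: rat set)"
    using assms(3) by (simp add: residue_qz_def qz.abs_eq_iff qz_rel_def)
  then obtain k where "of_int a / of_nat m - of_int b / of_nat m = (of_int k :: rat)" by (auto elim: Ints_cases)
  hence "(of_int (a - b) :: rat) = of_int (k * int m)" using m0 by (simp add: field_simps)
  hence eq: "a - b = k * int m" by (simp only: of_int_eq_iff)
  have "\<bar>k * int m\<bar> < int m" using assms(1,2) eq[symmetric] by auto
  hence "\<bar>k\<bar> < 1" using m0 by (simp add: abs_mult)
  thus ?thesis using eq by simp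
qed

text \<open>The target type is independent of \<open>p\<close>, so a single threshold
  \<open>N\<close> of \<open>card_msf_upper\<close> serves all primes.\<close>

fun emb :: "nat \<Rightarrow> (int \<times> int) \<times> int \<times> int \<Rightarrow> (qz \<times> qz) \<times> qz \<times> qz" where
  "emb p ((a, b), (c, d)) = ((residue_qz 3 a, residue_qz 3 b), (residue_qz 23 c, residue_qz p d))"

section \<open>Transfer between the concrete groups and subgroups of the common type\<close>

lemma sum_freeI:
  assumes "S \<subseteq> carrier G" "\<And>x y. x \<in> S \<Longrightarrow> y \<in> S \<Longrightarrow> x \<otimes>\<^bsub>G\<^esub> y \<notin> S"
  shows "sum_free G S"
  using assms unfolding sum_free_def by blast

lemma sum_freeD: "sum_free G S \<Longrightarrow> x \<in> S \<Longrightarrow> y \<in> S \<Longrightarrow> x \<otimes>\<^bsub>G\<^esub> y \<notin> S"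
  unfolding sum_free_def by blast

lemma carrier_grp:
  assumes "p > 0"
  shows "carrier (grp p) = ({0..<3} \<times> {0..<3}) \<times> {0..<23} \<times> {0..<int p}"
  using assms by (simp add: grp_def carrier_integer_mod_group)

lemma mult_grp:
  "((a, b), (c, d)) \<otimes>\<^bsub>grp p\<^esub> ((a', b'), (c', d'))
    = (((a + a') mod 3, (b + b') mod 3), ((c + c') mod 23, (d + d') mod int p))"
  by (simp add: grp_def)

lemma group_grp: "group (grp p)"
  by (simp add: grp_def DirProd_group)

lemma order_grp: "p > 0 \<Longrightarrow> order (grp p) = 207 * p"
  by (simp add: order_def carrier_grp card_cartesian_product)

lemma emb_mult:
  assumes "p > 0" shows "emb p (x \<otimes>\<^bsub>grp p\<^esub> y) = emb p x + emb p y"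
proof -
  obtain a b c d where x: "x = ((a, b), (c, d))" by (metis surj_pair)
  obtain a' b' c' d' where y: "y = ((a', b'), (c', d'))" by (metis surj_pair)
  show ?thesis
    using residue_qz_add[of 3 a a'] residue_qz_add[of 3 b b'] residue_qz_add[of 23 c c']
      residue_qz_add[OF assms, of d d']
    unfolding x y mult_grp by simp
qed

lemma inj_on_emb:
  assumes "p > 0" shows "inj_on (emb p) (carrier (grp p))"
  unfolding inj_on_def carrier_grp[OF assms]
  using residue_qz_inj[of _ 3] residue_qz_inj[of _ 23] residue_qz_inj[of _ p] by auto

lemma subgrp_image:
  fixes G (structure) and e :: "'a \<Rightarrow> 'b::ab_group_add"
  assumes "group G" and fin: "finite (carrier G)"
    and hom: "\<forall>x\<in>carrier G. \<forall>y\<in>carrier G. e (x \<otimes> y) = e x + e y"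
  shows "subgrp (e ` carrier G)"
proof -
  interpret group G by fact
  have "e \<one> = e \<one> + e \<one>" using hom one_closed by (metis r_one)
  hence one: "e \<one> = 0" by simp
  have "e x - e y = e (x \<otimes> inv y)" if "x \<in> carrier G" "y \<in> carrier G" for x y
  proof -
    have "e (inv y) + e y = 0" using hom that one by (metis inv_closed l_inv)
    hence "e (inv y) = - e y" by (simp add: eq_neg_iff_add_eq_0)
    thus ?thesis using hom that by simp
  qed
  hence "u - v \<in> e ` carrier G" if "u \<in> e ` carrier G" "v \<in> e ` carrier G" for u v
    using that by auto
  moreover have "0 \<in> e ` carrier G" using one one_closed by (metis imageI)
  ultimately show ?thesis using fin by (simp add: subgrp_def)
qed

lemma sum_free_image:
  fixes e :: "'a \<Rightarrow> 'b::ab_group_add"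
  assumes "group G" and inj: "inj_on e (carrier G)"
    and hom: "\<forall>x\<in>carrier G. \<forall>y\<in>carrier G. e (x \<otimes>\<^bsub>G\<^esub> y) = e x + e y"
    and S: "S \<subseteq> carrier G"
  shows "sumfree (e ` S) \<longleftrightarrow> sum_free G S"
proof -
  interpret group G by fact
  have "e x + e y \<in> e ` S \<longleftrightarrow> x \<otimes>\<^bsub>G\<^esub> y \<in> S" if "x \<in> S" "y \<in> S" for x y
  proof -
    have xy: "x \<in> carrier G" "y \<in> carrier G" using that S by auto
    have "e x + e y = e (x \<otimes>\<^bsub>G\<^esub> y)" using hom xy by simp
    thus ?thesis using inj_on_image_mem_iff[OF inj m_closed[OF xy] S] by simp
  qed
  thus ?thesis using S unfolding sumfree_def sum_free_def by auto
qed

lemma f_max_le_card_msf: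
  fixes e :: "'a \<Rightarrow> 'b::ab_group_add"
  assumes grp: "group G" and fin: "finite (carrier G)" and inj: "inj_on e (carrier G)"
    and hom: "\<forall>x\<in>carrier G. \<forall>y\<in>carrier G. e (x \<otimes>\<^bsub>G\<^esub> y) = e x + e y"
  shows "f_max G \<le> card {S. msf (e ` carrier G) S}"
  unfolding f_max_def
proof (rule card_inj_on_le)
  note sf = sum_free_image[OF grp inj hom]
  have sub: "{S. maximal_sum_free G S} \<subseteq> Pow (carrier G)"
    by (auto simp: maximal_sum_free_def sum_free_def)
  show "inj_on ((`) e) {S. maximal_sum_free G S}"
    by (rule inj_on_subset[OF inj_on_image_Pow[OF inj] sub])
  show "finite {S. msf (e ` carrier G) S}"
    by (rule finite_subset[of _ "Pow (e ` carrier G)"]) (auto simp: msf_def fin)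
  show "(`) e ` {S. maximal_sum_free G S} \<subseteq> {S. msf (e ` carrier G) S}"
  proof (rule image_subsetI, rule CollectI)
    fix S assume "S \<in> {S. maximal_sum_free G S}"
    hence S: "S \<subseteq> carrier G" "sum_free G S" and max: "\<And>T. sum_free G T \<Longrightarrow> S \<subseteq> T \<Longrightarrow> T = S"
      by (auto simp: maximal_sum_free_def sum_free_def)
    show "msf (e ` carrier G) (e ` S)" unfolding msf_def
    proof (intro conjI ballI notI)
      show "e ` S \<subseteq> e ` carrier G" using S(1) by (rule image_mono)
      show "sumfree (e ` S)" using sf[OF S(1)] S(2) by simp
      fix y assume y: "y \<in> e ` carrier G - e ` S" "sumfree (insert y (e ` S))"
      then obtain x where x: "x \<in> carrier G" "y = e x" by auto
      have xS: "insert x S \<subseteq> carrier G" using x S by auto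
      have "sumfree (e ` insert x S)" using y(2) x(2) by simp
      hence "sum_free G (insert x S)" using sf[OF xS] by simp
      from max[OF this] have "x \<in> S" by auto
      thus False using y(1) x(2) by auto
    qed
  qed
qed

section \<open>Lower bound, maximum size and final estimates\<close>

lemma extend_maximal_sum_free:
  assumes "finite (carrier G)" "sum_free G S"
  shows "\<exists>M. maximal_sum_free G M \<and> S \<subseteq> M"
proof -
  let ?A = "{T. sum_free G T}"
  have "finite ?A" by (rule finite_subset[of _ "Pow (carrier G)"]) (auto simp: sum_free_def assms(1))
  moreover have "S \<in> ?A" using assms(2) by simp
  ultimately obtain M where "M \<in> ?A" "S \<subseteq> M" "\<forall>T\<in>?A. M \<subseteq> T \<longrightarrow> M = T"
    using finite_has_maximal2[of ?A S] by blast
  thus ?thesis unfolding maximal_sum_free_def by blast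
qed

text \<open>The coset \<open>{1} \<times> \<dots>\<close> of index three splits into triangles of translates by the element
  \<open>t\<close> of order three; \<open>t\<close> together with a choice of one vertex in every triangle is sum-free,
  and no sum-free set contains \<open>t\<close> and two such choices.\<close>

lemma f_max_ge:
  assumes p: "p > 0"
  shows "3 ^ (23 * p) \<le> f_max (grp p)"
proof -
  let ?Z = "{0..<23::int} \<times> {0..<int p}" and ?G = "carrier (grp p)"
  define t :: "(int \<times> int) \<times> int \<times> int" where "t = ((0, 1), (0, 0))"
  define \<Phi> where "\<Phi> = (?Z \<rightarrow>\<^sub>E {0..<3::int})"
  define S where "S w = insert t ((\<lambda>z. ((1, w z), z)) ` ?Z)" for w :: "int \<times> int \<Rightarrow> int"
  have finG: "finite ?G" by (simp add: carrier_grp[OF p])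
  have "sum_free (grp p) (S w)" if w: "w \<in> \<Phi>" for w
  proof -
    have wz: "w (c, d) \<in> {0..<3}" if "(c, d) \<in> ?Z" for c d using w that by (auto simp: \<Phi>_def)
    have SG: "S w \<subseteq> ?G"
      using wz p by (auto simp: S_def t_def carrier_grp[OF p])
    have nott: "(1 + w (c, d)) mod 3 \<noteq> w (c, d)" if "(c, d) \<in> ?Z" for c d
      using wz[OF that] by presburger
    have "x \<otimes>\<^bsub>grp p\<^esub> y \<notin> S w" if xy: "x \<in> S w" "y \<in> S w" for x y
    proof -
      have tt: "t \<otimes>\<^bsub>grp p\<^esub> t \<notin> S w" by (auto simp: t_def mult_grp S_def)
      have ts: "t \<otimes>\<^bsub>grp p\<^esub> ((1, w (c, d)), (c, d)) \<notin> S w" if "(c, d) \<in> ?Z" for c d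
        using nott[OF that] that by (auto simp: t_def mult_grp S_def)
      have st: "((1, w (c, d)), (c, d)) \<otimes>\<^bsub>grp p\<^esub> t \<notin> S w" if "(c, d) \<in> ?Z" for c d
        using nott[OF that] that by (auto simp: t_def mult_grp S_def add.commute)
      \<comment> \<open>The first coordinate of the sum is 2, whereas on \<open>S w\<close> it is 0
        or 1.\<close>
      have ss: "((1, u), (c, d)) \<otimes>\<^bsub>grp p\<^esub> ((1, v), (c', d')) \<notin> S w" for u v c d c' d'
        by (auto simp: t_def mult_grp S_def)
      have "x = t \<or> (\<exists>c d. (c, d) \<in> ?Z \<and> x = ((1, w (c, d)), (c, d)))" if "x \<in> S w" for x
        using that by (auto simp: S_def)
      from this[OF xy(1)] this[OF xy(2)] show ?thesis
        by (elim disjE exE conjE) (simp_all only: tt ts st ss not_False_eq_True)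
    qed
    thus ?thesis by (rule sum_freeI[OF SG])
  qed
  hence "\<exists>M. maximal_sum_free (grp p) M \<and> S w \<subseteq> M" if "w \<in> \<Phi>" for w
    using extend_maximal_sum_free[OF finG] that by blast
  then obtain M where M: "\<And>w. w \<in> \<Phi> \<Longrightarrow> maximal_sum_free (grp p) (M w)"
    and SM: "\<And>w. w \<in> \<Phi> \<Longrightarrow> S w \<subseteq> M w" by metis
  have inj: "inj_on M \<Phi>"
  proof (rule inj_onI, rule ccontr)
    fix v w assume vw: "v \<in> \<Phi>" "w \<in> \<Phi>" "M v = M w" "v \<noteq> w"
    have "\<exists>z\<in>?Z. v z \<noteq> w z"
    proof (rule ccontr)
      assume "\<not> (\<exists>z\<in>?Z. v z \<noteq> w z)"
      hence "v = w" using vw(1,2) unfolding \<Phi>_def by (intro PiE_ext[of v ?Z _ w]) auto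
      thus False using vw(4) by simp
    qed
    then obtain c d where z: "(c, d) \<in> ?Z" "v (c, d) \<noteq> w (c, d)" by force
    have no: False if "x \<in> M v" "y \<in> M v" "x \<otimes>\<^bsub>grp p\<^esub> y \<in> M v" for x y
    proof -
      have "sum_free (grp p) (M v)" using M[OF vw(1)] by (simp add: maximal_sum_free_def)
      from sum_freeD[OF this that(1,2)] that(3) show False by (rule notE)
    qed
    have mem: "t \<in> M v" "((1, v (c, d)), (c, d)) \<in> M v" "((1, w (c, d)), (c, d)) \<in> M v"
      using SM[OF vw(1)] SM[OF vw(2)] vw(3) z by (auto simp: S_def)
    \<comment> \<open>Two distinct residues modulo 3 differ by one in some direction, so one of the
      two vertices is \<open>t\<close> plus the other.\<close>
    have step: "(1 + a) mod 3 = b \<or> (1 + b) mod 3 = a"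
      if "a \<in> {0..<3}" "b \<in> {0..<3}" "a \<noteq> b" for a b :: int
    proof -
      have "a = 0 \<or> a = 1 \<or> a = 2" "b = 0 \<or> b = 1 \<or> b = 2" using that(1,2) by auto
      thus ?thesis using that(3) by auto
    qed
    have "v (c, d) \<in> {0..<3}" "w (c, d) \<in> {0..<3}" using vw z by (auto simp: \<Phi>_def)
    from step[OF this z(2)]
    show False
    proof
      assume "(1 + v (c, d)) mod 3 = w (c, d)"
      hence "t \<otimes>\<^bsub>grp p\<^esub> ((1, v (c, d)), (c, d)) = ((1, w (c, d)), (c, d))"
        using z by (simp add: t_def mult_grp)
      thus False using no[OF mem(1,2)] mem(3) by simp
    next
      assume "(1 + w (c, d)) mod 3 = v (c, d)"
      hence "t \<otimes>\<^bsub>grp p\<^esub> ((1, w (c, d)), (c, d)) = ((1, v (c, d)), (c, d))"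
        using z by (simp add: t_def mult_grp)
      thus False using no[OF mem(1,3)] mem(2) by simp
    qed
  qed
  have "card \<Phi> \<le> f_max (grp p)" unfolding f_max_def
  proof (rule card_inj_on_le[OF inj])
    show "finite {S. maximal_sum_free (grp p) S}"
      by (rule finite_subset[of _ "Pow ?G"]) (auto simp: maximal_sum_free_def sum_free_def finG)
  qed (use M in auto)
  moreover have "card \<Phi> = 3 ^ (23 * p)" unfolding \<Phi>_def by (simp add: card_PiE card_cartesian_product)
  ultimately show ?thesis by simp
qed

lemma max_sum_free_size_grp:
  assumes p: "prime p" "p \<ge> 29"
  shows "\<mu> (grp p) = 72 * p"
proof -
  have p0: "p > 0" using p by simp
  let ?G = "carrier (grp p)"
  have finG: "finite ?G" by (simp add: carrier_grp[OF p0])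
  have hom: "\<forall>x\<in>carrier (grp p). \<forall>y\<in>carrier (grp p). emb p (x \<otimes>\<^bsub>grp p\<^esub> y) = emb p x + emb p y"
    by (simp add: emb_mult[OF p0])
  note inj = inj_on_emb[OF p0]
  have sg: "subgrp (emb p ` ?G)" by (rule subgrp_image[OF group_grp finG hom])
  have cG: "card (emb p ` ?G) = 207 * p" using card_image[OF inj] order_grp[OF p0] by (simp add: order_def)
  have upper: "card S \<le> 72 * p" if S: "sum_free (grp p) S" for S
  proof -
    have SG: "S \<subseteq> ?G" using S by (simp add: sum_free_def)
    have "sumfree (emb p ` S)" using sum_free_image[OF group_grp inj hom SG] S by simp
    hence "card (emb p ` S) \<le> 72 * p" using card_sumfree_le[OF sg cG p image_mono[OF SG]] by simp
    thus ?thesis using card_image[OF inj_on_subset[OF inj SG]] by simp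
  qed
  \<comment> \<open>The middle third of the residues modulo 23: sums of two of them run from 16 to
    30, that is through 16 to 22 and 0 to 7.\<close>
  let ?S = "({0..<3::int} \<times> {0..<3::int}) \<times> {8..<16::int} \<times> {0..<int p}"
  have sfS: "sum_free (grp p) ?S"
  proof -
    have "?S \<subseteq> ?G" by (auto simp: carrier_grp[OF p0])
    moreover have "x \<otimes>\<^bsub>grp p\<^esub> y \<notin> ?S" if "x \<in> ?S" "y \<in> ?S" for x y
    proof -
      obtain a b c d where x: "x = ((a, b), (c, d))" by (metis surj_pair)
      obtain a' b' c' d' where y: "y = ((a', b'), (c', d'))" by (metis surj_pair)
      have "8 \<le> c" "c < 16" "8 \<le> c'" "c' < 16" using that unfolding x y by auto
      hence "(c + c') mod 23 \<notin> {8..<16}" unfolding atLeastLessThan_iff by presburger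
      thus ?thesis unfolding x y mult_grp by auto
    qed
    ultimately show ?thesis by (rule sum_freeI)
  qed
  have cS: "card ?S = 72 * p" by (simp add: card_cartesian_product)
  have "card ?S \<in> card ` {S. sum_free (grp p) S}" using sfS by (intro imageI CollectI)
  hence mem: "72 * p \<in> card ` {S. sum_free (grp p) S}" unfolding cS .
  show ?thesis unfolding max_sum_free_size_def
  proof (rule Max_eqI[OF _ _ mem])
    show "finite (card ` {S. sum_free (grp p) S})"
      by (rule finite_imageI, rule finite_subset[of _ "Pow ?G"]) (auto simp: sum_free_def finG)
  qed (use upper in auto)
qed

lemma f_max_upper:
  "\<exists>N. \<forall>p. prime p \<longrightarrow> 29 \<le> p \<longrightarrow> N \<le> p \<longrightarrow> real (f_max (grp p)) \<le> 3 powr (25 * (207 * real p) / 216)"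
proof -
  obtain N where "\<forall>(G :: ((qz \<times> qz) \<times> qz \<times> qz) set) p. subgrp G \<longrightarrow> card G = 207 * p \<longrightarrow> prime p \<longrightarrow> 29 \<le> p \<longrightarrow> N \<le> p \<longrightarrow>
     real (card {S. msf G S}) \<le> 3 powr (25 * real (card G) / 216)"
    using card_msf_upper by (elim exE) (rule that)
  note N = this[rule_format]
  have "real (f_max (grp p)) \<le> 3 powr (25 * (207 * real p) / 216)" if p: "prime p" "29 \<le> p" "N \<le> p" for p
  proof -
    have p0: "p > 0" using p by simp
    have finG: "finite (carrier (grp p))" by (simp add: carrier_grp[OF p0])
    have hom: "\<forall>x\<in>carrier (grp p). \<forall>y\<in>carrier (grp p). emb p (x \<otimes>\<^bsub>grp p\<^esub> y) = emb p x + emb p y"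
    by (simp add: emb_mult[OF p0])
    have cG: "card (emb p ` carrier (grp p)) = 207 * p"
      using card_image[OF inj_on_emb[OF p0]] order_grp[OF p0] by (simp add: order_def)
    have "f_max (grp p) \<le> card {S. msf (emb p ` carrier (grp p)) S}"
      by (rule f_max_le_card_msf[OF group_grp finG inj_on_emb[OF p0] hom])
    hence "real (f_max (grp p)) \<le> real (card {S. msf (emb p ` carrier (grp p)) S})" by (rule of_nat_mono)
    also have "\<dots> \<le> 3 powr (25 * real (card (emb p ` carrier (grp p))) / 216)"
      by (rule N[OF subgrp_image[OF group_grp finG hom] cG p])
    also have "real (card (emb p ` carrier (grp p))) = 207 * real p" using cG by simp
    finally show ?thesis .
  qed
  thus ?thesis by (intro exI[of _ N] allI impI)
qed

text \<open>For the finitely many primes below the threshold. Base 3 makes it fit under an error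
  term equal to \<open>n p\<close>.\<close>

lemma f_max_trivial:
  assumes "p > 0" shows "real (f_max (grp p)) \<le> 3 powr (207 * real p)"
proof -
  have finG: "finite (carrier (grp p))" by (simp add: carrier_grp[OF assms])
  have "f_max (grp p) \<le> card (Pow (carrier (grp p)))" unfolding f_max_def
    using finG by (intro card_mono) (auto simp: maximal_sum_free_def sum_free_def)
  also have "\<dots> = 2 ^ (207 * p)" using finG order_grp[OF assms] by (simp add: card_Pow order_def)
  finally have "real (f_max (grp p)) \<le> real (2 ^ (207 * p))" by (rule of_nat_mono)
  also have "\<dots> \<le> 3 ^ (207 * p)" by (simp add: power_mono)
  also have "\<dots> = 3 powr (207 * real p)" by (simp add: powr_realpow[symmetric])
  finally show ?thesis .
qed

lemma eventually_primes_at_top_ge: "eventually (\<lambda>p. N \<le> p) primes_at_top"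
  unfolding primes_at_top_def by (rule filter_leD[OF inf_le1 eventually_ge_at_top])

theorem theorem3p1:
  fixes n :: "nat \<Rightarrow> nat"
  assumes n: "\<And>p. n p = order (grp p)"
  shows
    "(\<forall>p. prime p \<and> p \<ge> 29 \<longrightarrow>
        n p = 207 * p \<and>
        2 powr (real (\<mu> (grp p)) / 2) = 2 powr (4 * real (n p) / 23) \<and>
        3 powr (real (n p) / 9) \<le> real (f_max (grp p)) \<and>
        3 powr (8 * real (n p) / 69) = 3 powr (real (\<mu> (grp p)) / 3)) \<and>
     exp_smaller n (\<lambda>p. 2 powr (4 * real (n p) / 23)) (\<lambda>p. 3 powr (real (n p) / 9)) \<and>
     (\<exists>\<epsilon> :: nat \<Rightarrow> real. \<epsilon> \<in> o[primes_at_top](\<lambda>p. real (n p)) \<and>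
        (\<forall>p. prime p \<and> p \<ge> 29 \<longrightarrow>
           real (f_max (grp p)) \<le> 3 powr (25 * real (n p) / 216 + \<epsilon> p)) \<and>
        exp_smaller n (\<lambda>p. 3 powr (25 * real (n p) / 216 + \<epsilon> p))
                      (\<lambda>p. 3 powr (8 * real (n p) / 69)))"
proof -
  have np: "n p = 207 * p" if "p > 0" for p using n order_grp[OF that] by simp
  obtain N where N: "\<And>p. prime p \<Longrightarrow> 29 \<le> p \<Longrightarrow> N \<le> p \<Longrightarrow>
      real (f_max (grp p)) \<le> 3 powr (25 * (207 * real p) / 216)"
    using f_max_upper by blast
  \<comment> \<open>Only finitely many values are nonzero, so the error term is o(n) at
    once.\<close>
  define \<epsilon> where "\<epsilon> p = (if p < N then real (n p) else 0)" for p
  show ?thesis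
  proof (intro conjI exI[of _ \<epsilon>] allI impI)
    fix p :: nat assume p: "prime p \<and> p \<ge> 29"
    hence p0: "p > 0" by simp
    show "n p = 207 * p" by (rule np[OF p0])
    have mu: "\<mu> (grp p) = 72 * p" using p by (intro max_sum_free_size_grp) auto
    show "2 powr (real (\<mu> (grp p)) / 2) = 2 powr (4 * real (n p) / 23)"
      and "3 powr (8 * real (n p) / 69) = 3 powr (real (\<mu> (grp p)) / 3)"
      using mu np[OF p0] by simp_all
    have "3 powr (real (n p) / 9) = 3 powr (real (23 * p))" using np[OF p0] by simp
    also have "\<dots> = real (3 ^ (23 * p))" by (simp only: powr_realpow) simp
    also have "\<dots> \<le> real (f_max (grp p))" by (rule of_nat_mono[OF f_max_ge[OF p0]])
    finally show "3 powr (real (n p) / 9) \<le> real (f_max (grp p))" .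
  next
    fix p :: nat assume p: "prime p \<and> p \<ge> 29"
    hence p0: "p > 0" by simp
    show "real (f_max (grp p)) \<le> 3 powr (25 * real (n p) / 216 + \<epsilon> p)"
    proof (cases "p < N")
      case True
      have "real (f_max (grp p)) \<le> 3 powr (207 * real p)" by (rule f_max_trivial[OF p0])
      also have "\<dots> \<le> 3 powr (25 * real (n p) / 216 + \<epsilon> p)"
        using True np[OF p0] by (intro powr_mono) (auto simp: \<epsilon>_def)
      finally show ?thesis .
    next
      case False
      thus ?thesis using N[of p] p np[OF p0] by (simp add: \<epsilon>_def)
    qed
  next
    show "exp_smaller n (\<lambda>p. 2 powr (4 * real (n p) / 23)) (\<lambda>p. 3 powr (real (n p) / 9))"
      unfolding exp_smaller_def
    proof (intro exI[of _ "ln 3 / 9 - 4 * ln 2 / 23"] conjI always_eventually allI)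
      \<comment> \<open>Positivity amounts to 36 ln 2 < 23 ln 3, which \<open>ln3_ln2\<close> gives
        after division by five. At this rate the comparison is an equality.\<close>
      show "ln 3 / 9 - 4 * ln 2 / 23 > (0::real)" using ln3_ln2 ln2_bounds by simp
      show "2 powr (4 * real (n p) / 23) \<le> exp (- (ln 3 / 9 - 4 * ln 2 / 23) * real (n p)) * 3 powr (real (n p) / 9)" for p
        by (simp add: powr_def algebra_simps flip: exp_add)
    qed
  next
    show "\<epsilon> \<in> o[primes_at_top](\<lambda>p. real (n p))"
    proof (rule landau_o.smallI)
      fix c :: real assume "c > 0"
      show "\<forall>\<^sub>F p in primes_at_top. norm (\<epsilon> p) \<le> c * norm (real (n p))"
        by (rule eventually_mono[OF eventually_primes_at_top_ge[of N]]) (use \<open>c > 0\<close> in \<open>auto simp: \<epsilon>_def\<close>)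
    qed
  next
    show "exp_smaller n (\<lambda>p. 3 powr (25 * real (n p) / 216 + \<epsilon> p)) (\<lambda>p. 3 powr (8 * real (n p) / 69))"
      unfolding exp_smaller_def
    proof (intro exI[of _ "(8 / 69 - 25 / 216) * ln 3"] conjI)
      \<comment> \<open>A narrow gap: 8 * 216 = 1728 against 25 * 69 = 1725.\<close>
      show "(8 / 69 - 25 / 216) * ln 3 > (0::real)" by simp
      show "\<forall>\<^sub>F p in primes_at_top. 3 powr (25 * real (n p) / 216 + \<epsilon> p)
          \<le> exp (- ((8 / 69 - 25 / 216) * ln 3) * real (n p)) * 3 powr (8 * real (n p) / 69)"
        by (rule eventually_mono[OF eventually_primes_at_top_ge[of N]])
          (simp add: \<epsilon>_def powr_def algebra_simps flip: exp_add)
    qed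
  qed
qed

end
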